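(* Let $0<\alpha\le 2$, let $\beta_1,\beta_2>\frac1\alpha$, and let $X_{k,l}=\sum_{i,j=0}^\infty c_{i,j}\varepsilon_{k-i,l-j}$, $(k,l)\in\mathbb Z^2$, be a linear random field with i.i.d. symmetric $\alpha$-stable innovations $\varepsilon_{k,l}$ (characteristic function $\theta\mapsto e^{-|\theta|^\alpha}$) and coefficients $$c_{i,j}=w_{(i,j)}(1+i)^{-\beta_1}(1+j)^{-\beta_2},\qquad i,j\ge 0,$$ where the $w_{(i,j)}$ are nonzero real numbers such that: (A1) $\lim_{i,j\to\infty}w_{(i,j)}=1$ (as $\min(i,j)\to\infty$); (A2) for every $i\ge 0$ the limit $w_{(i,\infty)}:=\lim_{j\to\infty}w_{(i,j)}$ exists and is $>0$; (A3) for every $j\ge 0$ the limit $w_{(\infty,j)}:=\lim_{i\to\infty}w_{(i,j)}$ exists and is $>0$. For positive integers $n,m$ let $\rho(n,-m)=\rho(X_{0,0},X_{n,-m})$ be the spectral covariance. Below, $n,m\to\infty$ means $\min(n,m)\to\infty$, and $(m_n)$ denotes a sequence of positive integers; the sub-cases (a), (b), (c) in items 4–9 are as follows: (a) $\frac{m_n^{-\beta_2}}{n^{-\beta_1}}\to 0$; (b) $\frac{m_n^{-\beta_2}}{n^{-\beta_1}}\to c\in(0,\infty)$; (c) $m_n\to\infty$ and $\frac{m_n^{-\beta_2}}{n^{-\beta_1}}\to\infty$, all as $n\to\infty$. Then the following hold. 1. If $1<\alpha\le 2$, $\frac1{\beta_1}+\frac1{\beta_2}>\alpha$ and $\frac1\alpha<\beta_i<\frac1{\alpha-1}$,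 $i=1,2$, or if $0<\alpha\le 1$ and $\frac1{\beta_1}+\frac1{\beta_2}>\alpha$, then $$\lim_{n,m\to\infty}\frac{\rho(n,-m)}{n^{1-\beta_1\alpha}m^{1-\beta_2\alpha}}=\int_0^\infty\int_0^\infty V\big((1+u)^{-\beta_1}v^{-\beta_2},\,u^{-\beta_1}(1+v)^{-\beta_2}\big)\,du\,dv.$$ 2. If $1<\alpha\le 2$, $\frac1{\alpha-1}<\beta_1$ and $\frac1\alpha<\beta_2<1$, then $$\lim_{n,m\to\infty}\frac{\rho(n,-m)}{n^{-\beta_1}m^{1-\beta_2\alpha}}=\sum_{i=0}^\infty w_{(i,\infty)}^{\alpha-1}(1+i)^{-\beta_1(\alpha-1)}\int_0^\infty v^{-\beta_2}(1+v)^{-\beta_2(\alpha-1)}\,dv.$$ 3. If $1<\alpha\le 2$, $\beta_1=\frac1{\alpha-1}$ and $\frac1\alpha<\beta_2<1$, then $$\lim_{n,m\to\infty}\frac{\rho(n,-m)}{n^{1-\beta_1\alpha}m^{1-\beta_2\alpha}\ln(n)}=\int_0^\infty v^{-\beta_2}(1+v)^{-\beta_2(\alpha-1)}\,dv.$$ 4. If $1<\alpha\le 2$ and $\frac1{\alpha-1}<\beta_i$, $i=1,2$: - in case (a), $\displaystyle\lim_{n\to\infty}\frac{\rho(n,-m_n)}{n^{-\beta_1(\alpha-1)}m_n^{-\beta_2}}=\sum_{i=0}^\infty\sum_{j=0}^\infty w_{(\infty,j)}^{\alpha-1}w_{(i,\infty)}(1+j)^{-\beta_2(\alpha-1)}(1+i)^{-\beta_1}$;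 - in case (b), $\displaystyle\lim_{n\to\infty}\frac{\rho(n,-m_n)}{n^{-\beta_1(\alpha-1)}m_n^{-\beta_2}}=\frac1c\sum_{i=0}^\infty\sum_{j=0}^\infty V\big(w_{(\infty,j)}(1+j)^{-\beta_2},\,c\,w_{(i,\infty)}(1+i)^{-\beta_1}\big)$; - in case (c), $\displaystyle\lim_{n\to\infty}\frac{\rho(n,-m_n)}{n^{-\beta_1}m_n^{-\beta_2(\alpha-1)}}=\sum_{i=0}^\infty\sum_{j=0}^\infty w_{(\infty,j)}w_{(i,\infty)}^{\alpha-1}(1+j)^{-\beta_2}(1+i)^{-\beta_1(\alpha-1)}$. 5. If $1<\alpha<2$, $\frac1{\alpha-1}<\beta_1$ and $1<\beta_2<\frac1{\alpha-1}$: - in case (a), $\displaystyle\lim_{n\to\infty}\frac{\rho(n,-m_n)}{n^{-\beta_1/\beta_2}m_n^{1-\beta_2\alpha}}=\sum_{i=0}^\infty\int_0^\infty V\big(v^{-\beta_2},\,w_{(i,\infty)}(1+i)^{-\beta_1}\big)\,dv$; - in case (b), $\displaystyle\lim_{n\to\infty}\frac{\rho(n,-m_n)}{n^{-\beta_1}m_n^{-\beta_2(\alpha-1)}}=c\sum_{i=0}^\infty\sum_{j=0}^\infty V\big(w_{(\infty,j)}c^{-1}(1+j)^{-\beta_2},\,w_{(i,\infty)}(1+i)^{-\beta_1}\big)$; - in case (c), $\displaystyle\lim_{n\to\infty}\frac{\rho(n,-m_n)}{n^{-\beta_1}m_n^{-\beta_2(\alpha-1)}}=\sum_{i=0}^\infty\sum_{j=0}^\infty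 w_{(\infty,j)}w_{(i,\infty)}^{\alpha-1}(1+j)^{-\beta_2}(1+i)^{-\beta_1(\alpha-1)}$. 6. If $1<\alpha<2$, $1<\beta_i<\frac1{\alpha-1}$, $i=1,2$, and $\frac1{\beta_1}+\frac1{\beta_2}<\alpha$, or if $0<\alpha\le 1$ and $\frac1{\beta_1}+\frac1{\beta_2}<\alpha$: - in case (a), $\displaystyle\lim_{n\to\infty}\frac{\rho(n,-m_n)}{n^{-\beta_1/\beta_2}m_n^{1-\beta_2\alpha}}=\sum_{i=0}^\infty\int_0^\infty V\big(v^{-\beta_2},\,w_{(i,\infty)}(1+i)^{-\beta_1}\big)\,dv$; - in case (b), $\displaystyle\lim_{n\to\infty}\frac{\rho(n,-m_n)}{n^{-\beta_1(\alpha-1)}m_n^{-\beta_2}}=\frac1c\sum_{i=0}^\infty\sum_{j=0}^\infty V\big(w_{(\infty,j)}(1+j)^{-\beta_2},\,c\,w_{(i,\infty)}(1+i)^{-\beta_1}\big)$; - in case (c), $\displaystyle\lim_{n\to\infty}\frac{\rho(n,-m_n)}{n^{1-\beta_1\alpha}m_n^{-\beta_2/\beta_1}}=\sum_{j=0}^\infty\int_0^\infty V\big(u^{-\beta_1},\,w_{(\infty,j)}(1+j)^{-\beta_2}\big)\,du$. 7. If $1<\alpha<2$, $\frac1{\alpha-1}<\beta_1$ and $\beta_2=\frac1{\alpha-1}$: - in case (a), $\displaystyle\lim_{n\to\infty}\frac{\rho(n,-m_n)}{n^{-\beta_1/\beta_2}m_n^{1-\beta_2\alpha}\ln\big(n^{-\beta_1/\beta_2}m_n\big)}=\sum_{i=0}^\infty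 w_{(i,\infty)}(1+i)^{-\beta_1}$; - in case (b), $\displaystyle\lim_{n\to\infty}\frac{\rho(n,-m_n)}{n^{-\beta_1}m_n^{-\beta_2(\alpha-1)}}=c\sum_{i=0}^\infty\sum_{j=0}^\infty V\big(w_{(\infty,j)}c^{-1}(1+j)^{-\beta_2},\,w_{(i,\infty)}(1+i)^{-\beta_1}\big)$; - in case (c), $\displaystyle\lim_{n\to\infty}\frac{\rho(n,-m_n)}{n^{-\beta_1}m_n^{-\beta_2(\alpha-1)}}=\sum_{i=0}^\infty\sum_{j=0}^\infty w_{(\infty,j)}w_{(i,\infty)}^{\alpha-1}(1+j)^{-\beta_2}(1+i)^{-\beta_1(\alpha-1)}$. 8. If $1<\alpha<2$, $\beta_1=\frac1{\alpha-1}$ and $1<\beta_2<\frac1{\alpha-1}$: - in case (a), $\displaystyle\lim_{n\to\infty}\frac{\rho(n,-m_n)}{n^{-\beta_1/\beta_2}m_n^{1-\beta_2\alpha}}=\sum_{i=0}^\infty\int_0^\infty V\big(w_{(i,\infty)}(1+i)^{-\beta_1},\,s^{-\beta_2}\big)\,ds$; - in case (b), $\displaystyle\lim_{n\to\infty}\frac{\rho(n,-m_n)}{n^{-\beta_1}m_n^{-\beta_2(\alpha-1)}}=c\sum_{i=0}^\infty\sum_{j=0}^\infty V\big(w_{(\infty,j)}c^{-1}(1+j)^{-\beta_2},\,w_{(i,\infty)}(1+i)^{-\beta_1}\big)$; - in case (c), $\displaystyle\lim_{n\to\infty}\frac{\rho(n,-m_n)}{n^{1-\beta_1\alpha}m_n^{-\beta_2/\beta_1}\ln\big(n\,m_n^{-\beta_2/\beta_1}\big)}=\sum_{j=0}^\infty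 w_{(\infty,j)}(1+j)^{-\beta_2}$. 9. If $1<\alpha<2$ and $\beta_i=\frac1{\alpha-1}$, $i=1,2$: - in case (a), $\displaystyle\lim_{n\to\infty}\frac{\rho(n,-m_n)}{n^{-\beta_1/\beta_2}m_n^{1-\beta_2\alpha}\ln\big(n^{-\beta_1/\beta_2}m_n\big)}=\sum_{i=0}^\infty w_{(i,\infty)}(1+i)^{-\beta_1}$; - in case (b), $\displaystyle\lim_{n\to\infty}\frac{\rho(n,-m_n)}{n^{-\beta_1}m_n^{-\beta_2(\alpha-1)}}=c\sum_{i=0}^\infty\sum_{j=0}^\infty V\big(w_{(\infty,j)}c^{-1}(1+j)^{-\beta_2},\,w_{(i,\infty)}(1+i)^{-\beta_1}\big)$; - in case (c), $\displaystyle\lim_{n\to\infty}\frac{\rho(n,-m_n)}{n^{1-\beta_1\alpha}m_n^{-\beta_2/\beta_1}\ln\big(n\,m_n^{-\beta_2/\beta_1}\big)}=\sum_{j=0}^\infty w_{(\infty,j)}(1+j)^{-\beta_2}$.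
   Context: Notation: for the given $\alpha\in(0,2]$, $$V(x,y)=\frac{xy}{(x^2+y^2)^{(2-\alpha)/2}}\ \text{ if }x^2+y^2>0,\qquad V(0,0)=0.$$ Spectral covariance: for $0<\alpha<2$, a symmetric $\alpha$-stable random vector $(X_1,X_2)$ has characteristic function $\exp\{-\int_{S^1}|\theta_1s_1+\theta_2s_2|^\alpha\,\Gamma(ds)\}$ with a unique symmetric finite measure $\Gamma$ (the spectral measure) on the unit circle $S^1\subset\mathbb R^2$, and its spectral covariance is $\rho(X_1,X_2)=\int_{S^1}s_1s_2\,\Gamma(ds)$. For the field considered here, and $n,m>0$, the spectral covariance $\rho(n,-m)=\rho(X_{0,0},X_{n,-m})$ is given by the (absolutely convergent) series $$\rho(n,-m)=\sum_{i=0}^\infty\sum_{j=0}^\infty V(c_{i+n,j},c_{i,j+m}).$$ For $\alpha=2$ (Gaussian case, where the spectral measure is not unique) $\rho(n,-m)$ is understood as this series. The condition $\beta_1,\beta_2>1/\alpha$ ensures $\sum_{i,j}|c_{i,j}|^\alpha<\infty$, so that the field is well defined. *)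

theory Defs
  imports "HOL-Probability.Probability"
begin

definition V :: "real \<Rightarrow> real \<Rightarrow> real \<Rightarrow> real" where
  "V \<alpha> x y = (if x\<^sup>2 + y\<^sup>2 > 0 then x * y / (x\<^sup>2 + y\<^sup>2) powr ((2 - \<alpha>) / 2) else 0)"

definition field_coeff :: "real \<Rightarrow> real \<Rightarrow> (nat \<Rightarrow> nat \<Rightarrow> real) \<Rightarrow> nat \<Rightarrow> nat \<Rightarrow> real" where
  "field_coeff \<beta>1 \<beta>2 w i j = w i j * (1 + real i) powr (-\<beta>1) * (1 + real j) powr (-\<beta>2)"

definition iid_sas_innovations ::
  "'a measure \<Rightarrow> real \<Rightarrow> (int \<times> int \<Rightarrow> 'a \<Rightarrow> real) \<Rightarrow> bool" where
  "iid_sas_innovations M \<alpha> \<epsilon> \<longleftrightarrow>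
     prob_space.indep_vars M (\<lambda>_. borel) \<epsilon> UNIV \<and>
     (\<forall>p t. char (distr M borel (\<epsilon> p)) t = complex_of_real (exp (- (\<bar>t\<bar> powr \<alpha>))))"

(* The series defining X k l is not almost surely absolutely convergent in general;
   it is read as an unconditional limit in probability of its finite partial sums. *)
definition linear_random_field ::
  "'a measure \<Rightarrow> (nat \<Rightarrow> nat \<Rightarrow> real) \<Rightarrow> (int \<times> int \<Rightarrow> 'a \<Rightarrow> real)
     \<Rightarrow> (int \<Rightarrow> int \<Rightarrow> 'a \<Rightarrow> real) \<Rightarrow> bool" where
  "linear_random_field M c \<epsilon> X \<longleftrightarrow>
     (\<forall>k l. X k l \<in> borel_measurable M \<and>
        (\<forall>e>0. ((\<lambda>F. measure M {\<omega> \<in> space M.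
                   \<bar>(\<Sum>(i, j)\<in>F. c i j * \<epsilon> (k - int i, l - int j) \<omega>) - X k l \<omega>\<bar> > e})
                 \<longlongrightarrow> 0) (finite_subsets_at_top UNIV)))"

(* The norm on real \<times> real is the Euclidean one, so sphere 0 1 is the unit circle. *)
definition is_spectral_measure ::
  "'a measure \<Rightarrow> real \<Rightarrow> ('a \<Rightarrow> real) \<Rightarrow> ('a \<Rightarrow> real) \<Rightarrow> (real \<times> real) measure \<Rightarrow> bool" where
  "is_spectral_measure M \<alpha> X1 X2 \<Gamma> \<longleftrightarrow>
     space \<Gamma> = sphere 0 1 \<and>
     sets \<Gamma> = sets (restrict_space borel (sphere 0 1)) \<and>
     finite_measure \<Gamma> \<and>
     (\<forall>A\<in>sets \<Gamma>. emeasure \<Gamma> (uminus ` A) = emeasure \<Gamma> A) \<and>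
     (\<forall>\<theta>1 \<theta>2.
        (LINT \<omega>|M. iexp (\<theta>1 * X1 \<omega> + \<theta>2 * X2 \<omega>)) =
        complex_of_real (exp (- (LINT s|\<Gamma>. \<bar>\<theta>1 * fst s + \<theta>2 * snd s\<bar> powr \<alpha>))))"

(* For 0 < \<alpha> < 2 the symmetric spectral measure is unique, so the choice is immaterial. *)
definition spectral_measure ::
  "'a measure \<Rightarrow> real \<Rightarrow> ('a \<Rightarrow> real) \<Rightarrow> ('a \<Rightarrow> real) \<Rightarrow> (real \<times> real) measure" where
  "spectral_measure M \<alpha> X1 X2 = (SOME \<Gamma>. is_spectral_measure M \<alpha> X1 X2 \<Gamma>)"

definition spectral_covariance ::
  "'a measure \<Rightarrow> real \<Rightarrow> ('a \<Rightarrow> real) \<Rightarrow> ('a \<Rightarrow> real) \<Rightarrow> real" where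
  "spectral_covariance M \<alpha> X1 X2 = (LINT s|spectral_measure M \<alpha> X1 X2. fst s * snd s)"

(* field_rho M \<alpha> c X n m stands for \<rho>(n,-m). In the Gaussian case \<alpha> = 2 the spectral
   measure is not unique and \<rho>(n,-m) is by convention the series below, which for \<alpha> < 2
   represents the spectral covariance. *)
definition field_rho ::
  "'a measure \<Rightarrow> real \<Rightarrow> (nat \<Rightarrow> nat \<Rightarrow> real) \<Rightarrow> (int \<Rightarrow> int \<Rightarrow> 'a \<Rightarrow> real) \<Rightarrow> nat \<Rightarrow> nat \<Rightarrow> real"
  where
  "field_rho M \<alpha> c X n m =
     (if \<alpha> < 2 then spectral_covariance M \<alpha> (X 0 0) (X (int n) (- int m))
      else (\<Sum>\<^sub>\<infinity>(i, j)\<in>UNIV. V \<alpha> (c (i + n) j) (c i (j + m))))"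

definition case_a :: "real \<Rightarrow> real \<Rightarrow> (nat \<Rightarrow> nat) \<Rightarrow> bool" where
  "case_a \<beta>1 \<beta>2 m \<longleftrightarrow> (\<lambda>n. real (m n) powr (-\<beta>2) / real n powr (-\<beta>1)) \<longlonglongrightarrow> 0"

definition case_b :: "real \<Rightarrow> real \<Rightarrow> (nat \<Rightarrow> nat) \<Rightarrow> real \<Rightarrow> bool" where
  "case_b \<beta>1 \<beta>2 m c \<longleftrightarrow>
     0 < c \<and> (\<lambda>n. real (m n) powr (-\<beta>2) / real n powr (-\<beta>1)) \<longlonglongrightarrow> c"

definition case_c :: "real \<Rightarrow> real \<Rightarrow> (nat \<Rightarrow> nat) \<Rightarrow> bool" where
  "case_c \<beta>1 \<beta>2 m \<longleftrightarrow>
     filterlim m at_top sequentially \<and>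
     filterlim (\<lambda>n. real (m n) powr (-\<beta>2) / real n powr (-\<beta>1)) at_top sequentially"

(* HOL integrals and sums are 0 when they do not converge. The following predicates also assert
   convergence of the right-hand side of a limit statement F \<longlongrightarrow> (sum or integral). All summands
   and integrands they are applied to are nonnegative, so absolute convergence and
   convergence of the iterated expressions coincide. *)
definition lim_series :: "('b \<Rightarrow> real) \<Rightarrow> 'b filter \<Rightarrow> real \<Rightarrow> ('i \<Rightarrow> real) \<Rightarrow> bool" where
  "lim_series f F a g \<longleftrightarrow> g summable_on UNIV \<and> (f \<longlongrightarrow> a * (\<Sum>\<^sub>\<infinity>i\<in>UNIV. g i)) F"

definition lim_series_integral ::
  "('b \<Rightarrow> real) \<Rightarrow> 'b filter \<Rightarrow> (nat \<Rightarrow> real \<Rightarrow> real) \<Rightarrow> bool" where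
  "lim_series_integral f F g \<longleftrightarrow>
     (\<forall>i. set_integrable lborel {0<..} (g i)) \<and>
     lim_series f F 1 (\<lambda>i. LINT v:{0<..}|lborel. g i v)"

end

(* For 0 < alpha < 2 the angular average of |a cos t + b sin t|^alpha sin 2t is a positive
   multiple of V(a,b). Hence the integral of V against a spectral measure is determined by the
   characteristic function, and comparing the spectral measure with the discrete measure of
   coefficient pairs identifies rho(n,-m) with the double series of V(c(i+n,j), c(i,j+m)).

   For the asymptotics, |V(x,y)| <= |x|^a |y|^(alpha-a) whenever alpha-1 <= a <= 1, so the summands
   are dominated by products of a function of i and a function of j. In each regime an index is
   either kept, rescaled linearly (i = s u), or rescaled exponentially (i = s^t - 1, which
   produces the logarithms); the series becomes an integral over the quadrant, and a suitable a
   (below and above the critical value, where two are needed) gives an integrable majorant. The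
   pointwise limits follow from the homogeneity of V. The remaining regimes are obtained by
   exchanging the two coordinates. *)

theory Submission
  imports Defs
begin

section \<open>Pointwise bounds and scaling of the kernel V\<close>

section \<open>The kernel\<close>

text \<open>The exponent a in the bound for V is the one free parameter. For lags N, M it splits the
  majorant into an i-part (1+i+N)^(-beta1 a) (1+i)^(-beta1 (alpha-a)) and a j-part (1+j+M)^(-beta2
  (alpha-a)) (1+j)^(-beta2 a). An index may stay unscaled when its unshifted power is summable
  (beta1 (alpha-a) > 1, respectively beta2 a > 1) and is scaled by its own lag under the reverse
  strict inequality. As a ranges over [alpha-1, 1], this is where the thresholds 1/(alpha-1), 1 and
  1/beta1 + 1/beta2 = alpha come from; equality with 1/(alpha-1) can produce a logarithm.

  The intermediate scale s = M N^(-beta1/beta2) solves N^(-beta1) s^(-beta2) = M^(-beta2): for j of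
  order s and fixed i the two arguments of V have equal order.

  The conditions on w yield boundedness and pointwise limits but no rates, so every limit goes
  through dominated convergence. The spectral measure is obtained by choice; its properties become
  available only once some measure with the required characteristic function has been
  exhibited.\<close>

lemma V_eq: "V \<alpha> x y = x * y / (x\<^sup>2 + y\<^sup>2) powr ((2 - \<alpha>) / 2)"
  by (auto simp: V_def not_less sum_power2_le_zero_iff)

lemma V_commute: "V \<alpha> x y = V \<alpha> y x"
  by (simp add: V_eq add.commute mult.commute)

lemma V_zero [simp]: "V \<alpha> 0 y = 0" "V \<alpha> x 0 = 0"
  by (simp_all add: V_eq)

lemma V_measurable [measurable]:
  assumes [measurable]: "f \<in> borel_measurable M" "g \<in> borel_measurable M"
  shows "(\<lambda>x. V \<alpha> (f x) (g x)) \<in> borel_measurable M"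
  unfolding V_eq by measurable

text \<open>With r the Euclidean norm of (x, y), the product |x| |y| equals the right-hand side
  times |x|^(1-a) |y|^(1-alpha+a). The range of a makes both leftover exponents nonnegative, so this
  leftover is at most r^(2-alpha), which is the denominator of V.\<close>

lemma V_bound:
  assumes "\<alpha> - 1 \<le> a" "a \<le> 1"
  shows "\<bar>V \<alpha> x y\<bar> \<le> \<bar>x\<bar> powr a * \<bar>y\<bar> powr (\<alpha> - a)"
proof (cases "x = 0 \<or> y = 0")
  case False
  define r where "r = sqrt (x\<^sup>2 + y\<^sup>2)"
  have r: "r > 0" "\<bar>x\<bar> \<le> r" "\<bar>y\<bar> \<le> r"
    using False by (auto simp: r_def sum_power2_gt_zero_iff real_le_rsqrt)
  have den: "(x\<^sup>2 + y\<^sup>2) powr ((2 - \<alpha>) / 2) = r powr (2 - \<alpha>)"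
    by (simp add: r_def powr_powr flip: powr_half_sqrt)
  have "\<bar>x\<bar> * \<bar>y\<bar> = (\<bar>x\<bar> powr a * \<bar>x\<bar> powr (1 - a)) * (\<bar>y\<bar> powr (\<alpha> - a) * \<bar>y\<bar> powr (1 - \<alpha> + a))"
    using False by (simp flip: powr_add)
  also have "\<dots> = (\<bar>x\<bar> powr a * \<bar>y\<bar> powr (\<alpha> - a)) * (\<bar>x\<bar> powr (1 - a) * \<bar>y\<bar> powr (1 - \<alpha> + a))"
    by simp
  also have "\<dots> \<le> (\<bar>x\<bar> powr a * \<bar>y\<bar> powr (\<alpha> - a)) * (r powr (1 - a) * r powr (1 - \<alpha> + a))"
    using assms r by (intro mult_left_mono mult_mono powr_mono2) auto
  also have "r powr (1 - a) * r powr (1 - \<alpha> + a) = r powr (2 - \<alpha>)"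
    using r by (simp flip: powr_add)
  finally show ?thesis
    using r by (simp add: V_eq den abs_mult field_simps)
qed auto

text \<open>Factoring B^2 out of the denominator leaves only the ratio \<open>A / B\<close>. Here A
  and B are the orders of the two arguments, and \<open>A * B powr (\<alpha> - 1)\<close> is the
  order of V when the second argument is not the smaller one.\<close>

lemma V_scaled:
  assumes "A > 0" "B > 0"
  shows "V \<alpha> (A * \<xi>) (B * \<eta>) / (A * B powr (\<alpha> - 1)) =
    \<xi> * \<eta> / ((A / B * \<xi>)\<^sup>2 + \<eta>\<^sup>2) powr ((2 - \<alpha>) / 2)"
proof -
  have "(A * \<xi>)\<^sup>2 + (B * \<eta>)\<^sup>2 = B\<^sup>2 * ((A / B * \<xi>)\<^sup>2 + \<eta>\<^sup>2)"
    using assms by (simp add: field_simps power2_eq_square)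
  moreover have "(B\<^sup>2) powr ((2 - \<alpha>) / 2) = B powr (2 - \<alpha>)"
    using assms by (simp add: powr_powr diff_divide_distrib algebra_simps flip: powr_numeral)
  moreover have "B powr (2 - \<alpha>) * B powr (\<alpha> - 1) = B"
    using assms by (simp flip: powr_add)
  ultimately show ?thesis
  proof -
    assume "(A * \<xi>)\<^sup>2 + (B * \<eta>)\<^sup>2 = B\<^sup>2 * ((A / B * \<xi>)\<^sup>2 + \<eta>\<^sup>2)"
      and B2: "(B\<^sup>2) powr ((2 - \<alpha>) / 2) = B powr (2 - \<alpha>)" "B powr (2 - \<alpha>) * B powr (\<alpha> - 1) = B"
    then have "V \<alpha> (A * \<xi>) (B * \<eta>) = (A * \<xi>) * (B * \<eta>) /
        (B powr (2 - \<alpha>) * ((A / B * \<xi>)\<^sup>2 + \<eta>\<^sup>2) powr ((2 - \<alpha>) / 2))"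
      using assms by (simp only: V_eq powr_mult)
    moreover have "A * \<xi> * (B * \<eta>) / (b * W) / (A * b') = \<xi> * \<eta> / W" if "b * b' = B" "b' \<noteq> 0" "b \<noteq> 0" for b b' W
      using that assms by (cases "W = 0") (auto simp: field_simps)
    ultimately show ?thesis
      using assms B2 by simp
  qed
qed

text \<open>The hypothesis \<open>\<eta>0 > 0\<close> keeps the limiting denominator positive even
  for \<open>\<kappa> = 0\<close>, the case in which the first argument is negligible against the
  second.\<close>

lemma V_scaled_tendsto:
  fixes A B \<xi> \<eta> :: "nat \<Rightarrow> real"
  assumes pos: "\<forall>\<^sub>F k in sequentially. A k > 0 \<and> B k > 0"
    and AB: "(\<lambda>k. A k / B k) \<longlonglongrightarrow> \<kappa>" and lim: "\<xi> \<longlonglongrightarrow> \<xi>0" "\<eta> \<longlonglongrightarrow> \<eta>0" and "\<eta>0 > 0"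
  shows "(\<lambda>k. V \<alpha> (A k * \<xi> k) (B k * \<eta> k) / (A k * B k powr (\<alpha> - 1))) \<longlonglongrightarrow>
    \<xi>0 * \<eta>0 / ((\<kappa> * \<xi>0)\<^sup>2 + \<eta>0\<^sup>2) powr ((2 - \<alpha>) / 2)"
proof (rule Lim_transform_eventually)
  have "(\<kappa> * \<xi>0)\<^sup>2 + \<eta>0\<^sup>2 > 0"
    using \<open>\<eta>0 > 0\<close> by (simp add: add_nonneg_pos)
  then show "(\<lambda>k. \<xi> k * \<eta> k / ((A k / B k * \<xi> k)\<^sup>2 + (\<eta> k)\<^sup>2) powr ((2 - \<alpha>) / 2)) \<longlonglongrightarrow>
      \<xi>0 * \<eta>0 / ((\<kappa> * \<xi>0)\<^sup>2 + \<eta>0\<^sup>2) powr ((2 - \<alpha>) / 2)"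
    by (intro tendsto_intros AB lim) (auto intro: less_imp_neq)
  show "\<forall>\<^sub>F k in sequentially. \<xi> k * \<eta> k / ((A k / B k * \<xi> k)\<^sup>2 + (\<eta> k)\<^sup>2) powr ((2 - \<alpha>) / 2) =
      V \<alpha> (A k * \<xi> k) (B k * \<eta> k) / (A k * B k powr (\<alpha> - 1))"
    using pos by eventually_elim (rule V_scaled[symmetric], auto)
qed

section \<open>Sums over indices as integrals over cells of unit mass\<close>

section \<open>Series as integrals\<close>

text \<open>Under \<open>unit_cells \<phi> \<phi>'\<close> the substitution \<open>i = nat \<lfloor>\<phi> u\<rfloor>\<close> with weight \<open>\<phi>'\<close> turns a sum over \<open>i\<close> into
  an integral over \<open>u > 0\<close>.\<close>

definition unit_cells :: "(real \<Rightarrow> real) \<Rightarrow> (real \<Rightarrow> real) \<Rightarrow> bool" where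
  "unit_cells \<phi> \<phi>' \<longleftrightarrow> \<phi> \<in> borel_measurable borel \<and> \<phi>' \<in> borel_measurable borel \<and> (\<forall>u. 0 \<le> \<phi>' u) \<and>
     (\<forall>i. (\<integral>\<^sup>+u. ennreal (\<phi>' u) * indicator {u. 0 < u \<and> nat \<lfloor>\<phi> u\<rfloor> = i} u \<partial>lborel) = 1)"

text \<open>Up to null sets the cell of index i is an interval [a, b] with
  \<open>\<phi> a = i\<close> and \<open>\<phi> b = i + 1\<close>, so the fundamental theorem of
  calculus gives it mass 1.\<close>

lemma unit_cells_deriv:
  fixes \<phi> \<phi>' :: "real \<Rightarrow> real"
  assumes DERIV: "\<And>u. DERIV \<phi> u :> \<phi>' u" and pos: "\<And>u. \<phi>' u > 0" and "\<phi> 0 = 0"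
    and top: "filterlim \<phi> at_top at_top" and meas: "\<phi>' \<in> borel_measurable borel"
  shows "unit_cells \<phi> \<phi>'"
proof -
  have cont: "continuous_on UNIV \<phi>"
    using DERIV by (meson DERIV_isCont continuous_at_imp_continuous_on)
  have mono: "\<phi> x < \<phi> y" if "x < y" for x y
    by (rule DERIV_pos_imp_increasing[OF that]) (use DERIV pos in blast)
  have surj: "\<exists>u\<ge>0. \<phi> u = y" if "y \<ge> 0" for y
  proof -
    obtain b where "b \<ge> 0" "\<phi> b \<ge> y"
      using top unfolding filterlim_at_top eventually_at_top_linorder by (meson linear)
    then show ?thesis
      using IVT'[of \<phi> 0 y b] that \<open>\<phi> 0 = 0\<close> continuous_on_subset[OF cont] by auto
  qed
  have "(\<integral>\<^sup>+u. ennreal (\<phi>' u) * indicator {u. 0 < u \<and> nat \<lfloor>\<phi> u\<rfloor> = i} u \<partial>lborel) = 1" for i :: nat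
  proof -
    obtain a b where ab: "0 \<le> a" "\<phi> a = real i" "0 \<le> b" "\<phi> b = real i + 1"
      using surj[of "real i"] surj[of "real i + 1"] by auto
    have "a < b"
      using mono[of b a] ab by (cases a b rule: linorder_cases) auto
    \<comment> \<open>The point 0 is left out: for \<open>i = 0\<close> it lies in [a, b) but not in
      the open half-line. It is a null set, as is the endpoint \<open>b\<close> that the closed
      interval adds below.\<close>
    have cell: "(0 < u \<and> nat \<lfloor>\<phi> u\<rfloor> = i) \<longleftrightarrow> (a \<le> u \<and> u < b)" if "u \<noteq> 0" for u
    proof -
      have "nat \<lfloor>\<phi> u\<rfloor> = i \<longleftrightarrow> real i \<le> \<phi> u \<and> \<phi> u < real i + 1" if "0 < u"
        using mono[OF that] \<open>\<phi> 0 = 0\<close> by (auto simp: nat_eq_iff2 floor_eq_iff) linarith+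
      moreover have "\<phi> a \<le> \<phi> u \<longleftrightarrow> a \<le> u"
        using mono[of a u] mono[of u a] by (cases a u rule: linorder_cases) auto
      moreover have "\<phi> u < \<phi> b \<longleftrightarrow> u < b"
        using mono[of u b] mono[of b u] by (cases u b rule: linorder_cases) auto
      ultimately show ?thesis
        using ab \<open>u \<noteq> 0\<close> by auto
    qed
    have "AE u in lborel. u \<noteq> 0 \<and> u \<noteq> b"
      using AE_lborel_singleton[of "0::real"] AE_lborel_singleton[of b] by eventually_elim auto
    then have "(\<integral>\<^sup>+u. ennreal (\<phi>' u) * indicator {u. 0 < u \<and> nat \<lfloor>\<phi> u\<rfloor> = i} u \<partial>lborel) =
        (\<integral>\<^sup>+u. ennreal (\<phi>' u) * indicator {a..b} u \<partial>lborel)"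
    proof (intro nn_integral_cong_AE, eventually_elim)
      fix u assume "u \<noteq> 0 \<and> u \<noteq> b"
      then show "ennreal (\<phi>' u) * indicator {u. 0 < u \<and> nat \<lfloor>\<phi> u\<rfloor> = i} u = ennreal (\<phi>' u) * indicator {a..b} u"
        using cell[of u] by (auto simp: indicator_def)
    qed
    also have "\<dots> = ennreal (\<phi> b - \<phi> a)"
      using DERIV pos \<open>a < b\<close> meas by (intro nn_integral_FTC_Icc) (auto intro: less_imp_le)
    finally show ?thesis
      using ab by simp
  qed
  then show ?thesis
    using pos meas borel_measurable_continuous_onI[OF cont]
    by (auto simp: unit_cells_def intro: less_imp_le)
qed

lemma unit_cells_linear: "p > 0 \<Longrightarrow> unit_cells (\<lambda>u. p * u) (\<lambda>_. p)"
  by (rule unit_cells_deriv)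
    (auto intro!: derivative_eq_intros filterlim_tendsto_pos_mult_at_top[OF tendsto_const] filterlim_ident)

lemma unit_cells_id: "unit_cells (\<lambda>u. u) (\<lambda>_. 1)"
  using unit_cells_linear[of 1] by simp

text \<open>Subtracting 1 sends \<open>t = 0\<close> to 0 and makes 1 + i comparable to
  \<open>s powr t\<close>. The weight is the Jacobian; its factor \<open>ln s\<close> is the
  logarithm that appears in the rates.\<close>

lemma unit_cells_powr:
  assumes "s > 1"
  shows "unit_cells (\<lambda>t. s powr t - 1) (\<lambda>t. s powr t * ln s)"
proof (rule unit_cells_deriv)
  have "filterlim (\<lambda>t. exp (ln s * t)) at_top at_top"
    using assms by (intro filterlim_compose[OF exp_at_top]
      filterlim_tendsto_pos_mult_at_top[OF tendsto_const] filterlim_ident) auto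
  then have "filterlim (\<lambda>t. -1 + exp (ln s * t)) at_top at_top"
    by (rule filterlim_tendsto_add_at_top[OF tendsto_const])
  then show "filterlim (\<lambda>t. s powr t - 1) at_top at_top"
    using assms by (simp add: powr_def mult.commute)
qed (use assms in \<open>auto intro!: derivative_eq_intros\<close>)

text \<open>Since every fibre of I has mass 1, the image under I of the measure with density D is
  counting measure, and the sum becomes an integral by change of variables. On the summation side,
  real summability is absolute summability, hence integrability for counting measure.\<close>

lemma series_as_integral:
  fixes f :: "'c::countable \<Rightarrow> real" and D :: "'b \<Rightarrow> real"
  assumes [measurable]: "D \<in> borel_measurable P" "I \<in> measurable P (count_space UNIV)"
    and D0: "\<And>u. 0 \<le> D u"
    and mass: "\<And>i. (\<integral>\<^sup>+u. ennreal (D u) * indicator {u. I u = i} u \<partial>P) = 1"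
  shows series_summable_iff_integrable: "f summable_on UNIV \<longleftrightarrow> integrable P (\<lambda>u. D u * f (I u))" (is ?thesis1)
    and infsum_eq_integral: "integrable P (\<lambda>u. D u * f (I u)) \<Longrightarrow> (\<Sum>\<^sub>\<infinity>i. f i) = (\<integral>u. D u * f (I u) \<partial>P)"
proof -
  have [measurable]: "I \<in> measurable (density P D) (count_space UNIV)"
    by measurable
  have distr: "distr (density P D) (count_space UNIV) I = count_space UNIV"
  proof (rule measure_eqI_countable)
    fix i
    have "emeasure (distr (density P D) (count_space UNIV) I) {i} =
        (\<integral>\<^sup>+u. ennreal (D u) * indicator (I -` {i} \<inter> space P) u \<partial>P)"
      by (subst emeasure_distr) (auto simp: emeasure_density)
    also have "\<dots> = (\<integral>\<^sup>+u. ennreal (D u) * indicator {u. I u = i} u \<partial>P)"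
      by (intro nn_integral_cong) (auto simp: indicator_def)
    finally show "emeasure (distr (density P D) (count_space UNIV) I) {i} = emeasure (count_space UNIV) {i}"
      using mass by simp
  qed auto
  have "f summable_on UNIV \<longleftrightarrow> integrable (count_space UNIV) f"
    by (subst summable_on_iff_abs_summable_on_real) (simp only: abs_summable_equivalent abs_summable_on_def)
  also have "\<dots> \<longleftrightarrow> integrable (density P D) (\<lambda>u. f (I u))"
    by (subst distr[symmetric]) (simp add: integrable_distr_eq)
  also have "\<dots> \<longleftrightarrow> integrable P (\<lambda>u. D u * f (I u))"
    using D0 by (simp add: integrable_density)
  finally show iff: ?thesis1 .
  assume "integrable P (\<lambda>u. D u * f (I u))"
  then have "Infinite_Set_Sum.abs_summable_on f UNIV"
    using iff by (metis abs_summable_equivalent summable_on_iff_abs_summable_on_real)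
  then have "(\<Sum>\<^sub>\<infinity>i. f i) = integral\<^sup>L (count_space UNIV) f"
    by (simp add: infsetsum_def flip: infsetsum_infsum)
  also have "\<dots> = integral\<^sup>L (density P D) (\<lambda>u. f (I u))"
    by (subst distr[symmetric]) (simp add: integral_distr)
  also have "\<dots> = integral\<^sup>L P (\<lambda>u. D u * f (I u))"
    using D0 by (simp add: integral_density)
  finally show "(\<Sum>\<^sub>\<infinity>i. f i) = (\<integral>u. D u * f (I u) \<partial>P)" .
qed

text \<open>Serves the return trip: in a limit integral the variable of an unscaled index enters
  only through its integer part, and integrating it out is summation over that index.\<close>

lemma floor_series:
  fixes f :: "nat \<Rightarrow> real"
  shows floor_series_summable: "f summable_on UNIV \<longleftrightarrow> set_integrable lborel {0<..} (\<lambda>u::real. f (nat \<lfloor>u\<rfloor>))"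
    and floor_series_integral: "set_integrable lborel {0<..} (\<lambda>u::real. f (nat \<lfloor>u\<rfloor>)) \<Longrightarrow>
      (LINT u:{0::real<..}|lborel. f (nat \<lfloor>u\<rfloor>)) = (\<Sum>\<^sub>\<infinity>i. f i)"
proof -
  have mass: "(\<integral>\<^sup>+u. ennreal (indicator {0<..} (u::real)) * indicator {u. nat \<lfloor>u\<rfloor> = i} u \<partial>lborel) = 1" for i
  proof -
    have "(\<integral>\<^sup>+u. ennreal (indicator {0<..} (u::real)) * indicator {u. nat \<lfloor>u\<rfloor> = i} u \<partial>lborel) =
        (\<integral>\<^sup>+u. ennreal 1 * indicator {u::real. 0 < u \<and> nat \<lfloor>u\<rfloor> = i} u \<partial>lborel)"
      by (intro nn_integral_cong) (auto simp: indicator_def)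
    then show ?thesis
      using unit_cells_id by (simp add: unit_cells_def)
  qed
  note * = series_as_integral[OF _ _ _ mass, of f]
  show "f summable_on UNIV \<longleftrightarrow> set_integrable lborel {0<..} (\<lambda>u::real. f (nat \<lfloor>u\<rfloor>))"
    "set_integrable lborel {0<..} (\<lambda>u::real. f (nat \<lfloor>u\<rfloor>)) \<Longrightarrow>
      (LINT u:{0::real<..}|lborel. f (nat \<lfloor>u\<rfloor>)) = (\<Sum>\<^sub>\<infinity>i. f i)"
    using * by (simp_all add: set_integrable_def set_lebesgue_integral_def)
qed

text \<open>The fibre of an index pair is a product of two cells, so by Tonelli its mass is a
  product of two unit masses. The indicator of the quadrant belongs to the density because the cells
  contain positive points only.\<close>

lemma double_series:
  fixes f :: "nat \<Rightarrow> nat \<Rightarrow> real"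
  assumes "unit_cells \<phi> \<phi>'" "unit_cells \<psi> \<psi>'"
  defines "g \<equiv> \<lambda>(u, v). f (nat \<lfloor>\<phi> u\<rfloor>) (nat \<lfloor>\<psi> v\<rfloor>) * \<phi>' u * \<psi>' v"
  shows double_series_summable: "(\<lambda>(i, j). f i j) summable_on UNIV \<longleftrightarrow> set_integrable lborel ({0<..} \<times> {0<..}) g"
    and double_series_integral: "set_integrable lborel ({0<..} \<times> {0<..}) g \<Longrightarrow>
      (\<Sum>\<^sub>\<infinity>(i, j). f i j) = (LINT p:{0<..} \<times> {0<..}|lborel. g p)"
proof -
  have [measurable]: "\<phi> \<in> borel_measurable borel" "\<phi>' \<in> borel_measurable borel"
      "\<psi> \<in> borel_measurable borel" "\<psi>' \<in> borel_measurable borel"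
    and nonneg: "\<And>u. 0 \<le> \<phi>' u" "\<And>u. 0 \<le> \<psi>' u"
    and mass: "\<And>i. (\<integral>\<^sup>+u. ennreal (\<phi>' u) * indicator {u. 0 < u \<and> nat \<lfloor>\<phi> u\<rfloor> = i} u \<partial>lborel) = 1"
      "\<And>i. (\<integral>\<^sup>+u. ennreal (\<psi>' u) * indicator {u. 0 < u \<and> nat \<lfloor>\<psi> u\<rfloor> = i} u \<partial>lborel) = 1"
    using assms by (auto simp: unit_cells_def)
  define D where "D = (\<lambda>(u, v). indicator ({0<..} \<times> {0<..}) (u, v) * (\<phi>' u * \<psi>' v) :: real)"
  define I where "I = (\<lambda>(u, v). (nat \<lfloor>\<phi> u\<rfloor>, nat \<lfloor>\<psi> v\<rfloor>))"
  have "D \<in> borel_measurable (borel \<Otimes>\<^sub>M borel)"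
    unfolding D_def by measurable
  then have D: "D \<in> borel_measurable lborel"
    by (simp add: borel_prod)
  have "I \<in> measurable (borel \<Otimes>\<^sub>M borel) (count_space UNIV)"
    unfolding I_def by measurable
  then have I: "I \<in> measurable lborel (count_space UNIV)"
    by (simp add: borel_prod)
  have D0: "0 \<le> D p" for p
    using nonneg by (auto simp: D_def indicator_def split: prod.splits)
  have mass2: "(\<integral>\<^sup>+p. ennreal (D p) * indicator {p. I p = ij} p \<partial>lborel) = 1" for ij
  proof -
    obtain i j where ij: "ij = (i, j)"
      by force
    have "{p. I p = ij} \<in> sets lborel"
      using measurable_sets[OF I, of "{ij}"] by (simp add: vimage_def)
    then have [measurable]: "(\<lambda>p. ennreal (D p) * indicator {p. I p = ij} p) \<in> borel_measurable (lborel \<Otimes>\<^sub>M lborel)"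
      unfolding lborel_prod by (intro borel_measurable_times_ennreal borel_measurable_indicator
        measurable_compose[OF D measurable_ennreal])
    have "(\<integral>\<^sup>+p. ennreal (D p) * indicator {p. I p = ij} p \<partial>lborel) =
        (\<integral>\<^sup>+u. \<integral>\<^sup>+v. ennreal (D (u, v)) * indicator {p. I p = ij} (u, v) \<partial>lborel \<partial>lborel)"
      by (subst lborel_prod[symmetric], subst lborel.nn_integral_fst[symmetric]) auto
    also have "\<dots> = (\<integral>\<^sup>+u. \<integral>\<^sup>+v. (ennreal (\<phi>' u) * indicator {u. 0 < u \<and> nat \<lfloor>\<phi> u\<rfloor> = i} u) *
        (ennreal (\<psi>' v) * indicator {u. 0 < u \<and> nat \<lfloor>\<psi> u\<rfloor> = j} v) \<partial>lborel \<partial>lborel)"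
      using nonneg by (intro nn_integral_cong) (auto simp: D_def I_def ij indicator_def ennreal_mult)
    also have "\<dots> = 1"
      by (simp add: nn_integral_cmult mass)
    finally show ?thesis .
  qed
  have g: "D p * (case I p of (i, j) \<Rightarrow> f i j) = indicator ({0<..} \<times> {0<..}) p *\<^sub>R g p" for p
    by (auto simp: D_def I_def g_def split: prod.splits)
  show "(\<lambda>(i, j). f i j) summable_on UNIV \<longleftrightarrow> set_integrable lborel ({0<..} \<times> {0<..}) g"
    using series_summable_iff_integrable[OF D I D0 mass2, of "\<lambda>(i, j). f i j"]
    by (simp add: g set_integrable_def)
  assume "set_integrable lborel ({0<..} \<times> {0<..}) g"
  then show "(\<Sum>\<^sub>\<infinity>(i, j). f i j) = (LINT p:{0<..} \<times> {0<..}|lborel. g p)"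
    using infsum_eq_integral[OF D I D0 mass2, of "\<lambda>(i, j). f i j"]
    by (simp add: g set_integrable_def set_lebesgue_integral_def)
qed

text \<open>Fubini for an integrand that is constant in u on unit cells. This is how a limit
  integral takes the form of a series of integrals, with convergence of both the inner integrals and
  the outer series.\<close>

lemma floor_series_fst:
  fixes g :: "nat \<Rightarrow> real \<Rightarrow> real"
  assumes "set_integrable lborel ({0<..} \<times> {0<..}) (\<lambda>(u::real, v). g (nat \<lfloor>u\<rfloor>) v)"
  shows "set_integrable lborel {0<..} (g i)"
    and "(\<lambda>i. LINT v:{0<..}|lborel. g i v) summable_on UNIV"
    and "(LINT p:{0<..} \<times> {0<..}|lborel. (\<lambda>(u::real, v). g (nat \<lfloor>u\<rfloor>) v) p) = (\<Sum>\<^sub>\<infinity>i. LINT v:{0<..}|lborel. g i v)"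
proof -
  define G where "G = (\<lambda>(u::real, v::real). indicator {0<..} u * (indicator {0<..} v * g (nat \<lfloor>u\<rfloor>) v))"
  have G: "indicator ({0<..} \<times> {0<..}) p *\<^sub>R (\<lambda>(u::real, v). g (nat \<lfloor>u\<rfloor>) v) p = G p" for p
    by (auto simp: G_def indicator_def split: prod.splits)
  have int: "integrable (lborel \<Otimes>\<^sub>M lborel) G"
    using assms unfolding set_integrable_def G lborel_prod .
  show "set_integrable lborel {0<..} (g i)" for i
  proof -
    \<comment> \<open>Fubini yields integrable sections for almost every u only. The cell (i, i+1)
      has positive measure, so it contains a good u, and the section there is \<open>g i\<close>
      itself.\<close>
    have AE: "AE u in lborel. integrable lborel (\<lambda>v. G (u, v))"
      using lborel_pair.AE_integrable_fst'[OF int] .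
    have "{u. \<not> u \<notin> {real i<..<real i + 1}} = {real i<..<real i + 1}"
      by blast
    then have "emeasure lborel {u. \<not> u \<notin> {real i<..<real i + 1}} = 1"
      by (simp only: emeasure_lborel_Ioo) simp
    then have "\<not> (AE u in lborel. u \<notin> {real i<..<real i + 1})"
      by (subst AE_iff_measurable[OF _ refl]) auto
    then obtain u where u: "real i < u" "u < real i + 1" "integrable lborel (\<lambda>v. G (u, v))"
      using AE by (smt (verit, del_insts) eventually_mono greaterThanLessThan_iff)
    then have "\<lfloor>u\<rfloor> = int i"
      by linarith
    then have "nat \<lfloor>u\<rfloor> = i" "u > 0"
      using u by auto
    then show ?thesis
      using u by (simp add: G_def set_integrable_def)
  qed
  have sec: "(\<integral>v. G (u, v) \<partial>lborel) = indicator {0<..} u *\<^sub>R (LINT v:{0<..}|lborel. g (nat \<lfloor>u\<rfloor>) v)" for u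
    by (simp add: G_def set_lebesgue_integral_def)
  have int1: "set_integrable lborel {0<..} (\<lambda>u::real. LINT v:{0<..}|lborel. g (nat \<lfloor>u\<rfloor>) v)"
    using lborel_pair.integrable_fst'[OF int] unfolding sec by (simp add: set_integrable_def)
  then show "(\<lambda>i. LINT v:{0<..}|lborel. g i v) summable_on UNIV"
    using floor_series_summable by blast
  have "(LINT p:{0<..} \<times> {0<..}|lborel. (\<lambda>(u::real, v). g (nat \<lfloor>u\<rfloor>) v) p) = integral\<^sup>L (lborel \<Otimes>\<^sub>M lborel) G"
    unfolding set_lebesgue_integral_def G lborel_prod by simp
  also have "\<dots> = (LINT u:{0::real<..}|lborel. LINT v:{0<..}|lborel. g (nat \<lfloor>u\<rfloor>) v)"
    by (subst lborel_pair.integral_fst'[OF int, symmetric]) (simp add: sec set_lebesgue_integral_def)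
  also have "\<dots> = (\<Sum>\<^sub>\<infinity>i. LINT v:{0<..}|lborel. g i v)"
    by (rule floor_series_integral[OF int1])
  finally show "(LINT p:{0<..} \<times> {0<..}|lborel. (\<lambda>(u::real, v). g (nat \<lfloor>u\<rfloor>) v) p) = (\<Sum>\<^sub>\<infinity>i. LINT v:{0<..}|lborel. g i v)" .
qed

section \<open>Dominated convergence for double series with product majorants\<close>

section \<open>Dominated convergence\<close>

text \<open>Every majorant below is a product of such functions with exponents \<open>p < 1 < q\<close>.\<close>

definition two_powers :: "real \<Rightarrow> real \<Rightarrow> real \<Rightarrow> real" where
  "two_powers p q u = (if u < 1 then u powr -p else u powr -q)"

lemma two_powers_nonneg: "0 \<le> two_powers p q u"
  by (simp add: two_powers_def)

lemma two_powers_measurable [measurable]: "two_powers p q \<in> borel_measurable borel"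
  unfolding two_powers_def[abs_def] by measurable

lemma two_powers_integrable:
  assumes "p < 1" "1 < q"
  shows "integrable lborel (\<lambda>u. indicator {0<..} u * two_powers p q u)"
proof -
  have "(\<lambda>u. u powr -p) absolutely_integrable_on {0..1}"
    using assms by (intro nonnegative_absolutely_integrable_1 integrable_on_powr_from_0) auto
  then have 1: "integrable lborel (\<lambda>u. indicator {0..1} u * u powr -p)"
    by (simp add: set_integrable_def integrable_completion)
  have "(\<lambda>u. u powr -q) absolutely_integrable_on {1..}"
    using assms has_integral_powr_to_inf[of "-q" 1]
    by (intro nonnegative_absolutely_integrable_1) (auto simp: integrable_on_def)
  then have 2: "integrable lborel (\<lambda>u. indicator {1..} u * u powr -q)"
    by (simp add: set_integrable_def integrable_completion)
  show ?thesis
    by (rule Bochner_Integration.integrable_bound[OF Bochner_Integration.integrable_add[OF 1 2]])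
      (auto simp: indicator_def two_powers_def)
qed

lemma quadrant_integrable_two_powers:
  assumes "p1 < 1" "1 < q1" "p2 < 1" "1 < q2"
  shows "set_integrable lborel ({0<..} \<times> {0<..}) (\<lambda>(u, v). C * (two_powers p1 q1 u * two_powers p2 q2 v))"
proof -
  let ?f = "\<lambda>p q (u::real). indicator {0<..} u * two_powers p q u"
  have "integrable (lborel \<Otimes>\<^sub>M lborel) (\<lambda>(u, v). ?f p1 q1 u * ?f p2 q2 v)"
  proof (rule lborel_pair.Fubini_integrable)
    show "integrable lborel (\<lambda>u. \<integral>v. norm (case (u, v) of (u, v) \<Rightarrow> ?f p1 q1 u * ?f p2 q2 v) \<partial>lborel)"
      using two_powers_integrable[of p1 q1] assms by (simp add: abs_mult two_powers_nonneg)
    show "AE u in lborel. integrable lborel (\<lambda>v. case (u, v) of (u, v) \<Rightarrow> ?f p1 q1 u * ?f p2 q2 v)"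
      using two_powers_integrable[of p2 q2] assms by simp
  qed measurable
  then have "integrable lborel (\<lambda>p. C * (case p of (u, v) \<Rightarrow> ?f p1 q1 u * ?f p2 q2 v))"
    unfolding lborel_prod by simp
  then show ?thesis
    unfolding set_integrable_def
    by (rule Bochner_Integration.integrable_cong[THEN iffD1, rotated -1]) (auto simp: indicator_def)
qed

text \<open>After substitution all the sums are integrals over one fixed quadrant with a common
  majorant, although the scales vary with k. The lines u = 1 and v = 1 are exempt from the pointwise
  limit because the logarithmic limits jump there.\<close>

lemma series_dominated_convergence:
  fixes F :: "nat \<Rightarrow> nat \<Rightarrow> nat \<Rightarrow> real" and G :: "real \<Rightarrow> real \<Rightarrow> real"
  assumes cells: "\<forall>\<^sub>F k in sequentially. unit_cells (\<phi> k) (\<phi>' k) \<and> unit_cells (\<psi> k) (\<psi>' k)"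
    and bound: "\<forall>\<^sub>F k in sequentially. \<forall>u>0. \<forall>v>0.
      \<bar>F k (nat \<lfloor>\<phi> k u\<rfloor>) (nat \<lfloor>\<psi> k v\<rfloor>) * \<phi>' k u * \<psi>' k v\<bar> \<le> C * (two_powers p1 q1 u * two_powers p2 q2 v)"
    and pq: "p1 < 1" "1 < q1" "p2 < 1" "1 < q2"
    and lim: "\<And>u v. 0 < u \<Longrightarrow> 0 < v \<Longrightarrow> u \<noteq> 1 \<Longrightarrow> v \<noteq> 1 \<Longrightarrow>
      (\<lambda>k. F k (nat \<lfloor>\<phi> k u\<rfloor>) (nat \<lfloor>\<psi> k v\<rfloor>) * \<phi>' k u * \<psi>' k v) \<longlonglongrightarrow> G u v"
    and G: "(\<lambda>(u, v). G u v) \<in> borel_measurable borel"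
  shows "set_integrable lborel ({0<..} \<times> {0<..}) (\<lambda>(u, v). G u v)" (is ?thesis1)
    and "(\<lambda>k. \<Sum>\<^sub>\<infinity>(i, j). F k i j) \<longlonglongrightarrow> (LINT p:{0<..} \<times> {0<..}|lborel. (\<lambda>(u, v). G u v) p)"
proof -
  \<comment> \<open>Cells and majorant are available only eventually. Shifting the sequence by K
    makes them hold for every k, as the dominated convergence theorem demands.\<close>
  obtain K where K: "\<And>k. k \<ge> K \<Longrightarrow> unit_cells (\<phi> k) (\<phi>' k) \<and> unit_cells (\<psi> k) (\<psi>' k)"
      "\<And>k u v. k \<ge> K \<Longrightarrow> u > 0 \<Longrightarrow> v > 0 \<Longrightarrow>
        \<bar>F k (nat \<lfloor>\<phi> k u\<rfloor>) (nat \<lfloor>\<psi> k v\<rfloor>) * \<phi>' k u * \<psi>' k v\<bar> \<le> C * (two_powers p1 q1 u * two_powers p2 q2 v)"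
    using eventually_conj[OF cells bound] unfolding eventually_sequentially by blast
  define Q where "Q = {0::real<..} \<times> {0::real<..}"
  define g where "g k = (\<lambda>(u, v). F (k + K) (nat \<lfloor>\<phi> (k + K) u\<rfloor>) (nat \<lfloor>\<psi> (k + K) v\<rfloor>) * \<phi>' (k + K) u * \<psi>' (k + K) v)" for k
  define h where "h = (\<lambda>(u, v). C * (two_powers p1 q1 u * two_powers p2 q2 v))"
  have [measurable]: "Q \<in> sets borel"
    unfolding Q_def by (auto simp flip: borel_prod)
  have g [measurable]: "g k \<in> borel_measurable borel" for k
  proof -
    have [measurable]: "\<phi> (k + K) \<in> borel_measurable borel" "\<phi>' (k + K) \<in> borel_measurable borel"
      "\<psi> (k + K) \<in> borel_measurable borel" "\<psi>' (k + K) \<in> borel_measurable borel"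
      using K(1)[of "k + K"] by (auto simp: unit_cells_def)
    show ?thesis
      unfolding g_def borel_prod[symmetric] by measurable
  qed
  have h: "set_integrable lborel Q h"
    unfolding h_def Q_def by (rule quadrant_integrable_two_powers[OF pq])
  have gh: "norm (indicator Q p *\<^sub>R g k p) \<le> indicator Q p *\<^sub>R h p" for k p
    using K(2)[of "k + K"] by (auto simp: Q_def g_def h_def indicator_def split: prod.splits)
  have gint: "set_integrable lborel Q (g k)" for k
    unfolding set_integrable_def
    by (rule Bochner_Integration.integrable_bound[OF h[unfolded set_integrable_def]])
      (use g in measurable, rule AE_I2, rule order_trans[OF gh], simp)
  have "AE p in lborel. fst p \<noteq> (1::real) \<and> snd p \<noteq> (1::real)"
  proof -
    have "AE p in lborel \<Otimes>\<^sub>M lborel. fst p \<noteq> (1::real) \<and> snd p \<noteq> (1::real)"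
    proof (rule lborel_pair.AE_pair_measure)
      show "AE x in lborel. AE y in lborel. fst (x, y) \<noteq> (1::real) \<and> snd (x, y) \<noteq> (1::real)"
        using AE_lborel_singleton[of "1::real"] by eventually_elim (use AE_lborel_singleton[of "1::real"] in auto)
    qed measurable
    then show ?thesis
      unfolding lborel_prod .
  qed
  then have lim': "AE p in lborel. (\<lambda>k. indicator Q p *\<^sub>R g k p) \<longlonglongrightarrow> indicator Q p *\<^sub>R (\<lambda>(u, v). G u v) p"
  proof eventually_elim
    case (elim p)
    show ?case
    proof (cases "p \<in> Q")
      case True
      then show ?thesis
        using LIMSEQ_ignore_initial_segment[OF lim[of "fst p" "snd p"], of K] elim
        by (auto simp: Q_def g_def split: prod.splits)
    qed auto
  qed
  have meas: "(\<lambda>p. indicator Q p *\<^sub>R (\<lambda>(u, v). G u v) p) \<in> borel_measurable lborel"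
      "\<And>k. (\<lambda>p. indicator Q p *\<^sub>R g k p) \<in> borel_measurable lborel"
    using G by measurable
  note dct = meas h[unfolded set_integrable_def] lim' AE_I2[OF gh]
  have "integrable lborel (\<lambda>p. indicator Q p *\<^sub>R (\<lambda>(u, v). G u v) p) \<and>
    (\<lambda>k. integral\<^sup>L lborel (\<lambda>p. indicator Q p *\<^sub>R g k p)) \<longlonglongrightarrow> integral\<^sup>L lborel (\<lambda>p. indicator Q p *\<^sub>R (\<lambda>(u, v). G u v) p)"
    using integrable_dominated_convergence[OF dct] integral_dominated_convergence[OF dct] by blast
  moreover have "(\<Sum>\<^sub>\<infinity>(i, j). F (k + K) i j) = integral\<^sup>L lborel (\<lambda>p. indicator Q p *\<^sub>R g k p)" for k
    using double_series_integral[of "\<phi> (k + K)" "\<phi>' (k + K)" "\<psi> (k + K)" "\<psi>' (k + K)" "F (k + K)"]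
      K(1)[OF le_add2] gint[of k]
    unfolding Q_def g_def set_lebesgue_integral_def by blast
  ultimately have "integrable lborel (\<lambda>p. indicator Q p *\<^sub>R (\<lambda>(u, v). G u v) p)"
    and *: "(\<lambda>k. \<Sum>\<^sub>\<infinity>(i, j). F (k + K) i j) \<longlonglongrightarrow> integral\<^sup>L lborel (\<lambda>p. indicator Q p *\<^sub>R (\<lambda>(u, v). G u v) p)"
    by simp_all
  then show ?thesis1
    by (simp add: set_integrable_def Q_def)
  show "(\<lambda>k. \<Sum>\<^sub>\<infinity>(i, j). F k i j) \<longlonglongrightarrow> (LINT p:{0<..} \<times> {0<..}|lborel. (\<lambda>(u, v). G u v) p)"
    using LIMSEQ_offset[OF *] by (simp add: set_lebesgue_integral_def Q_def)
qed

section \<open>Pointwise limits of rescaled power weights\<close>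

section \<open>Asymptotics of a single factor\<close>

text \<open>One plus the integer part lies between \<open>q k\<close> and \<open>q k + 1\<close>, a
  gap that division by \<open>z k\<close> removes. The limit 0 is allowed; it describes an index
  negligible against its lag.\<close>

lemma tendsto_floor_ratio:
  fixes q z :: "nat \<Rightarrow> real"
  assumes z: "filterlim z at_top sequentially" and q: "\<And>k. 0 \<le> q k" and lim: "(\<lambda>k. q k / z k) \<longlonglongrightarrow> l"
  shows "(\<lambda>k. (1 + real (nat \<lfloor>q k\<rfloor>)) / z k) \<longlonglongrightarrow> l"
proof (rule tendsto_sandwich[OF _ _ lim])
  have z0: "\<forall>\<^sub>F k in sequentially. 0 < z k"
    using z by (simp add: filterlim_at_top_dense)
  have "(\<lambda>k. 1 / z k) \<longlonglongrightarrow> 0"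
    by (rule tendsto_divide_0[OF tendsto_const filterlim_at_top_imp_at_infinity[OF z]])
  from tendsto_add[OF lim this] show "(\<lambda>k. q k / z k + 1 / z k) \<longlonglongrightarrow> l"
    by simp
  show "\<forall>\<^sub>F k in sequentially. q k / z k \<le> (1 + real (nat \<lfloor>q k\<rfloor>)) / z k"
    using z0
  proof eventually_elim
    case (elim k)
    have "q k \<le> 1 + real (nat \<lfloor>q k\<rfloor>)"
      using q[of k] by linarith
    then show ?case
      using elim by (simp add: divide_right_mono)
  qed
  show "\<forall>\<^sub>F k in sequentially. (1 + real (nat \<lfloor>q k\<rfloor>)) / z k \<le> q k / z k + 1 / z k"
    using z0
  proof eventually_elim
    case (elim k)
    have "1 + real (nat \<lfloor>q k\<rfloor>) \<le> q k + 1"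
      using q[of k] by linarith
    then show ?case
      using elim by (simp add: divide_right_mono flip: add_divide_distrib)
  qed
qed

lemma powr_ratio_tendsto:
  fixes x z :: "nat \<Rightarrow> real"
  assumes "filterlim z at_top sequentially" "\<And>k. 0 \<le> x k" "(\<lambda>k. x k / z k) \<longlonglongrightarrow> l" "l > 0"
  shows "(\<lambda>k. x k powr b / z k powr b) \<longlonglongrightarrow> l powr b"
proof (rule Lim_transform_eventually)
  have "\<forall>\<^sub>F k in sequentially. 0 < z k"
    using assms(1) by (simp add: filterlim_at_top_dense)
  then show "\<forall>\<^sub>F k in sequentially. (x k / z k) powr b = x k powr b / z k powr b"
    by eventually_elim (use assms(2) in \<open>simp add: powr_divide\<close>)
  show "(\<lambda>k. (x k / z k) powr b) \<longlonglongrightarrow> l powr b"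
    using assms by (intro tendsto_intros) auto
qed

lemma floor_powr_tendsto:
  fixes q z :: "nat \<Rightarrow> real"
  assumes "filterlim z at_top sequentially" "\<And>k. 0 \<le> q k" "(\<lambda>k. q k / z k) \<longlonglongrightarrow> l" "l > 0"
  shows "(\<lambda>k. (1 + real (nat \<lfloor>q k\<rfloor>)) powr b / z k powr b) \<longlonglongrightarrow> l powr b"
  by (rule powr_ratio_tendsto[OF assms(1) _ tendsto_floor_ratio[OF assms(1-3)] assms(4)]) simp

text \<open>The 1 in \<open>1 + l\<close> is the lag divided by itself. For \<open>l = 0\<close> the
  index is negligible and the shifted weight behaves like a pure power of the lag.\<close>

lemma shifted_powr_tendsto:
  fixes q :: "nat \<Rightarrow> real" and N :: "nat \<Rightarrow> nat"
  assumes N: "filterlim N at_top sequentially" and q: "\<And>k. 0 \<le> q k" "(\<lambda>k. q k / real (N k)) \<longlonglongrightarrow> l" "l \<ge> 0"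
  shows "(\<lambda>k. (1 + real (nat \<lfloor>q k\<rfloor> + N k)) powr b / real (N k) powr b) \<longlonglongrightarrow> (1 + l) powr b"
proof (rule powr_ratio_tendsto)
  show N': "filterlim (\<lambda>k. real (N k)) at_top sequentially"
    using N by (rule filterlim_compose[OF filterlim_real_sequentially])
  show "(\<lambda>k. (1 + real (nat \<lfloor>q k\<rfloor> + N k)) / real (N k)) \<longlonglongrightarrow> 1 + l"
  proof (rule Lim_transform_eventually)
    show "(\<lambda>k. 1 + (1 + real (nat \<lfloor>q k\<rfloor>)) / real (N k)) \<longlonglongrightarrow> 1 + l"
      by (intro tendsto_intros tendsto_floor_ratio N' q)
    have "\<forall>\<^sub>F k in sequentially. 0 < real (N k)"
      using N' unfolding filterlim_at_top_dense by blast
    then show "\<forall>\<^sub>F k in sequentially. 1 + (1 + real (nat \<lfloor>q k\<rfloor>)) / real (N k) = (1 + real (nat \<lfloor>q k\<rfloor> + N k)) / real (N k)"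
      by eventually_elim (simp add: field_simps)
  qed
qed (use q(3) in auto)

lemma const_over_tendsto_0:
  fixes z :: "nat \<Rightarrow> real"
  assumes "filterlim z at_top sequentially"
  shows "(\<lambda>k. c / z k) \<longlonglongrightarrow> 0"
  by (rule tendsto_divide_0[OF tendsto_const filterlim_at_top_imp_at_infinity[OF assms]])

lemma filterlim_nat_floor:
  "filterlim q at_top F \<Longrightarrow> filterlim (\<lambda>k. nat \<lfloor>q k :: real\<rfloor>) at_top F"
  by (rule filterlim_compose[OF filterlim_nat_sequentially filterlim_compose[OF filterlim_floor_sequentially]])

section \<open>Integrable majorants for shifted power weights\<close>

section \<open>Majorants of a single factor\<close>

text \<open>One coordinate's share of the bound \<open>V_bound\<close>: exponent a comes from the
  coefficient whose index is shifted by the lag, b from the unshifted one. In use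
  \<open>a + b = \<alpha>\<close>, and the two coordinates carry the two exponents in opposite
  order, since each coefficient is shifted in one coordinate only.\<close>

definition shift_prod :: "real \<Rightarrow> real \<Rightarrow> real \<Rightarrow> nat \<Rightarrow> nat \<Rightarrow> real" where
  "shift_prod \<beta> a b N i = (1 + real (i + N)) powr (-\<beta> * a) * (1 + real i) powr (-\<beta> * b)"

lemma shift_prod_nonneg: "0 \<le> shift_prod \<beta> a b N i"
  by (simp add: shift_prod_def)

lemma powr_neg_mono:
  fixes x y :: real
  assumes "\<beta> > 0" "0 < x" "x \<le> y" "0 \<le> b"
  shows "y powr (-\<beta> * b) \<le> x powr (-\<beta> * b)"
  using assms by (intro powr_mono2') auto

text \<open>For an unscaled index the shifted weight is replaced by a power of the lag. The other
  weight is at most 1, which gives the exponent 0 near the origin, and its tail is integrable when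
  \<open>\<beta> * b > 1\<close>.\<close>

lemma shift_prod_const:
  assumes "\<beta> > 0" "0 \<le> a" "0 \<le> b" "N > 0" "u > 0"
  shows "shift_prod \<beta> a b N (nat \<lfloor>u\<rfloor>) \<le> real N powr (-\<beta> * a) * two_powers 0 (\<beta> * b) u"
  unfolding shift_prod_def
proof (intro mult_mono)
  show "(1 + real (nat \<lfloor>u\<rfloor> + N)) powr (-\<beta> * a) \<le> real N powr (-\<beta> * a)"
    using assms by (intro powr_neg_mono) auto
  have "(1 + real (nat \<lfloor>u\<rfloor>)) powr (-\<beta> * b) \<le> 1 powr (-\<beta> * b)"
    using assms by (intro powr_neg_mono) auto
  moreover have "(1 + real (nat \<lfloor>u\<rfloor>)) powr (-\<beta> * b) \<le> u powr (-\<beta> * b)"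
    using assms by (intro powr_neg_mono) (auto, linarith)
  ultimately show "(1 + real (nat \<lfloor>u\<rfloor>)) powr (-\<beta> * b) \<le> two_powers 0 (\<beta> * b) u"
    using assms by (auto simp: two_powers_def)
qed auto

text \<open>At a scale s unrelated to the lag the bound in u is a single power, which is not
  integrable on the whole half-line. Regimes with such a scale therefore combine two values of b,
  one for small and one for large u.\<close>

lemma shift_prod_linear:
  assumes "\<beta> > 0" "0 \<le> a" "0 \<le> b" "N > 0" "s > 0" "u > 0"
  shows "shift_prod \<beta> a b N (nat \<lfloor>s * u\<rfloor>) * s \<le> real N powr (-\<beta> * a) * s powr (1 - \<beta> * b) * u powr (-\<beta> * b)"
proof -
  have "shift_prod \<beta> a b N (nat \<lfloor>s * u\<rfloor>) \<le> real N powr (-\<beta> * a) * (s * u) powr (-\<beta> * b)"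
    unfolding shift_prod_def
  proof (intro mult_mono)
    show "(1 + real (nat \<lfloor>s * u\<rfloor> + N)) powr (-\<beta> * a) \<le> real N powr (-\<beta> * a)"
      using assms by (intro powr_neg_mono) auto
    show "(1 + real (nat \<lfloor>s * u\<rfloor>)) powr (-\<beta> * b) \<le> (s * u) powr (-\<beta> * b)"
      using assms by (intro powr_neg_mono) (auto, linarith)
  qed auto
  then have "shift_prod \<beta> a b N (nat \<lfloor>s * u\<rfloor>) * s \<le> real N powr (-\<beta> * a) * (s * u) powr (-\<beta> * b) * s"
    using assms by (intro mult_right_mono) auto
  also have "\<dots> = real N powr (-\<beta> * a) * s powr (1 - \<beta> * b) * u powr (-\<beta> * b)"
    using assms by (simp add: powr_mult powr_diff powr_minus field_simps)
  finally show ?thesis .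
qed

text \<open>When the scale is the lag itself, for u beyond 1 the shifted weight decays as well, so
  the tail exponent is the sum \<open>\<beta> * (a + b)\<close>, while the singularity at 0 comes
  from the unshifted weight alone.\<close>

lemma shift_prod_linear_self:
  assumes "\<beta> > 0" "0 \<le> a" "0 \<le> b" "N > 0" "u > 0"
  shows "shift_prod \<beta> a b N (nat \<lfloor>real N * u\<rfloor>) * real N \<le>
    real N powr (1 - \<beta> * (a + b)) * two_powers (\<beta> * b) (\<beta> * (a + b)) u"
proof (cases "u < 1")
  case True
  then show ?thesis
    using shift_prod_linear[OF assms(1-4), of "real N" u] assms
    by (simp add: two_powers_def algebra_simps flip: powr_add)
next
  case False
  have "shift_prod \<beta> a b N (nat \<lfloor>real N * u\<rfloor>) \<le> (real N * u) powr (-\<beta> * a) * (real N * u) powr (-\<beta> * b)"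
    unfolding shift_prod_def
    using assms by (intro mult_mono powr_neg_mono) (auto, linarith+)
  also have "\<dots> = (real N * u) powr (- \<beta> * (a + b))"
    by (simp add: algebra_simps flip: powr_add)
  finally have "shift_prod \<beta> a b N (nat \<lfloor>real N * u\<rfloor>) * real N \<le> (real N * u) powr (- \<beta> * (a + b)) * real N"
    by (intro mult_right_mono) auto
  also have "\<dots> = real N powr (1 - \<beta> * (a + b)) * two_powers (\<beta> * b) (\<beta> * (a + b)) u"
    using assms False by (simp add: two_powers_def powr_mult powr_diff powr_minus powr_add field_simps)
  finally show ?thesis .
qed

text \<open>For x at least 1 the left-over quantity 1 + floor(x - 1) is the integer part of x, hence
  at least x / 2. This loss is the source of the powers of 2 in the exponential bounds.\<close>

lemma floor_powr_lower:
  assumes "s > 1" "t > 0"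
  shows "s powr t / 2 \<le> 1 + real (nat \<lfloor>s powr t - 1\<rfloor>)"
proof -
  have "s powr t \<ge> 1"
    using assms by (intro ge_one_powr_ge_zero) auto
  then show ?thesis
    by linarith
qed

text \<open>The Jacobian contributes \<open>s powr t\<close> and the unshifted weight
  \<open>s powr (- t * \<beta> * b)\<close> up to a constant. At the critical value
  \<open>\<beta> * b = 1\<close> they cancel, and what remains is flat in t with the factor
  \<open>ln s\<close>.\<close>

lemma shift_prod_exponential:
  assumes "\<beta> > 0" "0 \<le> a" "0 \<le> b" "N > 0" "s > 1" "t > 0"
  shows "shift_prod \<beta> a b N (nat \<lfloor>s powr t - 1\<rfloor>) * (s powr t * ln s) \<le>
    2 powr (\<beta> * b) * (real N powr (-\<beta> * a) * s powr (t * (1 - \<beta> * b)) * ln s)"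
proof -
  have "shift_prod \<beta> a b N (nat \<lfloor>s powr t - 1\<rfloor>) \<le> real N powr (-\<beta> * a) * (s powr t / 2) powr (-\<beta> * b)"
    unfolding shift_prod_def using assms floor_powr_lower[OF assms(5,6)] 
    by (intro mult_mono powr_neg_mono) auto
  then have "shift_prod \<beta> a b N (nat \<lfloor>s powr t - 1\<rfloor>) * (s powr t * ln s) \<le>
      real N powr (-\<beta> * a) * (s powr t / 2) powr (-\<beta> * b) * (s powr t * ln s)"
    using assms by (intro mult_right_mono) auto
  also have "\<dots> = 2 powr (\<beta> * b) * (real N powr (-\<beta> * a) * s powr (t * (1 - \<beta> * b)) * ln s)"
    using assms by (simp add: powr_divide powr_powr powr_minus powr_diff field_simps)
  finally show ?thesis .
qed

text \<open>For large s the decay is at least exp(-2 (t - 1)), and exp(t - 1) is at least t. This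
  yields a tail majorant independent of s, as dominated convergence requires.\<close>

lemma powr_decay:
  fixes s t :: real
  assumes "s > 1" "r * ln s \<ge> 2" "t \<ge> 1"
  shows "s powr (r * (1 - t)) \<le> t powr -2"
proof -
  have "s powr (r * (1 - t)) = exp (- ((t - 1) * (r * ln s)))"
    using assms by (simp add: powr_def algebra_simps)
  also have "\<dots> \<le> exp (- ((t - 1) * 2))"
    using mult_left_mono[OF assms(2), of "t - 1"] assms by (intro iffD2[OF exp_le_cancel_iff]) auto
  also have "\<dots> = exp (t - 1) powr -2"
    by (simp add: powr_def algebra_simps)
  also have "\<dots> \<le> t powr -2"
    using assms exp_ge_add_one_self[of "t - 1"] by (intro powr_mono2') auto
  finally show ?thesis .
qed

text \<open>Here both weights are bounded through the index rather than the lag, which is the better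
  estimate for \<open>t > 1\<close>, where the index exceeds the lag: the exponent of N then becomes
  negative in t - 1.\<close>

lemma shift_prod_exponential_self_tail:
  assumes "\<beta> > 0" "0 \<le> a" "0 \<le> b" "\<beta> * b = 1" "t > 0" "N > 1"
  shows "shift_prod \<beta> a b N (nat \<lfloor>real N powr t - 1\<rfloor>) * (real N powr t * ln (real N)) \<le>
    2 powr (\<beta> * (a + b)) * (real N powr (-\<beta> * a) * ln (real N) * real N powr (\<beta> * a * (1 - t)))"
proof -
  let ?n = "real N"
  note lower = floor_powr_lower[of ?n t]
  have "shift_prod \<beta> a b N (nat \<lfloor>?n powr t - 1\<rfloor>) \<le> (?n powr t / 2) powr (-\<beta> * a) * (?n powr t / 2) powr (-\<beta> * b)"
    unfolding shift_prod_def using assms lower by (intro mult_mono powr_neg_mono) auto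
  also have "\<dots> = 2 powr (\<beta> * (a + b)) * ?n powr (- (t * (\<beta> * (a + b))))"
    using assms by (simp add: powr_divide powr_powr powr_minus powr_add powr_diff distrib_left field_simps)
  also have "?n powr (- (t * (\<beta> * (a + b)))) = ?n powr (-\<beta> * a) * ?n powr (\<beta> * a * (1 - t)) * ?n powr (-t)"
    using assms by (simp add: algebra_simps flip: powr_add)
  finally have "shift_prod \<beta> a b N (nat \<lfloor>?n powr t - 1\<rfloor>) * (?n powr t * ln ?n) \<le>
      2 powr (\<beta> * (a + b)) * (?n powr (-\<beta> * a) * ?n powr (\<beta> * a * (1 - t)) * ?n powr (-t)) * (?n powr t * ln ?n)"
    using assms by (intro mult_right_mono) auto
  also have "\<dots> = 2 powr (\<beta> * (a + b)) * (?n powr (-\<beta> * a) * ln ?n * ?n powr (\<beta> * a * (1 - t)))"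
    using assms by (simp add: powr_minus field_simps)
  finally show ?thesis .
qed

text \<open>Below \<open>t = 1\<close> the critical exponent makes the bound constant in t. Beyond
  it the tail estimate together with \<open>powr_decay\<close> gives t^(-2); the lower bound on the
  logarithm, true for large N, is what \<open>powr_decay\<close> asks for.\<close>

lemma shift_prod_exponential_self:
  assumes "\<beta> > 0" "0 \<le> a" "0 \<le> b" "\<beta> * b = 1" "\<beta> * a * ln (real N) \<ge> 2" "t > 0" "N > 1"
  shows "shift_prod \<beta> a b N (nat \<lfloor>real N powr t - 1\<rfloor>) * (real N powr t * ln (real N)) \<le>
    2 powr (\<beta> * (a + b)) * (real N powr (-\<beta> * a) * ln (real N) * two_powers 0 2 t)"
proof (cases "t < 1")
  case True
  have "shift_prod \<beta> a b N (nat \<lfloor>real N powr t - 1\<rfloor>) * (real N powr t * ln (real N)) \<le>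
      2 powr (\<beta> * b) * (real N powr (-\<beta> * a) * real N powr (t * (1 - \<beta> * b)) * ln (real N))"
    using assms by (intro shift_prod_exponential) auto
  also have "\<dots> = 2 powr (\<beta> * b) * (real N powr (-\<beta> * a) * ln (real N) * two_powers 0 2 t)"
    using assms True by (simp add: two_powers_def)
  also have "\<dots> \<le> 2 powr (\<beta> * (a + b)) * (real N powr (-\<beta> * a) * ln (real N) * two_powers 0 2 t)"
    using assms by (intro mult_right_mono powr_mono mult_left_mono) (auto simp: two_powers_nonneg)
  finally show ?thesis .
next
  case False
  have "real N powr (\<beta> * a * (1 - t)) \<le> two_powers 0 2 t"
    using powr_decay[of "real N" "\<beta> * a" t] assms False by (simp add: two_powers_def)
  then have "2 powr (\<beta> * (a + b)) * (real N powr (-\<beta> * a) * ln (real N) * real N powr (\<beta> * a * (1 - t))) \<le>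
      2 powr (\<beta> * (a + b)) * (real N powr (-\<beta> * a) * ln (real N) * two_powers 0 2 t)"
    using assms by (intro mult_left_mono) auto
  then show ?thesis
    using shift_prod_exponential_self_tail[OF assms(1-4,6,7)] by linarith
qed

section \<open>Reduction of the lag series to majorants and pointwise limits\<close>

section \<open>The lag series along sequences\<close>

definition lag_series :: "real \<Rightarrow> (nat \<Rightarrow> nat \<Rightarrow> real) \<Rightarrow> nat \<Rightarrow> nat \<Rightarrow> real" where
  "lag_series \<alpha> c N M = (\<Sum>\<^sub>\<infinity>(i, j). V \<alpha> (c (i + N) j) (c i (j + M)))"

text \<open>Swapping the summation indices exchanges the two arguments of V, and V is symmetric.
  Every regime thus has a mirror image with the two lags exchanged.\<close>

lemma lag_series_transpose: "lag_series \<alpha> (\<lambda>i j. c j i) M N = lag_series \<alpha> c N M"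
proof -
  have "(\<Sum>\<^sub>\<infinity>p\<in>UNIV. (\<lambda>(i, j). V \<alpha> (c (i + N) j) (c i (j + M))) (prod.swap p)) =
      (\<Sum>\<^sub>\<infinity>(i, j). V \<alpha> (c (i + N) j) (c i (j + M)))"
    by (rule infsum_reindex_bij_betw) (rule bij_swap)
  then show ?thesis
    unfolding lag_series_def by (subst V_commute) (simp add: case_prod_unfold)
qed

text \<open>The limit of \<open>V (A * \<xi>) (B * \<eta>) / (A * B powr (\<alpha> - 1))\<close> as \<open>A / B \<longlongrightarrow> \<kappa>\<close>.\<close>

definition kern :: "real \<Rightarrow> real \<Rightarrow> real \<Rightarrow> real \<Rightarrow> real" where
  "kern \<alpha> \<kappa> \<xi> \<eta> = \<xi> * \<eta> / ((\<kappa> * \<xi>)\<^sup>2 + \<eta>\<^sup>2) powr ((2 - \<alpha>) / 2)"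

lemma kern_1: "kern \<alpha> 1 \<xi> \<eta> = V \<alpha> \<xi> \<eta>"
  by (simp add: kern_def V_eq)

text \<open>With the first argument negligible, V degenerates to a product. This is the origin of
  the limits with factors raised to the power alpha - 1.\<close>

lemma kern_0:
  assumes "\<eta> > 0"
  shows "kern \<alpha> 0 \<xi> \<eta> = \<xi> * \<eta> powr (\<alpha> - 1)"
proof -
  have "\<eta>\<^sup>2 powr ((2 - \<alpha>) / 2) = \<eta> powr (2 - \<alpha>)"
    using assms by (simp add: powr_powr diff_divide_distrib algebra_simps flip: powr_numeral)
  also have "\<dots> = \<eta> / \<eta> powr (\<alpha> - 1)"
    using assms by (simp add: powr_diff power2_eq_square)
  finally show ?thesis
    using assms by (simp add: kern_def)
qed

text \<open>Brings the balanced limit, where the orders have ratio 1 / c, into the form in which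
  case (b) is stated.\<close>

lemma kern_inverse: "c > 0 \<Longrightarrow> kern \<alpha> (1 / c) \<xi> \<eta> = c * V \<alpha> (\<xi> * inverse c) \<eta>"
  by (simp add: kern_def V_eq field_simps)

text \<open>The assumptions are symmetric under exchanging the coordinates together with
  \<open>wI\<close> and \<open>wJ\<close>; a second interpretation of the locale delivers the
  mirrored regimes.\<close>

locale coefficients =
  fixes \<alpha> \<beta>1 \<beta>2 :: real and w :: "nat \<Rightarrow> nat \<Rightarrow> real" and wI wJ :: "nat \<Rightarrow> real"
  assumes alpha: "0 < \<alpha>" "\<alpha> \<le> 2" and beta: "1 / \<alpha> < \<beta>1" "1 / \<alpha> < \<beta>2"
    and w_lim: "((\<lambda>(i, j). w i j) \<longlongrightarrow> 1) (at_top \<times>\<^sub>F at_top)"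
    and wI_lim: "\<And>i. (\<lambda>j. w i j) \<longlonglongrightarrow> wI i" and wI_pos: "\<And>i. wI i > 0"
    and wJ_lim: "\<And>j. (\<lambda>i. w i j) \<longlonglongrightarrow> wJ j" and wJ_pos: "\<And>j. wJ j > 0"
begin

abbreviation c :: "nat \<Rightarrow> nat \<Rightarrow> real" where
  "c \<equiv> field_coeff \<beta>1 \<beta>2 w"

lemma beta_pos: "\<beta>1 > 0" "\<beta>2 > 0"
  using alpha beta by (smt (verit) divide_pos_pos)+

lemma beta_alpha: "\<beta>1 * \<alpha> > 1" "\<beta>2 * \<alpha> > 1"
  using alpha beta by (simp_all add: field_simps)

text \<open>Outside finitely many rows and columns the double limit bounds the weights by 2. Each
  exceptional row or column is a convergent sequence and hence bounded, so adding up these finitely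
  many bounds gives K.\<close>

lemma w_bounded: "\<exists>K\<ge>1. \<forall>i j. \<bar>w i j\<bar> \<le> K"
proof -
  have "\<forall>\<^sub>F p in at_top \<times>\<^sub>F at_top. \<bar>(\<lambda>(i, j). w i j) p\<bar> < 2"
    using order_tendstoD(2)[OF tendsto_rabs[OF w_lim], of 2] by simp
  then obtain n where n: "\<And>i j. i \<ge> n \<Longrightarrow> j \<ge> n \<Longrightarrow> \<bar>w i j\<bar> < 2"
    unfolding eventually_prod_sequentially by auto
  have "\<exists>B. \<forall>i. \<forall>j. \<bar>w i j\<bar> \<le> B i"
    using convergent_imp_Bseq[OF convergentI[OF wI_lim]] unfolding Bseq_def real_norm_def by metis
  then obtain B where B: "\<And>i j. \<bar>w i j\<bar> \<le> B i"
    by blast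
  have "\<exists>B. \<forall>j. \<forall>i. \<bar>w i j\<bar> \<le> B j"
    using convergent_imp_Bseq[OF convergentI[OF wJ_lim]] unfolding Bseq_def real_norm_def by metis
  then obtain B' where B': "\<And>i j. \<bar>w i j\<bar> \<le> B' j"
    by blast
  have nonneg: "0 \<le> B i" "0 \<le> B' i" for i
    using B[of i 0] B'[of 0 i] by linarith+
  define K where "K = 2 + sum B {..<n} + sum B' {..<n}"
  have "\<bar>w i j\<bar> \<le> K" for i j
  proof -
    have s: "0 \<le> sum B {..<n}" "0 \<le> sum B' {..<n}"
      using nonneg by (auto intro: sum_nonneg)
    consider "i < n" | "j < n" | "i \<ge> n" "j \<ge> n"
      by linarith
    then show ?thesis
    proof cases
      case 1
      then have "B i \<le> sum B {..<n}"
        using nonneg by (intro member_le_sum) auto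
      then show ?thesis
        using B[of i j] s by (simp add: K_def)
    next
      case 2
      then have "B' j \<le> sum B' {..<n}"
        using nonneg by (intro member_le_sum) auto
      then show ?thesis
        using B'[of i j] s by (simp add: K_def)
    next
      case 3
      then show ?thesis
        using n[of i j] s by (simp add: K_def)
    qed
  qed
  moreover have "K \<ge> 1"
    using nonneg by (auto simp: K_def intro!: add_nonneg_nonneg sum_nonneg)
  ultimately show ?thesis
    by blast
qed

text \<open>The powers of the bound K for the weights multiply to \<open>K powr \<alpha>\<close>
  whatever a is, so one constant C serves all admissible exponents. This matters where different
  exponents are used on different ranges of the index.\<close>

lemma term_bound:
  "\<exists>C\<ge>0. \<forall>a N M i j. \<alpha> - 1 \<le> a \<longrightarrow> a \<le> 1 \<longrightarrow> 0 \<le> a \<longrightarrow> a \<le> \<alpha> \<longrightarrow>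
    \<bar>V \<alpha> (c (i + N) j) (c i (j + M))\<bar> \<le> C * (shift_prod \<beta>1 a (\<alpha> - a) N i * shift_prod \<beta>2 (\<alpha> - a) a M j)"
proof -
  obtain K where K: "K \<ge> 1" "\<And>i j. \<bar>w i j\<bar> \<le> K"
    using w_bounded by blast
  have c_powr: "\<bar>c i j\<bar> powr a \<le> K powr a * ((1 + real i) powr (-\<beta>1 * a) * (1 + real j) powr (-\<beta>2 * a))"
    if "a \<ge> 0" for i j a
  proof -
    have "\<bar>c i j\<bar> powr a = \<bar>w i j\<bar> powr a * ((1 + real i) powr (-\<beta>1 * a) * (1 + real j) powr (-\<beta>2 * a))"
      by (simp add: field_coeff_def abs_mult powr_mult powr_powr)
    also have "\<dots> \<le> K powr a * ((1 + real i) powr (-\<beta>1 * a) * (1 + real j) powr (-\<beta>2 * a))"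
      using K that by (intro mult_right_mono powr_mono2) auto
    finally show ?thesis .
  qed
  have "\<bar>V \<alpha> (c (i + N) j) (c i (j + M))\<bar> \<le> K powr \<alpha> * (shift_prod \<beta>1 a (\<alpha> - a) N i * shift_prod \<beta>2 (\<alpha> - a) a M j)"
    if "\<alpha> - 1 \<le> a" "a \<le> 1" "0 \<le> a" "a \<le> \<alpha>" for a N M i j
  proof -
    have "\<bar>V \<alpha> (c (i + N) j) (c i (j + M))\<bar> \<le> \<bar>c (i + N) j\<bar> powr a * \<bar>c i (j + M)\<bar> powr (\<alpha> - a)"
      using that by (intro V_bound) auto
    also have "\<dots> \<le> (K powr a * ((1 + real (i + N)) powr (-\<beta>1 * a) * (1 + real j) powr (-\<beta>2 * a))) *
        (K powr (\<alpha> - a) * ((1 + real i) powr (-\<beta>1 * (\<alpha> - a)) * (1 + real (j + M)) powr (-\<beta>2 * (\<alpha> - a))))"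
      using that by (intro mult_mono c_powr) auto
    also have "\<dots> = (K powr a * K powr (\<alpha> - a)) * (shift_prod \<beta>1 a (\<alpha> - a) N i * shift_prod \<beta>2 (\<alpha> - a) a M j)"
      by (simp add: shift_prod_def mult_ac)
    also have "K powr a * K powr (\<alpha> - a) = K powr \<alpha>"
      by (simp flip: powr_add)
    finally show ?thesis .
  qed
  then show ?thesis
    by (intro exI[of _ "K powr \<alpha>"]) auto
qed

lemma w_tendsto_1:
  assumes "filterlim i at_top F" "filterlim j at_top F"
  shows "((\<lambda>k. w (i k) (j k)) \<longlongrightarrow> 1) F"
  using filterlim_compose[OF w_lim filterlim_Pair[OF assms]] by simp

lemma w_tendsto_wI: "filterlim j at_top F \<Longrightarrow> ((\<lambda>k. w i (j k)) \<longlongrightarrow> wI i) F"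
  by (rule filterlim_compose[OF wI_lim])

lemma w_tendsto_wJ: "filterlim i at_top F \<Longrightarrow> ((\<lambda>k. w (i k) j) \<longlongrightarrow> wJ j) F"
  by (rule filterlim_compose[OF wJ_lim])

text \<open>The common frame of all regimes: each one supplies a substitution per index, a rate R, a
  product majorant and a pointwise limit. The majorant carries the factor \<open>R k\<close> so that
  dividing the series by the rate leaves a bound free of k.\<close>

lemma lag_series_tendsto:
  fixes N M :: "nat \<Rightarrow> nat" and R :: "nat \<Rightarrow> real"
  assumes cells: "\<forall>\<^sub>F k in sequentially. unit_cells (\<phi> k) (\<phi>' k) \<and> unit_cells (\<psi> k) (\<psi>' k)"
    and R: "\<forall>\<^sub>F k in sequentially. 0 < R k"
    and bound: "\<forall>\<^sub>F k in sequentially. \<forall>u>0. \<forall>v>0.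
      \<bar>V \<alpha> (c (nat \<lfloor>\<phi> k u\<rfloor> + N k) (nat \<lfloor>\<psi> k v\<rfloor>)) (c (nat \<lfloor>\<phi> k u\<rfloor>) (nat \<lfloor>\<psi> k v\<rfloor> + M k))\<bar> * \<phi>' k u * \<psi>' k v
        \<le> R k * (C * (two_powers p1 q1 u * two_powers p2 q2 v))"
    and pq: "p1 < 1" "1 < q1" "p2 < 1" "1 < q2"
    and lim: "\<And>u v. 0 < u \<Longrightarrow> 0 < v \<Longrightarrow> u \<noteq> 1 \<Longrightarrow> v \<noteq> 1 \<Longrightarrow>
      (\<lambda>k. V \<alpha> (c (nat \<lfloor>\<phi> k u\<rfloor> + N k) (nat \<lfloor>\<psi> k v\<rfloor>)) (c (nat \<lfloor>\<phi> k u\<rfloor>) (nat \<lfloor>\<psi> k v\<rfloor> + M k)) / R k * \<phi>' k u * \<psi>' k v)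
        \<longlonglongrightarrow> G u v"
    and G: "(\<lambda>(u, v). G u v) \<in> borel_measurable borel"
  shows "set_integrable lborel ({0<..} \<times> {0<..}) (\<lambda>(u, v). G u v)"
    and "(\<lambda>k. lag_series \<alpha> c (N k) (M k) / R k) \<longlonglongrightarrow> (LINT p:{0<..} \<times> {0<..}|lborel. (\<lambda>(u, v). G u v) p)"
proof -
  have "\<forall>\<^sub>F k in sequentially. \<forall>u>0. \<forall>v>0.
      \<bar>V \<alpha> (c (nat \<lfloor>\<phi> k u\<rfloor> + N k) (nat \<lfloor>\<psi> k v\<rfloor>)) (c (nat \<lfloor>\<phi> k u\<rfloor>) (nat \<lfloor>\<psi> k v\<rfloor> + M k)) / R k * \<phi>' k u * \<psi>' k v\<bar>
        \<le> C * (two_powers p1 q1 u * two_powers p2 q2 v)"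
    using cells R bound
  proof eventually_elim
    case (elim k)
    then have "0 \<le> \<phi>' k u" "0 \<le> \<psi>' k u" for u
      by (auto simp: unit_cells_def)
    then show ?case
      using elim by (auto simp: abs_mult field_simps)
  qed
  note * = series_dominated_convergence[where F="\<lambda>k i j. V \<alpha> (c (i + N k) j) (c i (j + M k)) / R k",
    OF cells this pq lim G]
  show "set_integrable lborel ({0<..} \<times> {0<..}) (\<lambda>(u, v). G u v)"
    by (rule *(1))
  have "(\<Sum>\<^sub>\<infinity>(i, j). V \<alpha> (c (i + N k) j) (c i (j + M k)) / R k) = lag_series \<alpha> c (N k) (M k) / R k" for k
    using infsum_cmult_left'[of "\<lambda>(i, j). V \<alpha> (c (i + N k) j) (c i (j + M k))" "1 / R k" UNIV]
    by (simp add: lag_series_def case_prod_unfold)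
  then show "(\<lambda>k. lag_series \<alpha> c (N k) (M k) / R k) \<longlonglongrightarrow> (LINT p:{0<..} \<times> {0<..}|lborel. (\<lambda>(u, v). G u v) p)"
    using *(2) by simp
qed

text \<open>The sequences a1, a2 and b1, b2 are the orders of the two factors of the first and of
  the second coefficient, x and y the Jacobians. The two versions differ in which coefficient is
  assumed not to be negligible; the rate has to be the corresponding order of V times the
  Jacobians.\<close>

lemma term_tendsto:
  fixes i j N M :: "nat \<Rightarrow> nat" and a1 a2 b1 b2 x y :: "nat \<Rightarrow> real"
  assumes pos: "\<forall>\<^sub>F k in sequentially. 0 < a1 k \<and> 0 < a2 k \<and> 0 < b1 k \<and> 0 < b2 k \<and> 0 < x k \<and> 0 < y k"
    and X: "(\<lambda>k. (1 + real (i k + N k)) powr -\<beta>1 / a1 k) \<longlonglongrightarrow> X1" "(\<lambda>k. (1 + real (j k)) powr -\<beta>2 / a2 k) \<longlonglongrightarrow> X2"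
    and Y: "(\<lambda>k. (1 + real (i k)) powr -\<beta>1 / b1 k) \<longlonglongrightarrow> Y1" "(\<lambda>k. (1 + real (j k + M k)) powr -\<beta>2 / b2 k) \<longlonglongrightarrow> Y2"
    and W: "(\<lambda>k. w (i k + N k) (j k)) \<longlonglongrightarrow> W1" "(\<lambda>k. w (i k) (j k + M k)) \<longlonglongrightarrow> W2"
  shows "0 < W2 * Y1 * Y2 \<Longrightarrow> (\<lambda>k. (a1 k * a2 k) / (b1 k * b2 k)) \<longlonglongrightarrow> \<kappa> \<Longrightarrow>
      \<forall>\<^sub>F k in sequentially. R k = a1 k * a2 k * (b1 k * b2 k) powr (\<alpha> - 1) * x k * y k \<Longrightarrow>
      (\<lambda>k. V \<alpha> (c (i k + N k) (j k)) (c (i k) (j k + M k)) / R k * x k * y k) \<longlonglongrightarrow> kern \<alpha> \<kappa> (W1 * X1 * X2) (W2 * Y1 * Y2)"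
    and "0 < W1 * X1 * X2 \<Longrightarrow> (\<lambda>k. (b1 k * b2 k) / (a1 k * a2 k)) \<longlonglongrightarrow> \<kappa> \<Longrightarrow>
      \<forall>\<^sub>F k in sequentially. R k = b1 k * b2 k * (a1 k * a2 k) powr (\<alpha> - 1) * x k * y k \<Longrightarrow>
      (\<lambda>k. V \<alpha> (c (i k + N k) (j k)) (c (i k) (j k + M k)) / R k * x k * y k) \<longlonglongrightarrow> kern \<alpha> \<kappa> (W2 * Y1 * Y2) (W1 * X1 * X2)"
proof -
  define A where "A k = a1 k * a2 k" for k
  define B where "B k = b1 k * b2 k" for k
  define \<xi> where "\<xi> k = w (i k + N k) (j k) * ((1 + real (i k + N k)) powr -\<beta>1 / a1 k) * ((1 + real (j k)) powr -\<beta>2 / a2 k)" for k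
  define \<eta> where "\<eta> k = w (i k) (j k + M k) * ((1 + real (i k)) powr -\<beta>1 / b1 k) * ((1 + real (j k + M k)) powr -\<beta>2 / b2 k)" for k
  have lim: "\<xi> \<longlonglongrightarrow> W1 * X1 * X2" "\<eta> \<longlonglongrightarrow> W2 * Y1 * Y2"
    unfolding \<xi>_def \<eta>_def by (intro tendsto_intros X Y W)+
  have ab: "\<forall>\<^sub>F k in sequentially. A k > 0 \<and> B k > 0" "\<forall>\<^sub>F k in sequentially. B k > 0 \<and> A k > 0"
    using pos by (auto simp: A_def B_def elim: eventually_mono)
  have eq: "\<forall>\<^sub>F k in sequentially. c (i k + N k) (j k) = A k * \<xi> k \<and> c (i k) (j k + M k) = B k * \<eta> k"
    using pos by eventually_elim (auto simp: A_def B_def \<xi>_def \<eta>_def field_coeff_def)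
  {
    assume "0 < W2 * Y1 * Y2" "(\<lambda>k. (a1 k * a2 k) / (b1 k * b2 k)) \<longlonglongrightarrow> \<kappa>"
      and R: "\<forall>\<^sub>F k in sequentially. R k = a1 k * a2 k * (b1 k * b2 k) powr (\<alpha> - 1) * x k * y k"
    then have "(\<lambda>k. V \<alpha> (A k * \<xi> k) (B k * \<eta> k) / (A k * B k powr (\<alpha> - 1))) \<longlonglongrightarrow> kern \<alpha> \<kappa> (W1 * X1 * X2) (W2 * Y1 * Y2)"
      unfolding kern_def by (intro V_scaled_tendsto ab lim) (auto simp: A_def B_def)
    moreover have "\<forall>\<^sub>F k in sequentially. V \<alpha> (A k * \<xi> k) (B k * \<eta> k) / (A k * B k powr (\<alpha> - 1)) =
        V \<alpha> (c (i k + N k) (j k)) (c (i k) (j k + M k)) / R k * x k * y k"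
      using R eq pos by eventually_elim (simp add: A_def B_def field_simps)
    ultimately show "(\<lambda>k. V \<alpha> (c (i k + N k) (j k)) (c (i k) (j k + M k)) / R k * x k * y k) \<longlonglongrightarrow> kern \<alpha> \<kappa> (W1 * X1 * X2) (W2 * Y1 * Y2)"
      by (rule Lim_transform_eventually)
  }
  {
    assume "0 < W1 * X1 * X2" "(\<lambda>k. (b1 k * b2 k) / (a1 k * a2 k)) \<longlonglongrightarrow> \<kappa>"
      and R: "\<forall>\<^sub>F k in sequentially. R k = b1 k * b2 k * (a1 k * a2 k) powr (\<alpha> - 1) * x k * y k"
    then have "(\<lambda>k. V \<alpha> (B k * \<eta> k) (A k * \<xi> k) / (B k * A k powr (\<alpha> - 1))) \<longlonglongrightarrow> kern \<alpha> \<kappa> (W2 * Y1 * Y2) (W1 * X1 * X2)"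
      unfolding kern_def by (intro V_scaled_tendsto ab lim) (auto simp: A_def B_def)
    moreover have "\<forall>\<^sub>F k in sequentially. V \<alpha> (B k * \<eta> k) (A k * \<xi> k) / (B k * A k powr (\<alpha> - 1)) =
        V \<alpha> (c (i k + N k) (j k)) (c (i k) (j k + M k)) / R k * x k * y k"
      using R eq pos by eventually_elim (simp add: A_def B_def V_commute field_simps)
    ultimately show "(\<lambda>k. V \<alpha> (c (i k + N k) (j k)) (c (i k) (j k + M k)) / R k * x k * y k) \<longlonglongrightarrow> kern \<alpha> \<kappa> (W2 * Y1 * Y2) (W1 * X1 * X2)"
      by (rule Lim_transform_eventually)
  }
qed

end

section \<open>Regimes with unscaled or linearly rescaled indices\<close>

section \<open>The scaling regimes\<close>

lemma product_bound:
  fixes z C p q x y r1 r2 t1 t2 :: real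
  assumes "\<bar>z\<bar> \<le> C * (p * q)" "p * x \<le> r1 * t1" "q * y \<le> r2 * t2"
    and "0 \<le> C" "0 \<le> p" "0 \<le> q" "0 \<le> x" "0 \<le> y"
  shows "\<bar>z\<bar> * x * y \<le> r1 * r2 * (C * (t1 * t2))"
proof -
  have "\<bar>z\<bar> * x * y \<le> C * (p * q) * x * y"
    using assms by (intro mult_right_mono) auto
  also have "\<dots> = C * ((p * x) * (q * y))"
    by simp
  also have "\<dots> \<le> C * ((r1 * t1) * (r2 * t2))"
  proof (rule mult_left_mono, rule mult_mono)
    have "0 \<le> p * x"
      using assms by simp
    then show "0 \<le> r1 * t1"
      using assms(2) by linarith
  qed (use assms in auto)
  finally show ?thesis
    by (simp add: mult_ac)
qed

lemma real_nat_at_top: "filterlim N at_top F \<Longrightarrow> filterlim (\<lambda>k. real (N k)) at_top F"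
  by (rule filterlim_compose[OF filterlim_real_sequentially])

lemma ratio_mult_tendsto:
  fixes s :: "nat \<Rightarrow> real"
  assumes "filterlim s at_top sequentially"
  shows "(\<lambda>k. s k * t / s k) \<longlonglongrightarrow> t"
proof (rule Lim_transform_eventually[OF tendsto_const])
  have "\<forall>\<^sub>F k in sequentially. 0 < s k"
    using assms by (simp add: filterlim_at_top_dense)
  then show "\<forall>\<^sub>F k in sequentially. t = s k * t / s k"
    by eventually_elim simp
qed

lemma nat_floor_mult_at_top:
  fixes s :: "nat \<Rightarrow> real"
  assumes "filterlim s at_top sequentially" "t > 0"
  shows "filterlim (\<lambda>k. nat \<lfloor>s k * t\<rfloor>) at_top sequentially"
  by (intro filterlim_nat_floor filterlim_at_top_mult_tendsto_pos[OF tendsto_const] assms)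

lemma add_nat_at_top:
  fixes f :: "nat \<Rightarrow> nat"
  assumes "filterlim N at_top sequentially"
  shows "filterlim (\<lambda>k. f k + N k) at_top sequentially"
  using assms by (rule filterlim_at_top_mono) auto

lemma powr_neg_tendsto_0: "filterlim s at_top F \<Longrightarrow> b > 0 \<Longrightarrow> ((\<lambda>k. s k powr -b :: real) \<longlongrightarrow> 0) F"
  by (rule tendsto_neg_powr) auto

lemma shifted_powr_const:
  fixes N :: "nat \<Rightarrow> nat"
  assumes "filterlim N at_top sequentially"
  shows "(\<lambda>k. (1 + real (i + N k)) powr b / real (N k) powr b) \<longlonglongrightarrow> 1"
  using shifted_powr_tendsto[OF assms _ const_over_tendsto_0[OF real_nat_at_top[OF assms]], of "real i" b] by simp

lemma two_powers_antimono: "q' \<le> q \<Longrightarrow> two_powers p q u \<le> two_powers p q' u"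
  by (simp add: two_powers_def powr_mono)

lemma eventually_pos_nat: "filterlim N at_top F \<Longrightarrow> \<forall>\<^sub>F k in F. (0::nat) < N k"
  using eventually_gt_at_top[of "0::nat"] by (auto simp: filterlim_iff)

context coefficients
begin

text \<open>Each index is scaled by its own lag, so both arguments of V have order N^(-beta1)
  M^(-beta2) and V itself survives in the limit. The two conditions on a make the singularities at
  the axes integrable; the tails are integrable because beta1 alpha and beta2 alpha exceed
  1.\<close>

lemma both_linear:
  fixes N M :: "nat \<Rightarrow> nat"
  assumes N: "filterlim N at_top sequentially" and M: "filterlim M at_top sequentially"
    and a: "\<alpha> - 1 \<le> a" "a \<le> 1" "0 \<le> a" "a \<le> \<alpha>" "\<beta>1 * (\<alpha> - a) < 1" "\<beta>2 * a < 1"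
  defines "G \<equiv> \<lambda>u v. V \<alpha> ((1 + u) powr (-\<beta>1) * v powr (-\<beta>2)) (u powr (-\<beta>1) * (1 + v) powr (-\<beta>2))"
  shows "set_integrable lborel ({0<..} \<times> {0<..}) (\<lambda>(u, v). G u v)"
    and "(\<lambda>k. lag_series \<alpha> c (N k) (M k) / (real (N k) powr (1 - \<beta>1 * \<alpha>) * real (M k) powr (1 - \<beta>2 * \<alpha>)))
      \<longlonglongrightarrow> (LINT p:{0<..} \<times> {0<..}|lborel. (\<lambda>(u, v). G u v) p)"
proof -
  note pos = eventually_pos_nat[OF N] eventually_pos_nat[OF M]
  obtain C where C: "C \<ge> 0" "\<And>N M i j. \<bar>V \<alpha> (c (i + N) j) (c i (j + M))\<bar> \<le>
      C * (shift_prod \<beta>1 a (\<alpha> - a) N i * shift_prod \<beta>2 (\<alpha> - a) a M j)"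
    using term_bound a by metis
  have cells: "\<forall>\<^sub>F k in sequentially. unit_cells (\<lambda>u. real (N k) * u) (\<lambda>u. real (N k)) \<and>
      unit_cells (\<lambda>u. real (M k) * u) (\<lambda>u. real (M k))"
    using pos by eventually_elim (auto intro: unit_cells_linear)
  have bound: "\<forall>\<^sub>F k in sequentially. \<forall>u>0. \<forall>v>0.
      \<bar>V \<alpha> (c (nat \<lfloor>real (N k) * u\<rfloor> + N k) (nat \<lfloor>real (M k) * v\<rfloor>)) (c (nat \<lfloor>real (N k) * u\<rfloor>) (nat \<lfloor>real (M k) * v\<rfloor> + M k))\<bar>
          * real (N k) * real (M k)
        \<le> real (N k) powr (1 - \<beta>1 * \<alpha>) * real (M k) powr (1 - \<beta>2 * \<alpha>) *
          (C * (two_powers (\<beta>1 * (\<alpha> - a)) (\<beta>1 * \<alpha>) u * two_powers (\<beta>2 * a) (\<beta>2 * \<alpha>) v))"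
    using pos
  proof eventually_elim
    case (elim k)
    show ?case
      using shift_prod_linear_self[OF beta_pos(1), of a "\<alpha> - a" "N k"] shift_prod_linear_self[OF beta_pos(2), of "\<alpha> - a" a "M k"]
        a elim C(1)
      by (intro allI impI product_bound[OF C(2)]) (auto simp: shift_prod_nonneg)
  qed
  have lim: "(\<lambda>k. V \<alpha> (c (nat \<lfloor>real (N k) * u\<rfloor> + N k) (nat \<lfloor>real (M k) * v\<rfloor>)) (c (nat \<lfloor>real (N k) * u\<rfloor>) (nat \<lfloor>real (M k) * v\<rfloor> + M k))
        / (real (N k) powr (1 - \<beta>1 * \<alpha>) * real (M k) powr (1 - \<beta>2 * \<alpha>)) * real (N k) * real (M k)) \<longlonglongrightarrow> G u v"
    if "0 < u" "0 < v" for u v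
  proof -
    \<comment> \<open>The goal is put into the shape \<open>W * X1 * X2\<close> of
      \<open>term_tendsto\<close>; the leading factors 1 are the limits of the weights when both
      indices tend to infinity.\<close>
    have k1: "kern \<alpha> 1 (1 * (1 + u) powr -\<beta>1 * v powr -\<beta>2) (1 * u powr -\<beta>1 * (1 + v) powr -\<beta>2) = G u v"
      by (simp add: kern_1 G_def)
    show ?thesis
      unfolding k1[symmetric]
    proof (rule term_tendsto(1))
      show "0 < 1 * u powr - \<beta>1 * (1 + v) powr - \<beta>2"
        using that by simp
      show "\<forall>\<^sub>F k in sequentially. 0 < real (N k) powr -\<beta>1 \<and> 0 < real (M k) powr -\<beta>2 \<and>
        0 < real (N k) powr -\<beta>1 \<and> 0 < real (M k) powr -\<beta>2 \<and> 0 < real (N k) \<and> 0 < real (M k)"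
        using pos by eventually_elim auto
      then show "(\<lambda>k. real (N k) powr -\<beta>1 * real (M k) powr -\<beta>2 / (real (N k) powr -\<beta>1 * real (M k) powr -\<beta>2)) \<longlonglongrightarrow> 1"
        by (intro Lim_transform_eventually[OF tendsto_const]) (auto elim: eventually_mono)
      show "\<forall>\<^sub>F k in sequentially. real (N k) powr (1 - \<beta>1 * \<alpha>) * real (M k) powr (1 - \<beta>2 * \<alpha>) =
        real (N k) powr -\<beta>1 * real (M k) powr -\<beta>2 * (real (N k) powr -\<beta>1 * real (M k) powr -\<beta>2) powr (\<alpha> - 1) * real (N k) * real (M k)"
        using pos
      proof eventually_elim
        case (elim k)
        \<comment> \<open>Writing the positive integers as exponentials turns an identity between
          powers into a linear identity between exponents, which the simplifier can settle.\<close>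
        then obtain x y where "real (N k) = exp x" "real (M k) = exp y"
          by (metis exp_ln of_nat_0_less_iff)
        then show ?case
          by (simp add: powr_def ln_mult flip: exp_add) (simp add: algebra_simps)
      qed
    qed (intro shifted_powr_tendsto floor_powr_tendsto w_tendsto_1 N M ratio_mult_tendsto nat_floor_mult_at_top
        add_nat_at_top real_nat_at_top; use that in simp)+
  qed
  have meas: "(\<lambda>(u, v). G u v) \<in> borel_measurable borel"
    unfolding G_def borel_prod[symmetric] case_prod_unfold by measurable
  have R: "\<forall>\<^sub>F k in sequentially. 0 < real (N k) powr (1 - \<beta>1 * \<alpha>) * real (M k) powr (1 - \<beta>2 * \<alpha>)"
    using pos by eventually_elim auto
  show "set_integrable lborel ({0<..} \<times> {0<..}) (\<lambda>(u, v). G u v)"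
    "(\<lambda>k. lag_series \<alpha> c (N k) (M k) / (real (N k) powr (1 - \<beta>1 * \<alpha>) * real (M k) powr (1 - \<beta>2 * \<alpha>)))
      \<longlonglongrightarrow> (LINT p:{0<..} \<times> {0<..}|lborel. (\<lambda>(u, v). G u v) p)"
    using lag_series_tendsto[OF cells R bound a(5) beta_alpha(1) a(6) beta_alpha(2) lim meas] by blast+
qed


lemma wI_factor_pos: "0 < wI i * (1 + real i) powr x"
  using wI_pos[of i] by (intro mult_pos_pos) auto

text \<open>The index i stays while j is scaled by its lag. The first argument is smaller than the
  second by the factor N^(-beta1), so the kernel limit is the degenerate one with ratio 0. The
  choice a = 1 makes the i-sum converge by beta1 (alpha-1) > 1, and beta2 < 1 makes the singularity
  at v = 0 integrable.\<close>

lemma const_linear: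
  fixes N M :: "nat \<Rightarrow> nat"
  assumes N: "filterlim N at_top sequentially" and M: "filterlim M at_top sequentially"
    and hyp: "1 < \<alpha>" "\<beta>1 * (\<alpha> - 1) > 1" "\<beta>2 < 1"
  defines "G \<equiv> \<lambda>i v. wI i powr (\<alpha> - 1) * (1 + real i) powr (-\<beta>1 * (\<alpha> - 1)) * (v powr (-\<beta>2) * (1 + v) powr (-\<beta>2 * (\<alpha> - 1)))"
  shows "set_integrable lborel ({0<..} \<times> {0<..}) (\<lambda>(u::real, v). G (nat \<lfloor>u\<rfloor>) v)"
    and "(\<lambda>k. lag_series \<alpha> c (N k) (M k) / (real (N k) powr (-\<beta>1) * real (M k) powr (1 - \<beta>2 * \<alpha>)))
      \<longlonglongrightarrow> (LINT p:{0<..} \<times> {0<..}|lborel. (\<lambda>(u::real, v). G (nat \<lfloor>u\<rfloor>) v) p)"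
proof -
  note pos = eventually_pos_nat[OF N] eventually_pos_nat[OF M]
  have "\<alpha> - 1 \<le> 1" "(1::real) \<le> 1" "(0::real) \<le> 1" "1 \<le> \<alpha>"
    using alpha hyp by simp_all
  then obtain C where C: "C \<ge> 0" "\<And>N M i j. \<bar>V \<alpha> (c (i + N) j) (c i (j + M))\<bar> \<le>
      C * (shift_prod \<beta>1 1 (\<alpha> - 1) N i * shift_prod \<beta>2 (\<alpha> - 1) 1 M j)"
    using term_bound by metis
  have cells: "\<forall>\<^sub>F k in sequentially. unit_cells (\<lambda>u. u) (\<lambda>u. 1) \<and>
      unit_cells (\<lambda>u. real (M k) * u) (\<lambda>u. real (M k))"
    using pos by eventually_elim (auto intro: unit_cells_linear unit_cells_id)
  have bound: "\<forall>\<^sub>F k in sequentially. \<forall>u>0. \<forall>v>0.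
      \<bar>V \<alpha> (c (nat \<lfloor>u\<rfloor> + N k) (nat \<lfloor>real (M k) * v\<rfloor>)) (c (nat \<lfloor>u\<rfloor>) (nat \<lfloor>real (M k) * v\<rfloor> + M k))\<bar>
          * 1 * real (M k)
        \<le> real (N k) powr -\<beta>1 * real (M k) powr (1 - \<beta>2 * \<alpha>) *
          (C * (two_powers 0 (\<beta>1 * (\<alpha> - 1)) u * two_powers \<beta>2 (\<beta>2 * \<alpha>) v))"
    using pos
  proof eventually_elim
    case (elim k)
    show ?case
      using shift_prod_const[OF beta_pos(1), of 1 "\<alpha> - 1" "N k"] shift_prod_linear_self[OF beta_pos(2), of "\<alpha> - 1" 1 "M k"]
        hyp elim C(1)
      by (intro allI impI product_bound[OF C(2)]) (auto simp: shift_prod_nonneg)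
  qed
  have lim: "(\<lambda>k. V \<alpha> (c (nat \<lfloor>u\<rfloor> + N k) (nat \<lfloor>real (M k) * v\<rfloor>)) (c (nat \<lfloor>u\<rfloor>) (nat \<lfloor>real (M k) * v\<rfloor> + M k))
        / (real (N k) powr -\<beta>1 * real (M k) powr (1 - \<beta>2 * \<alpha>)) * 1 * real (M k)) \<longlonglongrightarrow> G (nat \<lfloor>u\<rfloor>) v"
    if "0 < u" "0 < v" for u v
  proof -
    let ?i = "nat \<lfloor>u\<rfloor>"
    have k0: "kern \<alpha> 0 (1 * 1 * v powr -\<beta>2) (wI ?i * (1 + real ?i) powr -\<beta>1 * (1 + v) powr -\<beta>2) = G ?i v"
      using that wI_pos[of ?i]
      by (subst kern_0, intro mult_pos_pos[OF wI_factor_pos]) (auto simp: G_def powr_mult powr_powr less_imp_le)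
    show ?thesis
      unfolding k0[symmetric]
    proof (rule term_tendsto(1))
      show "0 < wI ?i * (1 + real ?i) powr -\<beta>1 * (1 + v) powr -\<beta>2"
        using that by (intro mult_pos_pos[OF wI_factor_pos]) simp
      show "\<forall>\<^sub>F k in sequentially. 0 < real (N k) powr -\<beta>1 \<and> 0 < real (M k) powr -\<beta>2 \<and>
        0 < (1::real) \<and> 0 < real (M k) powr -\<beta>2 \<and> 0 < (1::real) \<and> 0 < real (M k)"
        using pos by eventually_elim auto
      then show "(\<lambda>k. real (N k) powr -\<beta>1 * real (M k) powr -\<beta>2 / (1 * real (M k) powr -\<beta>2)) \<longlonglongrightarrow> 0"
        by (intro Lim_transform_eventually[OF powr_neg_tendsto_0[OF real_nat_at_top[OF N] beta_pos(1)]])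
          (auto elim: eventually_mono)
      show "\<forall>\<^sub>F k in sequentially. real (N k) powr -\<beta>1 * real (M k) powr (1 - \<beta>2 * \<alpha>) =
        real (N k) powr -\<beta>1 * real (M k) powr -\<beta>2 * (1 * real (M k) powr -\<beta>2) powr (\<alpha> - 1) * 1 * real (M k)"
        using pos
      proof eventually_elim
        case (elim k)
        then obtain x y where "real (N k) = exp x" "real (M k) = exp y"
          by (metis exp_ln of_nat_0_less_iff)
        then show ?case
          by (simp add: powr_def ln_mult flip: exp_add) (simp add: algebra_simps)
      qed
      show "(\<lambda>k. (1 + real ?i) powr -\<beta>1 / 1) \<longlonglongrightarrow> (1 + real ?i) powr -\<beta>1"
        by simp
      show "(\<lambda>k. w ?i (nat \<lfloor>real (M k) * v\<rfloor> + M k)) \<longlonglongrightarrow> wI ?i"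
        by (intro w_tendsto_wI add_nat_at_top M)
      show "(\<lambda>k. (1 + real (?i + N k)) powr -\<beta>1 / real (N k) powr -\<beta>1) \<longlonglongrightarrow> 1"
        by (intro shifted_powr_const N)
    qed (intro shifted_powr_tendsto floor_powr_tendsto w_tendsto_1 N M ratio_mult_tendsto nat_floor_mult_at_top
        add_nat_at_top real_nat_at_top; use that in simp)+
  qed
  have meas: "(\<lambda>(u::real, v). G (nat \<lfloor>u\<rfloor>) v) \<in> borel_measurable borel"
    unfolding G_def borel_prod[symmetric] case_prod_unfold by measurable
  have R: "\<forall>\<^sub>F k in sequentially. 0 < real (N k) powr -\<beta>1 * real (M k) powr (1 - \<beta>2 * \<alpha>)"
    using pos by eventually_elim auto
  show "set_integrable lborel ({0<..} \<times> {0<..}) (\<lambda>(u::real, v). G (nat \<lfloor>u\<rfloor>) v)"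
    "(\<lambda>k. lag_series \<alpha> c (N k) (M k) / (real (N k) powr (-\<beta>1) * real (M k) powr (1 - \<beta>2 * \<alpha>)))
      \<longlonglongrightarrow> (LINT p:{0<..} \<times> {0<..}|lborel. (\<lambda>(u::real, v). G (nat \<lfloor>u\<rfloor>) v) p)"
    using lag_series_tendsto[OF cells R bound _ hyp(2) hyp(3) beta_alpha(2) lim meas] by simp_all
qed

text \<open>With both indices kept, the arguments have orders A = N^(-beta1) and B = M^(-beta2), and
  the rate is A B^(alpha-1). The majorant carries A^a B^(alpha-a), which exceeds the rate by (B /
  A)^(1-a); hypothesis \<open>D\<close> bounds this factor. It is trivial for a = 1 and holds for
  other a when B / A stays bounded.\<close>

lemma const_const:
  fixes N M :: "nat \<Rightarrow> nat"
  assumes N: "filterlim N at_top sequentially" and M: "filterlim M at_top sequentially"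
    and a: "\<alpha> - 1 \<le> a" "a \<le> 1" "0 \<le> a" "a \<le> \<alpha>" "\<beta>1 * (\<alpha> - a) > 1" "\<beta>2 * a > 1"
    and \<kappa>: "(\<lambda>k. real (N k) powr -\<beta>1 / real (M k) powr -\<beta>2) \<longlonglongrightarrow> \<kappa>"
    and D: "\<forall>\<^sub>F k in sequentially. real (N k) powr (-\<beta>1 * a) * real (M k) powr (-\<beta>2 * (\<alpha> - a)) \<le>
      D * (real (N k) powr -\<beta>1 * real (M k) powr (-\<beta>2 * (\<alpha> - 1)))"
  defines "G \<equiv> \<lambda>i j. kern \<alpha> \<kappa> (wJ j * (1 + real j) powr -\<beta>2) (wI i * (1 + real i) powr -\<beta>1)"
  shows "(\<lambda>(i, j). G i j) summable_on UNIV"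
    and "(\<lambda>k. lag_series \<alpha> c (N k) (M k) / (real (N k) powr (-\<beta>1) * real (M k) powr (-\<beta>2 * (\<alpha> - 1))))
      \<longlonglongrightarrow> (\<Sum>\<^sub>\<infinity>(i, j). G i j)"
proof -
  note pos = eventually_pos_nat[OF N] eventually_pos_nat[OF M]
  obtain C where C: "C \<ge> 0" "\<And>N M i j. \<bar>V \<alpha> (c (i + N) j) (c i (j + M))\<bar> \<le>
      C * (shift_prod \<beta>1 a (\<alpha> - a) N i * shift_prod \<beta>2 (\<alpha> - a) a M j)"
    using term_bound a by metis
  have cells: "\<forall>\<^sub>F k::nat in sequentially. unit_cells (\<lambda>u. u) (\<lambda>u. 1) \<and> unit_cells (\<lambda>u. u) (\<lambda>u. 1)"
    by (simp add: unit_cells_id)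
  have bound: "\<forall>\<^sub>F k in sequentially. \<forall>u>0. \<forall>v>0.
      \<bar>V \<alpha> (c (nat \<lfloor>u\<rfloor> + N k) (nat \<lfloor>v\<rfloor>)) (c (nat \<lfloor>u\<rfloor>) (nat \<lfloor>v\<rfloor> + M k))\<bar> * 1 * 1
        \<le> real (N k) powr -\<beta>1 * real (M k) powr (-\<beta>2 * (\<alpha> - 1)) *
          ((D * C) * (two_powers 0 (\<beta>1 * (\<alpha> - a)) u * two_powers 0 (\<beta>2 * a) v))"
    using pos D
  proof eventually_elim
    case (elim k)
    show ?case
    proof (intro allI impI)
      fix u v :: real assume uv: "0 < u" "0 < v"
      let ?T = "C * (two_powers 0 (\<beta>1 * (\<alpha> - a)) u * two_powers 0 (\<beta>2 * a) v)"
      have "\<bar>V \<alpha> (c (nat \<lfloor>u\<rfloor> + N k) (nat \<lfloor>v\<rfloor>)) (c (nat \<lfloor>u\<rfloor>) (nat \<lfloor>v\<rfloor> + M k))\<bar> * 1 * 1 \<le>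
          real (N k) powr (-\<beta>1 * a) * real (M k) powr (-\<beta>2 * (\<alpha> - a)) * ?T"
        using shift_prod_const[OF beta_pos(1), of a "\<alpha> - a" "N k"] shift_prod_const[OF beta_pos(2), of "\<alpha> - a" a "M k"]
          a elim C(1) uv
        by (intro product_bound[OF C(2)]) (auto simp: shift_prod_nonneg)
      also have "\<dots> \<le> D * (real (N k) powr -\<beta>1 * real (M k) powr (-\<beta>2 * (\<alpha> - 1))) * ?T"
        using elim C(1) by (intro mult_right_mono) (auto simp: two_powers_nonneg)
      finally show "\<bar>V \<alpha> (c (nat \<lfloor>u\<rfloor> + N k) (nat \<lfloor>v\<rfloor>)) (c (nat \<lfloor>u\<rfloor>) (nat \<lfloor>v\<rfloor> + M k))\<bar> * 1 * 1 \<le>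
          real (N k) powr -\<beta>1 * real (M k) powr (-\<beta>2 * (\<alpha> - 1)) *
          ((D * C) * (two_powers 0 (\<beta>1 * (\<alpha> - a)) u * two_powers 0 (\<beta>2 * a) v))"
        by (simp only: mult_ac)
    qed
  qed
  have lim: "(\<lambda>k. V \<alpha> (c (nat \<lfloor>u\<rfloor> + N k) (nat \<lfloor>v\<rfloor>)) (c (nat \<lfloor>u\<rfloor>) (nat \<lfloor>v\<rfloor> + M k))
        / (real (N k) powr -\<beta>1 * real (M k) powr (-\<beta>2 * (\<alpha> - 1))) * 1 * 1) \<longlonglongrightarrow> G (nat \<lfloor>u\<rfloor>) (nat \<lfloor>v\<rfloor>)"
    for u v :: real
  proof -
    let ?i = "nat \<lfloor>u\<rfloor>" and ?j = "nat \<lfloor>v\<rfloor>"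
    have k0: "kern \<alpha> \<kappa> (wJ ?j * 1 * (1 + real ?j) powr -\<beta>2) (wI ?i * (1 + real ?i) powr -\<beta>1 * 1) = G ?i ?j"
      by (simp add: G_def)
    show ?thesis
      unfolding k0[symmetric]
    proof (rule term_tendsto(1))
      show "0 < wI ?i * (1 + real ?i) powr -\<beta>1 * 1"
        using wI_pos[of ?i] by simp
      show "\<forall>\<^sub>F k in sequentially. 0 < real (N k) powr -\<beta>1 \<and> 0 < (1::real) \<and>
        0 < (1::real) \<and> 0 < real (M k) powr -\<beta>2 \<and> 0 < (1::real) \<and> 0 < (1::real)"
        using pos by eventually_elim auto
      show "(\<lambda>k. real (N k) powr -\<beta>1 * 1 / (1 * real (M k) powr -\<beta>2)) \<longlonglongrightarrow> \<kappa>"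
        using \<kappa> by simp
      show "\<forall>\<^sub>F k in sequentially. real (N k) powr -\<beta>1 * real (M k) powr (-\<beta>2 * (\<alpha> - 1)) =
        real (N k) powr -\<beta>1 * 1 * (1 * real (M k) powr -\<beta>2) powr (\<alpha> - 1) * 1 * 1"
        by (simp add: powr_powr)
      show "(\<lambda>k. (1 + real ?i) powr -\<beta>1 / 1) \<longlonglongrightarrow> (1 + real ?i) powr -\<beta>1"
        "(\<lambda>k. (1 + real ?j) powr -\<beta>2 / 1) \<longlonglongrightarrow> (1 + real ?j) powr -\<beta>2"
        by simp_all
      show "(\<lambda>k. w ?i (nat \<lfloor>v\<rfloor> + M k)) \<longlonglongrightarrow> wI ?i" "(\<lambda>k. w (?i + N k) ?j) \<longlonglongrightarrow> wJ ?j"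
        by (intro w_tendsto_wI w_tendsto_wJ add_nat_at_top M N)+
    qed (intro shifted_powr_const N M)+
  qed
  have meas: "(\<lambda>(u::real, v::real). G (nat \<lfloor>u\<rfloor>) (nat \<lfloor>v\<rfloor>)) \<in> borel_measurable borel"
    unfolding G_def kern_def borel_prod[symmetric] case_prod_unfold by measurable
  have R: "\<forall>\<^sub>F k in sequentially. 0 < real (N k) powr -\<beta>1 * real (M k) powr (-\<beta>2 * (\<alpha> - 1))"
    using pos by eventually_elim auto
  note * = lag_series_tendsto[OF cells R bound _ a(5) _ a(6) lim meas, simplified]
  note double = double_series[OF unit_cells_id unit_cells_id, of G, simplified]
  show "(\<lambda>(i, j). G i j) summable_on UNIV"
    using * double by simp
  show "(\<lambda>k. lag_series \<alpha> c (N k) (M k) / (real (N k) powr (-\<beta>1) * real (M k) powr (-\<beta>2 * (\<alpha> - 1))))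
      \<longlonglongrightarrow> (\<Sum>\<^sub>\<infinity>(i, j). G i j)"
    using * double by simp
qed


text \<open>At j = s v the first argument has the order M^(-beta2) of the second, so V survives with
  v^(-beta2) in one slot. The scale s is large but small compared with M, hence the shift of j by M
  is asymptotically M alone. Exponent \<open>a1\<close> makes the majorant integrable near v = 0 and
  \<open>a2\<close> makes it integrable at infinity.\<close>

lemma const_scaled:
  fixes N M :: "nat \<Rightarrow> nat"
  assumes N: "filterlim N at_top sequentially" and M: "filterlim M at_top sequentially"
  defines "s \<equiv> \<lambda>k. real (M k) * real (N k) powr (-\<beta>1 / \<beta>2)"
  assumes s: "filterlim s at_top sequentially"
    and a1: "\<alpha> - 1 \<le> a1" "a1 \<le> 1" "0 \<le> a1" "a1 \<le> \<alpha>" "\<beta>2 * a1 < 1"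
    and a2: "\<alpha> - 1 \<le> a2" "a2 \<le> 1" "0 \<le> a2" "a2 \<le> \<alpha>" "\<beta>2 * a2 > 1" "\<beta>1 * (\<alpha> - a2) > 1"
  defines "G \<equiv> \<lambda>i v. V \<alpha> (v powr (-\<beta>2)) (wI i * (1 + real i) powr (-\<beta>1))"
  shows "set_integrable lborel ({0<..} \<times> {0<..}) (\<lambda>(u::real, v). G (nat \<lfloor>u\<rfloor>) v)"
    and "(\<lambda>k. lag_series \<alpha> c (N k) (M k) / (s k * real (M k) powr (-\<beta>2 * \<alpha>)))
      \<longlonglongrightarrow> (LINT p:{0<..} \<times> {0<..}|lborel. (\<lambda>(u::real, v). G (nat \<lfloor>u\<rfloor>) v) p)"
proof -
  note pos = eventually_pos_nat[OF N] eventually_pos_nat[OF M]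
  obtain C where C: "C \<ge> 0" "\<And>a N M i j. \<alpha> - 1 \<le> a \<Longrightarrow> a \<le> 1 \<Longrightarrow> 0 \<le> a \<Longrightarrow> a \<le> \<alpha> \<Longrightarrow>
      \<bar>V \<alpha> (c (i + N) j) (c i (j + M))\<bar> \<le> C * (shift_prod \<beta>1 a (\<alpha> - a) N i * shift_prod \<beta>2 (\<alpha> - a) a M j)"
    using term_bound by metis
  have "a1 < a2"
    using less_trans[OF a1(5) a2(5)] beta_pos by (simp add: mult_less_cancel_left)
  have s_pos: "\<forall>\<^sub>F k in sequentially. 0 < s k"
    using s by (simp add: filterlim_at_top_dense)
  have cells: "\<forall>\<^sub>F k in sequentially. unit_cells (\<lambda>u. u) (\<lambda>u. 1) \<and> unit_cells (\<lambda>u. s k * u) (\<lambda>u. s k)"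
    using s_pos by eventually_elim (auto intro: unit_cells_linear unit_cells_id)
  \<comment> \<open>By the choice of s, the powers depending on a cancel: s^(-beta2 a) equals
    M^(-beta2 a) N^(beta1 a). The rate is therefore the same for both exponents, so the two bounds
    can be joined at v = 1.\<close>
  have scale: "real N powr (-\<beta>1 * a) * (real M powr (-\<beta>2 * (\<alpha> - a)) * (real M * real N powr (-\<beta>1 / \<beta>2)) powr (1 - \<beta>2 * a)) =
      real M * real N powr (-\<beta>1 / \<beta>2) * real M powr (-\<beta>2 * \<alpha>)" if NM: "0 < N" "0 < M" for N M :: nat and a
  proof -
    have "exp x powr (r * \<beta>2 * a) * (exp y powr (-\<beta>2 * (\<alpha> - a)) * (exp y * exp x powr r) powr (1 - \<beta>2 * a)) =
        exp y * exp x powr r * exp y powr (-\<beta>2 * \<alpha>)" for x y r :: real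
      by (simp add: powr_def algebra_simps flip: exp_add)
    from this[of "ln (real N)" "-\<beta>1 / \<beta>2" "ln (real M)"] show ?thesis
      using NM beta_pos by simp
  qed
  have bound: "\<forall>\<^sub>F k in sequentially. \<forall>u>0. \<forall>v>0.
      \<bar>V \<alpha> (c (nat \<lfloor>u\<rfloor> + N k) (nat \<lfloor>s k * v\<rfloor>)) (c (nat \<lfloor>u\<rfloor>) (nat \<lfloor>s k * v\<rfloor> + M k))\<bar> * 1 * s k
        \<le> s k * real (M k) powr (-\<beta>2 * \<alpha>) *
          (C * (two_powers 0 (\<beta>1 * (\<alpha> - a2)) u * two_powers (\<beta>2 * a1) (\<beta>2 * a2) v))"
    using pos s_pos
  proof eventually_elim
    case (elim k)
    have *: "\<bar>V \<alpha> (c (nat \<lfloor>u\<rfloor> + N k) (nat \<lfloor>s k * v\<rfloor>)) (c (nat \<lfloor>u\<rfloor>) (nat \<lfloor>s k * v\<rfloor> + M k))\<bar> * 1 * s k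
        \<le> s k * real (M k) powr (-\<beta>2 * \<alpha>) * (C * (two_powers 0 (\<beta>1 * (\<alpha> - a2)) u * v powr (-\<beta>2 * a)))"
      if uv: "0 < u" "0 < v" and a: "\<alpha> - 1 \<le> a" "a \<le> 1" "0 \<le> a" "a \<le> \<alpha>" "a \<le> a2" for u v a
    proof -
      have "shift_prod \<beta>1 a (\<alpha> - a) (N k) (nat \<lfloor>u\<rfloor>) * 1 \<le> real (N k) powr (-\<beta>1 * a) * two_powers 0 (\<beta>1 * (\<alpha> - a)) u"
        using shift_prod_const[OF beta_pos(1), of a "\<alpha> - a" "N k" u] a uv elim by simp
      \<comment> \<open>The i-majorant for \<open>a2\<close> has the slowest decay among exponents
        up to \<open>a2\<close>, so it serves \<open>a1\<close> as well and the joint bound remains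
        a product of a function of u and one of v.\<close>
      also have "\<dots> \<le> real (N k) powr (-\<beta>1 * a) * two_powers 0 (\<beta>1 * (\<alpha> - a2)) u"
        using a beta_pos by (intro mult_left_mono two_powers_antimono) auto
      finally have "\<bar>V \<alpha> (c (nat \<lfloor>u\<rfloor> + N k) (nat \<lfloor>s k * v\<rfloor>)) (c (nat \<lfloor>u\<rfloor>) (nat \<lfloor>s k * v\<rfloor> + M k))\<bar> * 1 * s k
        \<le> real (N k) powr (-\<beta>1 * a) * (real (M k) powr (-\<beta>2 * (\<alpha> - a)) * s k powr (1 - \<beta>2 * a)) *
          (C * (two_powers 0 (\<beta>1 * (\<alpha> - a2)) u * v powr (-\<beta>2 * a)))"
        using shift_prod_linear[OF beta_pos(2), of "\<alpha> - a" a "M k" "s k" v] a uv elim C(1)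
        by (intro product_bound[OF C(2)]) (auto simp: shift_prod_nonneg)
      then show ?thesis
        using scale[of "N k" "M k" a] elim by (simp add: s_def)
    qed
    show ?case
    proof (intro allI impI)
      fix u v :: real assume "0 < u" "0 < v"
      then show "\<bar>V \<alpha> (c (nat \<lfloor>u\<rfloor> + N k) (nat \<lfloor>s k * v\<rfloor>)) (c (nat \<lfloor>u\<rfloor>) (nat \<lfloor>s k * v\<rfloor> + M k))\<bar> * 1 * s k
        \<le> s k * real (M k) powr (-\<beta>2 * \<alpha>) *
          (C * (two_powers 0 (\<beta>1 * (\<alpha> - a2)) u * two_powers (\<beta>2 * a1) (\<beta>2 * a2) v))"
        using *[of u v a1] *[of u v a2] a1 a2 \<open>a1 < a2\<close> by (cases "v < 1") (simp_all add: two_powers_def)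
    qed
  qed
  have lim: "(\<lambda>k. V \<alpha> (c (nat \<lfloor>u\<rfloor> + N k) (nat \<lfloor>s k * v\<rfloor>)) (c (nat \<lfloor>u\<rfloor>) (nat \<lfloor>s k * v\<rfloor> + M k))
        / (s k * real (M k) powr (-\<beta>2 * \<alpha>)) * 1 * s k) \<longlonglongrightarrow> G (nat \<lfloor>u\<rfloor>) v"
    if "0 < u" "0 < v" for u v
  proof -
    let ?i = "nat \<lfloor>u\<rfloor>"
    \<comment> \<open>The factor \<open>(1 + 0) powr -\<beta>2\<close> is the limit of the shifted
      j-weight: the index s v is negligible against the lag M.\<close>
    have k0: "kern \<alpha> 1 (1 * 1 * v powr -\<beta>2) (wI ?i * (1 + real ?i) powr -\<beta>1 * (1 + 0) powr -\<beta>2) = G ?i v"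
      by (simp add: kern_1 G_def)
    have s_powr: "real (N k) powr -\<beta>1 * s k powr -\<beta>2 = real (M k) powr -\<beta>2" if "0 < N k" "0 < M k" for k
      using that beta_pos by (simp add: s_def powr_mult powr_powr flip: powr_add)
    show ?thesis
      unfolding k0[symmetric]
    proof (rule term_tendsto(1))
      show "0 < wI ?i * (1 + real ?i) powr -\<beta>1 * (1 + 0) powr -\<beta>2"
        by (intro mult_pos_pos[OF wI_factor_pos]) simp
      show "\<forall>\<^sub>F k in sequentially. 0 < real (N k) powr -\<beta>1 \<and> 0 < s k powr -\<beta>2 \<and>
        0 < (1::real) \<and> 0 < real (M k) powr -\<beta>2 \<and> 0 < (1::real) \<and> 0 < s k"
        using pos s_pos by eventually_elim auto
      show "(\<lambda>k. real (N k) powr -\<beta>1 * s k powr -\<beta>2 / (1 * real (M k) powr -\<beta>2)) \<longlonglongrightarrow> 1"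
        by (rule Lim_transform_eventually[OF tendsto_const]) (use pos in \<open>eventually_elim, simp add: s_powr\<close>)
      show "\<forall>\<^sub>F k in sequentially. s k * real (M k) powr (-\<beta>2 * \<alpha>) =
        real (N k) powr -\<beta>1 * s k powr -\<beta>2 * (1 * real (M k) powr -\<beta>2) powr (\<alpha> - 1) * 1 * s k"
        using pos
      proof eventually_elim
        case (elim k)
        have "real (M k) powr -\<beta>2 * (real (M k) powr -\<beta>2) powr (\<alpha> - 1) = real (M k) powr (-\<beta>2 * \<alpha>)"
          by (simp add: powr_powr algebra_simps flip: powr_add)
        then show ?case
          using s_powr[OF elim] by simp
      qed
      show "(\<lambda>k. (1 + real ?i) powr -\<beta>1 / 1) \<longlonglongrightarrow> (1 + real ?i) powr -\<beta>1"
        by simp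
      show "(\<lambda>k. w ?i (nat \<lfloor>s k * v\<rfloor> + M k)) \<longlonglongrightarrow> wI ?i"
        by (intro w_tendsto_wI add_nat_at_top M)
      show "(\<lambda>k. (1 + real (?i + N k)) powr -\<beta>1 / real (N k) powr -\<beta>1) \<longlonglongrightarrow> 1"
        by (intro shifted_powr_const N)
      have "(\<lambda>k. real (N k) powr - (\<beta>1 / \<beta>2) * v) \<longlonglongrightarrow> 0 * v"
        using beta_pos by (intro tendsto_mult powr_neg_tendsto_0 real_nat_at_top N tendsto_const) auto
      then have "(\<lambda>k. s k * v / real (M k)) \<longlonglongrightarrow> 0 * v"
        by (rule Lim_transform_eventually) (use pos in \<open>eventually_elim, simp add: s_def\<close>)
      then show "(\<lambda>k. (1 + real (nat \<lfloor>s k * v\<rfloor> + M k)) powr -\<beta>2 / real (M k) powr -\<beta>2) \<longlonglongrightarrow> (1 + 0) powr -\<beta>2"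
        using that by (intro shifted_powr_tendsto M) (auto simp: s_def)
      show "(\<lambda>k. (1 + real (nat \<lfloor>s k * v\<rfloor>)) powr -\<beta>2 / s k powr -\<beta>2) \<longlonglongrightarrow> v powr -\<beta>2"
        by (intro floor_powr_tendsto s ratio_mult_tendsto that) (use that in \<open>simp add: s_def\<close>)
    qed (intro w_tendsto_1 N s nat_floor_mult_at_top add_nat_at_top that)+
  qed
  have meas: "(\<lambda>(u::real, v). G (nat \<lfloor>u\<rfloor>) v) \<in> borel_measurable borel"
    unfolding G_def borel_prod[symmetric] case_prod_unfold by measurable
  have R: "\<forall>\<^sub>F k in sequentially. 0 < s k * real (M k) powr (-\<beta>2 * \<alpha>)"
    using pos s_pos by eventually_elim auto
  show "set_integrable lborel ({0<..} \<times> {0<..}) (\<lambda>(u::real, v). G (nat \<lfloor>u\<rfloor>) v)"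
    "(\<lambda>k. lag_series \<alpha> c (N k) (M k) / (s k * real (M k) powr (-\<beta>2 * \<alpha>)))
      \<longlonglongrightarrow> (LINT p:{0<..} \<times> {0<..}|lborel. (\<lambda>(u::real, v). G (nat \<lfloor>u\<rfloor>) v) p)"
    using lag_series_tendsto[OF cells R bound _ a2(6) a1(5) a2(5) lim meas] by simp_all
qed

end

section \<open>Regimes with an index on an exponential scale\<close>

section \<open>The logarithmic regimes\<close>

lemma powr_minus_one_over_powr:
  fixes s :: "nat \<Rightarrow> real"
  assumes s: "filterlim s at_top sequentially" and t: "t > 0"
  shows "filterlim (\<lambda>k. s k powr t) at_top sequentially"
    and "(\<lambda>k. (s k powr t - 1) / s k powr t) \<longlonglongrightarrow> 1"
    and "filterlim (\<lambda>k. nat \<lfloor>s k powr t - 1\<rfloor>) at_top sequentially"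
proof -
  show top: "filterlim (\<lambda>k. s k powr t) at_top sequentially"
  proof (rule filterlim_at_top_mono)
    show "filterlim (\<lambda>k. exp (t * ln (s k))) at_top sequentially"
      by (intro filterlim_compose[OF exp_at_top] filterlim_tendsto_pos_mult_at_top[OF tendsto_const t]
          filterlim_compose[OF ln_at_top s])
    have "\<forall>\<^sub>F k in sequentially. 1 < s k"
      using s by (simp add: filterlim_at_top_dense)
    then show "\<forall>\<^sub>F k in sequentially. exp (t * ln (s k)) \<le> s k powr t"
      by eventually_elim (simp add: powr_def)
  qed
  have "(\<lambda>k. 1 - 1 / s k powr t) \<longlonglongrightarrow> 1 - 0"
    by (intro tendsto_diff tendsto_const const_over_tendsto_0 top)
  moreover have "\<forall>\<^sub>F k in sequentially. 0 < s k powr t"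
    using top unfolding filterlim_at_top_dense by blast
  then have "\<forall>\<^sub>F k in sequentially. 1 - 1 / s k powr t = (s k powr t - 1) / s k powr t"
    by eventually_elim (simp add: diff_divide_distrib)
  ultimately show "(\<lambda>k. (s k powr t - 1) / s k powr t) \<longlonglongrightarrow> 1"
    using Lim_transform_eventually by fastforce
  have "filterlim (\<lambda>k. -1 + s k powr t) at_top sequentially"
    by (rule filterlim_tendsto_add_at_top[OF tendsto_const top])
  then have "filterlim (\<lambda>k. nat \<lfloor>-1 + s k powr t\<rfloor>) at_top sequentially"
    by (rule filterlim_nat_floor)
  then show "filterlim (\<lambda>k. nat \<lfloor>s k powr t - 1\<rfloor>) at_top sequentially"
    by simp
qed

lemma eventually_powr_ge_1:
  fixes s :: "nat \<Rightarrow> real"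
  assumes "filterlim s at_top sequentially"
  shows "\<forall>\<^sub>F k in sequentially. 1 < s k" and "r > 0 \<Longrightarrow> \<forall>\<^sub>F k in sequentially. 2 \<le> r * ln (s k)"
proof -
  show "\<forall>\<^sub>F k in sequentially. 1 < s k"
    using assms by (simp add: filterlim_at_top_dense)
  assume "r > 0"
  then have "filterlim (\<lambda>k. r * ln (s k)) at_top sequentially"
    by (intro filterlim_tendsto_pos_mult_at_top[OF tendsto_const] filterlim_compose[OF ln_at_top assms])
  then show "\<forall>\<^sub>F k in sequentially. 2 \<le> r * ln (s k)"
    by (simp add: filterlim_at_top)
qed



text \<open>\<open>floor_powr_tendsto\<close> asks for nonnegativity at every k, while
  \<open>s k powr t - 1\<close> is nonnegative only eventually. Truncation at 0 repairs this without
  changing the index, since \<open>nat\<close> already maps negative integers to 0.\<close>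

lemma floor_powr_powr_tendsto:
  fixes s :: "nat \<Rightarrow> real"
  assumes s: "filterlim s at_top sequentially" and t: "t > 0"
  shows "(\<lambda>k. (1 + real (nat \<lfloor>s k powr t - 1\<rfloor>)) powr b / (s k powr t) powr b) \<longlonglongrightarrow> 1"
proof -
  have "\<forall>\<^sub>F k in sequentially. (s k powr t - 1) / s k powr t = max 0 (s k powr t - 1) / s k powr t"
    using eventually_powr_ge_1(1)[OF s]
    by eventually_elim (use t in \<open>simp add: max_def ge_one_powr_ge_zero\<close>)
  then have "(\<lambda>k. max 0 (s k powr t - 1) / s k powr t) \<longlonglongrightarrow> 1"
    by (rule Lim_transform_eventually[OF powr_minus_one_over_powr(2)[OF s t]])
  from floor_powr_tendsto[OF powr_minus_one_over_powr(1)[OF s t] _ this, of b]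
  have "(\<lambda>k. (1 + real (nat \<lfloor>max 0 (s k powr t - 1)\<rfloor>)) powr b / (s k powr t) powr b) \<longlonglongrightarrow> 1"
    by simp
  moreover have "nat \<lfloor>max 0 x\<rfloor> = nat \<lfloor>x\<rfloor>" for x :: real
    by (simp add: max_def)
  ultimately show ?thesis
    by (simp only:)
qed

text \<open>For \<open>t < 1\<close> an index of order s^t is negligible against N, because s is at
  most N and so s^t / N is at most s^(t-1). The shifted weight then sees the lag only.\<close>

lemma shifted_floor_powr_tendsto:
  fixes s :: "nat \<Rightarrow> real" and N :: "nat \<Rightarrow> nat"
  assumes s: "filterlim s at_top sequentially" and N: "filterlim N at_top sequentially"
    and le: "\<forall>\<^sub>F k in sequentially. s k \<le> real (N k)" and t: "0 < t" "t < 1"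
  shows "(\<lambda>k. (1 + real (nat \<lfloor>s k powr t - 1\<rfloor> + N k)) powr b / real (N k) powr b) \<longlonglongrightarrow> 1"
proof -
  have "(\<lambda>k. max 0 (s k powr t - 1) / real (N k)) \<longlonglongrightarrow> 0"
  proof (rule Lim_null_comparison)
    show "(\<lambda>k. s k powr - (1 - t)) \<longlonglongrightarrow> 0"
      using t by (intro powr_neg_tendsto_0 s) auto
    show "\<forall>\<^sub>F k in sequentially. norm (max 0 (s k powr t - 1) / real (N k)) \<le> s k powr - (1 - t)"
      using le eventually_powr_ge_1(1)[OF s]
    proof eventually_elim
      case (elim k)
      have "norm (max 0 (s k powr t - 1) / real (N k)) = max 0 (s k powr t - 1) / real (N k)"
        by simp
      also have "max 0 (s k powr t - 1) / real (N k) \<le> s k powr t / s k"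
        using elim by (intro frac_le) auto
      also have "\<dots> = s k powr - (1 - t)"
        using elim by (simp add: powr_diff)
      finally show ?case .
    qed
  qed
  from shifted_powr_tendsto[OF N _ this, of b]
  have "(\<lambda>k. (1 + real (nat \<lfloor>max 0 (s k powr t - 1)\<rfloor> + N k)) powr b / real (N k) powr b) \<longlonglongrightarrow> 1"
    by simp
  moreover have "nat \<lfloor>max 0 x\<rfloor> = nat \<lfloor>x\<rfloor>" for x :: real
    by (simp add: max_def)
  ultimately show ?thesis
    by (simp only:)
qed

lemma tendsto_0_of_powr_decay:
  fixes f s :: "nat \<Rightarrow> real"
  assumes s: "filterlim s at_top sequentially" and "b > 0"
    and le: "\<forall>\<^sub>F k in sequentially. \<bar>f k\<bar> \<le> C * s k powr -b"
  shows "f \<longlonglongrightarrow> 0"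
proof (rule Lim_null_comparison)
  show "\<forall>\<^sub>F k in sequentially. norm (f k) \<le> C * s k powr -b"
    using le by simp
  show "(\<lambda>k. C * s k powr -b) \<longlonglongrightarrow> 0"
    by (rule tendsto_mult_right_zero[OF powr_neg_tendsto_0[OF s \<open>b > 0\<close>]])
qed

lemma abs_divide_le:
  fixes X R Y Z B :: real
  assumes "\<bar>X\<bar> * Y * Z \<le> R * B" "0 < R" "0 \<le> Y" "0 \<le> Z"
  shows "\<bar>X / R * Y * Z\<bar> \<le> B"
  using assms by (simp add: abs_mult field_simps)

context coefficients
begin

text \<open>At the critical beta1 the i-sum behaves like the sum of 1/(1+i) up to the lag. On the
  scale i = N^t - 1 each t in (0, 1) contributes equally, and t > 1 contributes nothing in the
  limit. The test \<open>i = 0\<close> in \<open>G\<close> is applied to the integer part of t and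
  thus encodes the indicator of t < 1.\<close>

lemma log_linear:
  fixes N M :: "nat \<Rightarrow> nat"
  assumes N: "filterlim N at_top sequentially" and M: "filterlim M at_top sequentially"
    and hyp: "1 < \<alpha>" "\<beta>1 * (\<alpha> - 1) = 1" "\<beta>2 < 1"
  defines "G \<equiv> \<lambda>i v. if i = (0::nat) then v powr (-\<beta>2) * (1 + v) powr (-\<beta>2 * (\<alpha> - 1)) else 0"
  shows "set_integrable lborel ({0<..} \<times> {0<..}) (\<lambda>(t::real, v). G (nat \<lfloor>t\<rfloor>) v)"
    and "(\<lambda>k. lag_series \<alpha> c (N k) (M k) / (real (N k) powr (-\<beta>1) * ln (real (N k)) * real (M k) powr (1 - \<beta>2 * \<alpha>)))
      \<longlonglongrightarrow> (LINT p:{0<..} \<times> {0<..}|lborel. (\<lambda>(t::real, v). G (nat \<lfloor>t\<rfloor>) v) p)"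
proof -
  note N' = real_nat_at_top[OF N]
  note pos = eventually_pos_nat[OF N] eventually_pos_nat[OF M] eventually_powr_ge_1(1)[OF N']
  have "\<alpha> - 1 \<le> 1" "(1::real) \<le> 1" "(0::real) \<le> 1" "1 \<le> \<alpha>"
    using alpha hyp by simp_all
  then obtain C where C: "C \<ge> 0" "\<And>N M i j. \<bar>V \<alpha> (c (i + N) j) (c i (j + M))\<bar> \<le>
      C * (shift_prod \<beta>1 1 (\<alpha> - 1) N i * shift_prod \<beta>2 (\<alpha> - 1) 1 M j)"
    using term_bound by metis
  have cells: "\<forall>\<^sub>F k in sequentially. unit_cells (\<lambda>t. real (N k) powr t - 1) (\<lambda>t. real (N k) powr t * ln (real (N k))) \<and>
      unit_cells (\<lambda>u. real (M k) * u) (\<lambda>u. real (M k))"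
    using pos by eventually_elim (auto intro: unit_cells_linear unit_cells_powr)
  let ?x = "\<lambda>k t v. V \<alpha> (c (nat \<lfloor>real (N k) powr t - 1\<rfloor> + N k) (nat \<lfloor>real (M k) * v\<rfloor>))
      (c (nat \<lfloor>real (N k) powr t - 1\<rfloor>) (nat \<lfloor>real (M k) * v\<rfloor> + M k))"
  let ?R = "\<lambda>k. real (N k) powr -\<beta>1 * ln (real (N k)) * real (M k) powr (1 - \<beta>2 * \<alpha>)"
  have bound: "\<forall>\<^sub>F k in sequentially. \<forall>t>0. \<forall>v>0.
      \<bar>?x k t v\<bar> * (real (N k) powr t * ln (real (N k))) * real (M k)
        \<le> ?R k * ((C * 2 powr (\<beta>1 * \<alpha>)) * (two_powers 0 2 t * two_powers \<beta>2 (\<beta>2 * \<alpha>) v))"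
    using pos eventually_powr_ge_1(2)[OF N' beta_pos(1)]
  proof eventually_elim
    case (elim k)
    show ?case
    proof (intro allI impI)
      fix t v :: real assume tv: "0 < t" "0 < v"
      have "\<bar>?x k t v\<bar> * (real (N k) powr t * ln (real (N k))) * real (M k) \<le>
          ?R k * (C * ((2 powr (\<beta>1 * \<alpha>) * two_powers 0 2 t) * two_powers \<beta>2 (\<beta>2 * \<alpha>) v))"
        using shift_prod_exponential_self[OF beta_pos(1), of 1 "\<alpha> - 1" "N k" t]
          shift_prod_linear_self[OF beta_pos(2), of "\<alpha> - 1" 1 "M k" v] hyp elim C(1) tv
        by (intro product_bound[OF C(2)]) (auto simp: shift_prod_nonneg mult_ac)
      then show "\<bar>?x k t v\<bar> * (real (N k) powr t * ln (real (N k))) * real (M k) \<le>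
          ?R k * ((C * 2 powr (\<beta>1 * \<alpha>)) * (two_powers 0 2 t * two_powers \<beta>2 (\<beta>2 * \<alpha>) v))"
        by (simp only: mult_ac)
    qed
  qed
  have lim: "(\<lambda>k. ?x k t v / ?R k * (real (N k) powr t * ln (real (N k))) * real (M k)) \<longlonglongrightarrow> G (nat \<lfloor>t\<rfloor>) v"
    if tv: "0 < t" "0 < v" "t \<noteq> 1" for t v
  proof (cases "t < 1")
    case True
    then have "nat \<lfloor>t\<rfloor> = 0"
      using tv by (simp add: floor_eq_iff)
    then have k0: "kern \<alpha> 0 (1 * 1 * v powr -\<beta>2) (1 * 1 * (1 + v) powr -\<beta>2) = G (nat \<lfloor>t\<rfloor>) v"
      using tv by (subst kern_0) (auto simp: G_def powr_powr)
    show ?thesis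
      unfolding k0[symmetric]
    proof (rule term_tendsto(1))
      show "0 < 1 * 1 * (1 + v) powr -\<beta>2"
        using tv by simp
      show "\<forall>\<^sub>F k in sequentially. 0 < real (N k) powr -\<beta>1 \<and> 0 < real (M k) powr -\<beta>2 \<and>
        0 < (real (N k) powr t) powr -\<beta>1 \<and> 0 < real (M k) powr -\<beta>2 \<and> 0 < real (N k) powr t * ln (real (N k)) \<and> 0 < real (M k)"
        using pos by eventually_elim auto
      have "(\<lambda>k. real (N k) powr - (\<beta>1 * (1 - t))) \<longlonglongrightarrow> 0"
        using True beta_pos by (intro powr_neg_tendsto_0 N') auto
      then show "(\<lambda>k. real (N k) powr -\<beta>1 * real (M k) powr -\<beta>2 / ((real (N k) powr t) powr -\<beta>1 * real (M k) powr -\<beta>2)) \<longlonglongrightarrow> 0"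
      proof (rule Lim_transform_eventually)
        show "\<forall>\<^sub>F k in sequentially. real (N k) powr - (\<beta>1 * (1 - t)) =
            real (N k) powr -\<beta>1 * real (M k) powr -\<beta>2 / ((real (N k) powr t) powr -\<beta>1 * real (M k) powr -\<beta>2)"
          using pos by eventually_elim (simp add: powr_powr algebra_simps flip: powr_diff)
      qed
      show "\<forall>\<^sub>F k in sequentially. ?R k = real (N k) powr -\<beta>1 * real (M k) powr -\<beta>2 *
          ((real (N k) powr t) powr -\<beta>1 * real (M k) powr -\<beta>2) powr (\<alpha> - 1) * (real (N k) powr t * ln (real (N k))) * real (M k)"
        using pos
      proof eventually_elim
        case (elim k)
        have "((exp x powr t) powr -\<beta>1) powr (\<alpha> - 1) = exp x powr -t" for x :: real
          using hyp(2) by (simp add: powr_powr mult.assoc)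
        moreover have "exp x powr -\<beta>1 * L * exp y powr (1 - \<beta>2 * \<alpha>) = exp x powr -\<beta>1 * exp y powr -\<beta>2 *
            (exp x powr -t * (exp y powr -\<beta>2) powr (\<alpha> - 1)) * (exp x powr t * L) * exp y" for x y L :: real
        proof -
          have "exp y powr (1 - \<beta>2 * \<alpha>) = exp y powr -\<beta>2 * (exp y powr -\<beta>2) powr (\<alpha> - 1) * exp y"
            by (simp add: powr_def algebra_simps flip: exp_add)
          then show ?thesis
            by (simp add: powr_minus field_simps)
        qed
        ultimately have "exp x powr -\<beta>1 * L * exp y powr (1 - \<beta>2 * \<alpha>) = exp x powr -\<beta>1 * exp y powr -\<beta>2 *
            ((exp x powr t) powr -\<beta>1 * exp y powr -\<beta>2) powr (\<alpha> - 1) * (exp x powr t * L) * exp y" for x y L :: real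
          by (simp only: powr_mult)
        from this[of "ln (real (N k))" "ln (real (N k))" "ln (real (M k))"] show ?case
          using elim by simp
      qed
    qed (intro shifted_floor_powr_tendsto floor_powr_powr_tendsto shifted_powr_tendsto floor_powr_tendsto w_tendsto_1 N M N'
        powr_minus_one_over_powr ratio_mult_tendsto nat_floor_mult_at_top
        add_nat_at_top real_nat_at_top; use tv True in simp)+
  next
    case False
    \<comment> \<open>Past the lag, the shifted weight decays too and the summand is smaller than
      the rate by a power of N with negative exponent.\<close>
    with tv have "t > 1"
      by simp
    then have "nat \<lfloor>t\<rfloor> \<noteq> 0"
      by simp
    then have G0: "G (nat \<lfloor>t\<rfloor>) v = 0"
      by (simp add: G_def)
    show ?thesis
      unfolding G0
    proof (rule tendsto_0_of_powr_decay[OF N'])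
      show "\<beta>1 * (t - 1) > 0"
        using beta_pos \<open>t > 1\<close> by simp
      let ?C = "C * (2 powr (\<beta>1 * \<alpha>) * two_powers \<beta>2 (\<beta>2 * \<alpha>) v)"
      show "\<forall>\<^sub>F k in sequentially. \<bar>?x k t v / ?R k * (real (N k) powr t * ln (real (N k))) * real (M k)\<bar> \<le>
          ?C * real (N k) powr - (\<beta>1 * (t - 1))"
        using pos
      proof eventually_elim
        case (elim k)
        have "\<bar>?x k t v\<bar> * (real (N k) powr t * ln (real (N k))) * real (M k) \<le>
            ?R k * (C * ((2 powr (\<beta>1 * \<alpha>) * real (N k) powr (\<beta>1 * (1 - t))) * two_powers \<beta>2 (\<beta>2 * \<alpha>) v))"
          using shift_prod_exponential_self_tail[OF beta_pos(1), of 1 "\<alpha> - 1" t "N k"]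
            shift_prod_linear_self[OF beta_pos(2), of "\<alpha> - 1" 1 "M k" v] hyp elim C(1) tv
          by (intro product_bound[OF C(2)]) (auto simp: shift_prod_nonneg mult_ac)
        then have "\<bar>?x k t v / ?R k * (real (N k) powr t * ln (real (N k))) * real (M k)\<bar> \<le>
            C * ((2 powr (\<beta>1 * \<alpha>) * real (N k) powr (\<beta>1 * (1 - t))) * two_powers \<beta>2 (\<beta>2 * \<alpha>) v)"
          using elim by (intro abs_divide_le) auto
        also have "\<beta>1 * (1 - t) = - (\<beta>1 * (t - 1))"
          by (simp add: algebra_simps)
        finally show ?case
          by (simp only: mult_ac)
      qed
    qed
  qed
  have meas: "(\<lambda>(t::real, v). G (nat \<lfloor>t\<rfloor>) v) \<in> borel_measurable borel"
    unfolding G_def borel_prod[symmetric] case_prod_unfold by measurable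
  have R: "\<forall>\<^sub>F k in sequentially. 0 < ?R k"
    using pos by eventually_elim auto
  show "set_integrable lborel ({0<..} \<times> {0<..}) (\<lambda>(t::real, v). G (nat \<lfloor>t\<rfloor>) v)"
    "(\<lambda>k. lag_series \<alpha> c (N k) (M k) / (real (N k) powr (-\<beta>1) * ln (real (N k)) * real (M k) powr (1 - \<beta>2 * \<alpha>)))
      \<longlonglongrightarrow> (LINT p:{0<..} \<times> {0<..}|lborel. (\<lambda>(t::real, v). G (nat \<lfloor>t\<rfloor>) v) p)"
    using lag_series_tendsto[OF cells R bound _ _ hyp(3) beta_alpha(2) lim meas] by simp_all
qed

text \<open>For j = s^t - 1 with t < 1 the first argument dominates the second, so the second
  version of \<open>term_tendsto\<close> applies with ratio 0; the limit is linear in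
  \<open>wI\<close> and flat in t because beta2 (alpha-1) = 1. For t > 1 an exponent a above alpha-1
  forces decay.\<close>

lemma const_log:
  fixes N M :: "nat \<Rightarrow> nat"
  assumes N: "filterlim N at_top sequentially" and M: "filterlim M at_top sequentially"
  defines "s \<equiv> \<lambda>k. real (M k) * real (N k) powr (-\<beta>1 / \<beta>2)"
  assumes s: "filterlim s at_top sequentially"
    and hyp: "1 < \<alpha>" "\<beta>2 * (\<alpha> - 1) = 1"
    and a: "\<alpha> - 1 < a" "a \<le> 1" "\<beta>1 * (\<alpha> - a) > 1"
  defines "G \<equiv> \<lambda>i t. wI i * (1 + real i) powr (-\<beta>1) * indicator {..<1} (t::real)"
  shows "set_integrable lborel ({0<..} \<times> {0<..}) (\<lambda>(u::real, t). G (nat \<lfloor>u\<rfloor>) t)"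
    and "(\<lambda>k. lag_series \<alpha> c (N k) (M k) / (s k * real (M k) powr (-\<beta>2 * \<alpha>) * ln (s k)))
      \<longlonglongrightarrow> (LINT p:{0<..} \<times> {0<..}|lborel. (\<lambda>(u::real, t). G (nat \<lfloor>u\<rfloor>) t) p)"
proof -
  define \<delta> where "\<delta> = \<beta>2 * a - 1"
  have "\<delta> > 0"
    using hyp a(1) mult_strict_left_mono[OF a(1) beta_pos(2)] by (simp add: \<delta>_def)
  note pos = eventually_pos_nat[OF N] eventually_pos_nat[OF M] eventually_powr_ge_1(1)[OF s]
  \<comment> \<open>As N is at least 1, its negative power is at most 1; this comparison of s with
    the lag is what makes indices s^t with t < 1 negligible against M.\<close>
  have s_le: "\<forall>\<^sub>F k in sequentially. s k \<le> real (M k)"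
    using pos
  proof eventually_elim
    case (elim k)
    have "real (N k) powr (-\<beta>1 / \<beta>2) \<le> 1 powr (-\<beta>1 / \<beta>2)"
      using elim beta_pos by (intro powr_mono2') auto
    then show ?case
      by (simp add: s_def mult_left_le)
  qed
  obtain C where C: "C \<ge> 0" "\<And>a N M i j. \<alpha> - 1 \<le> a \<Longrightarrow> a \<le> 1 \<Longrightarrow> 0 \<le> a \<Longrightarrow> a \<le> \<alpha> \<Longrightarrow>
      \<bar>V \<alpha> (c (i + N) j) (c i (j + M))\<bar> \<le> C * (shift_prod \<beta>1 a (\<alpha> - a) N i * shift_prod \<beta>2 (\<alpha> - a) a M j)"
    using term_bound by metis
  have cells: "\<forall>\<^sub>F k in sequentially. unit_cells (\<lambda>u. u) (\<lambda>u. 1) \<and>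
      unit_cells (\<lambda>t. s k powr t - 1) (\<lambda>t. s k powr t * ln (s k))"
    using pos by eventually_elim (auto intro: unit_cells_id unit_cells_powr)
  let ?x = "\<lambda>k (u::real) t. V \<alpha> (c (nat \<lfloor>u\<rfloor> + N k) (nat \<lfloor>s k powr t - 1\<rfloor>)) (c (nat \<lfloor>u\<rfloor>) (nat \<lfloor>s k powr t - 1\<rfloor> + M k))"
  let ?R = "\<lambda>k. s k * real (M k) powr (-\<beta>2 * \<alpha>) * ln (s k)"
  \<comment> \<open>As in the linearly scaled regime, but the exponential scale leaves a residual
    power of s with exponent (beta2 b - 1)(1 - t). It is absent for b = alpha-1 and gives decay for
    t > 1 when b > alpha-1.\<close>
  have scale: "real N powr (-\<beta>1 * b) * (real M powr (-\<beta>2 * (\<alpha> - b)) * (real M * real N powr (-\<beta>1 / \<beta>2)) powr (t * (1 - \<beta>2 * b))) =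
      real M * real N powr (-\<beta>1 / \<beta>2) * real M powr (-\<beta>2 * \<alpha>) * (real M * real N powr (-\<beta>1 / \<beta>2)) powr ((\<beta>2 * b - 1) * (1 - t))"
    if NM: "0 < N" "0 < M" for N M :: nat and b t
  proof -
    have "exp x powr (r * \<beta>2 * b) * (exp y powr (-\<beta>2 * (\<alpha> - b)) * (exp y * exp x powr r) powr (t * (1 - \<beta>2 * b))) =
        exp y * exp x powr r * exp y powr (-\<beta>2 * \<alpha>) * (exp y * exp x powr r) powr ((\<beta>2 * b - 1) * (1 - t))" for x y r :: real
      by (simp add: powr_def algebra_simps flip: exp_add)
    from this[of "ln (real N)" "-\<beta>1 / \<beta>2" "ln (real M)"] show ?thesis
      using NM beta_pos by simp
  qed
  have summand: "\<bar>?x k u t\<bar> * 1 * (s k powr t * ln (s k)) \<le>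
      ?R k * (C * (two_powers 0 (\<beta>1 * (\<alpha> - a)) u * (2 powr (\<beta>2 * a) * s k powr ((\<beta>2 * b - 1) * (1 - t)))))"
    if k: "0 < N k" "0 < M k" "1 < s k" and ut: "0 < u" "0 < t" and b: "\<alpha> - 1 \<le> b" "b \<le> a" for k u t b
  proof -
    have "shift_prod \<beta>1 b (\<alpha> - b) (N k) (nat \<lfloor>u\<rfloor>) * 1 \<le> real (N k) powr (-\<beta>1 * b) * two_powers 0 (\<beta>1 * (\<alpha> - b)) u"
      using shift_prod_const[OF beta_pos(1), of b "\<alpha> - b" "N k" u] a b k ut hyp by simp
    also have "\<dots> \<le> real (N k) powr (-\<beta>1 * b) * two_powers 0 (\<beta>1 * (\<alpha> - a)) u"
      using b beta_pos by (intro mult_left_mono two_powers_antimono) auto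
    finally have 1: "shift_prod \<beta>1 b (\<alpha> - b) (N k) (nat \<lfloor>u\<rfloor>) * 1 \<le> real (N k) powr (-\<beta>1 * b) * two_powers 0 (\<beta>1 * (\<alpha> - a)) u" .
    have "shift_prod \<beta>2 (\<alpha> - b) b (M k) (nat \<lfloor>s k powr t - 1\<rfloor>) * (s k powr t * ln (s k)) \<le>
        2 powr (\<beta>2 * b) * (real (M k) powr (-\<beta>2 * (\<alpha> - b)) * s k powr (t * (1 - \<beta>2 * b)) * ln (s k))"
      using a b k ut hyp by (intro shift_prod_exponential beta_pos) auto
    also have "\<dots> \<le> 2 powr (\<beta>2 * a) * (real (M k) powr (-\<beta>2 * (\<alpha> - b)) * s k powr (t * (1 - \<beta>2 * b)) * ln (s k))"
      using b k beta_pos by (intro mult_right_mono powr_mono mult_left_mono) auto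
    finally have 2: "shift_prod \<beta>2 (\<alpha> - b) b (M k) (nat \<lfloor>s k powr t - 1\<rfloor>) * (s k powr t * ln (s k)) \<le>
        (real (M k) powr (-\<beta>2 * (\<alpha> - b)) * s k powr (t * (1 - \<beta>2 * b)) * ln (s k)) * 2 powr (\<beta>2 * a)"
      by (simp only: mult_ac)
    have "\<bar>?x k u t\<bar> * 1 * (s k powr t * ln (s k)) \<le>
        real (N k) powr (-\<beta>1 * b) * (real (M k) powr (-\<beta>2 * (\<alpha> - b)) * s k powr (t * (1 - \<beta>2 * b)) * ln (s k)) *
          (C * (two_powers 0 (\<beta>1 * (\<alpha> - a)) u * 2 powr (\<beta>2 * a)))"
      using a b k ut hyp C(1) by (intro product_bound[OF C(2) 1 2]) (auto simp: shift_prod_nonneg)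
    also have "\<dots> = real (N k) powr (-\<beta>1 * b) * (real (M k) powr (-\<beta>2 * (\<alpha> - b)) * s k powr (t * (1 - \<beta>2 * b))) * (ln (s k) *
          (C * (two_powers 0 (\<beta>1 * (\<alpha> - a)) u * 2 powr (\<beta>2 * a))))"
      by (simp only: mult.assoc)
    also have "real (N k) powr (-\<beta>1 * b) * (real (M k) powr (-\<beta>2 * (\<alpha> - b)) * s k powr (t * (1 - \<beta>2 * b))) =
        s k * real (M k) powr (-\<beta>2 * \<alpha>) * s k powr ((\<beta>2 * b - 1) * (1 - t))"
      unfolding s_def by (rule scale[OF k(1,2)])
    also have "\<dots> * (ln (s k) * (C * (two_powers 0 (\<beta>1 * (\<alpha> - a)) u * 2 powr (\<beta>2 * a)))) =
        ?R k * (C * (two_powers 0 (\<beta>1 * (\<alpha> - a)) u * (2 powr (\<beta>2 * a) * s k powr ((\<beta>2 * b - 1) * (1 - t)))))"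
      by (simp only: mult_ac)
    finally show ?thesis .
  qed
  have bound: "\<forall>\<^sub>F k in sequentially. \<forall>u>0. \<forall>t>0. \<bar>?x k u t\<bar> * 1 * (s k powr t * ln (s k))
        \<le> ?R k * ((C * 2 powr (\<beta>2 * a)) * (two_powers 0 (\<beta>1 * (\<alpha> - a)) u * two_powers 0 2 t))"
    using pos eventually_powr_ge_1(2)[OF s \<open>\<delta> > 0\<close>]
  proof eventually_elim
    case (elim k)
    show ?case
    proof (intro allI impI)
      fix u t :: real assume ut: "0 < u" "0 < t"
      \<comment> \<open>Below t = 1 the critical exponent makes the residual power equal to 1; above
        it the larger exponent a gives s^(-delta (t - 1)), which \<open>powr_decay\<close> bounds by
        t^(-2).\<close>
      define b where "b = (if t < 1 then \<alpha> - 1 else a)"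
      have b: "\<alpha> - 1 \<le> b" "b \<le> a"
        using a by (auto simp: b_def)
      have "s k powr ((\<beta>2 * b - 1) * (1 - t)) \<le> two_powers 0 2 t"
        using hyp elim powr_decay[of "s k" \<delta> t] ut by (auto simp: b_def two_powers_def \<delta>_def)
      then have "?R k * (C * (two_powers 0 (\<beta>1 * (\<alpha> - a)) u * (2 powr (\<beta>2 * a) * s k powr ((\<beta>2 * b - 1) * (1 - t))))) \<le>
          ?R k * (C * (two_powers 0 (\<beta>1 * (\<alpha> - a)) u * (2 powr (\<beta>2 * a) * two_powers 0 2 t)))"
        using elim C(1) by (intro mult_left_mono) (auto simp: two_powers_nonneg)
      also have "\<dots> = ?R k * ((C * 2 powr (\<beta>2 * a)) * (two_powers 0 (\<beta>1 * (\<alpha> - a)) u * two_powers 0 2 t))"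
        by (simp only: mult_ac)
      finally show "\<bar>?x k u t\<bar> * 1 * (s k powr t * ln (s k))
        \<le> ?R k * ((C * 2 powr (\<beta>2 * a)) * (two_powers 0 (\<beta>1 * (\<alpha> - a)) u * two_powers 0 2 t))"
        using order_trans[OF summand[OF elim(1-3) ut b]] by blast
    qed
  qed
  have lim: "(\<lambda>k. ?x k u t / ?R k * 1 * (s k powr t * ln (s k))) \<longlonglongrightarrow> G (nat \<lfloor>u\<rfloor>) t"
    if ut: "0 < u" "0 < t" "t \<noteq> 1" for u t :: real
  proof (cases "t < 1")
    case True
    let ?i = "nat \<lfloor>u\<rfloor>"
    have k0: "kern \<alpha> 0 (wI ?i * (1 + real ?i) powr -\<beta>1 * 1) (1 * 1 * 1) = G ?i t"
      using True by (subst kern_0) (auto simp: G_def)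
    have s_powr: "real (N k) powr -\<beta>1 * s k powr -\<beta>2 = real (M k) powr -\<beta>2" if "0 < N k" "0 < M k" for k
      using that beta_pos by (simp add: s_def powr_mult powr_powr flip: powr_add)
    show ?thesis
      unfolding k0[symmetric]
    proof (rule term_tendsto(2))
      show "0 < (1::real) * 1 * 1"
        by simp
      show "\<forall>\<^sub>F k in sequentially. 0 < real (N k) powr -\<beta>1 \<and> 0 < (s k powr t) powr -\<beta>2 \<and>
        0 < (1::real) \<and> 0 < real (M k) powr -\<beta>2 \<and> 0 < (1::real) \<and> 0 < s k powr t * ln (s k)"
        using pos by eventually_elim auto
      have "(\<lambda>k. s k powr - (\<beta>2 * (1 - t))) \<longlonglongrightarrow> 0"
        using True beta_pos by (intro powr_neg_tendsto_0 s) auto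
      then show "(\<lambda>k. 1 * real (M k) powr -\<beta>2 / (real (N k) powr -\<beta>1 * (s k powr t) powr -\<beta>2)) \<longlonglongrightarrow> 0"
      proof (rule Lim_transform_eventually)
        show "\<forall>\<^sub>F k in sequentially. s k powr - (\<beta>2 * (1 - t)) =
            1 * real (M k) powr -\<beta>2 / (real (N k) powr -\<beta>1 * (s k powr t) powr -\<beta>2)"
          using pos
        proof eventually_elim
          case (elim k)
          have "s k powr - (\<beta>2 * (1 - t)) = s k powr -\<beta>2 / (s k powr t) powr -\<beta>2"
            using elim by (simp add: powr_powr algebra_simps flip: powr_diff)
          then show ?case
            using elim by (simp add: s_powr[symmetric])
        qed
      qed
      show "\<forall>\<^sub>F k in sequentially. ?R k = 1 * real (M k) powr -\<beta>2 *
          (real (N k) powr -\<beta>1 * (s k powr t) powr -\<beta>2) powr (\<alpha> - 1) * 1 * (s k powr t * ln (s k))"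
        using pos
      proof eventually_elim
        case (elim k)
        have "(real (N k) powr -\<beta>1 * (s k powr t) powr -\<beta>2) powr (\<alpha> - 1) =
            real (N k) powr (-\<beta>1 * (\<alpha> - 1)) * s k powr (- (t * (\<beta>2 * (\<alpha> - 1))))"
          by (simp add: powr_mult powr_powr mult_ac)
        also have "\<dots> * s k powr t = real (N k) powr (-\<beta>1 * (\<alpha> - 1))"
          using elim hyp(2) by (simp flip: powr_add)
        finally have *: "(real (N k) powr -\<beta>1 * (s k powr t) powr -\<beta>2) powr (\<alpha> - 1) * s k powr t =
          real (N k) powr (-\<beta>1 * (\<alpha> - 1))" .
        \<comment> \<open>Taking b = alpha-1 and t = 0 in \<open>scale\<close> removes both powers
          of s from that identity, since beta2 (alpha-1) = 1.\<close>
        have "real (N k) powr (-\<beta>1 * (\<alpha> - 1)) * real (M k) powr -\<beta>2 = s k * real (M k) powr (-\<beta>2 * \<alpha>)"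
          using scale[OF elim(1,2), of "\<alpha> - 1" 0] hyp(2) elim by (simp add: s_def)
        then have "?R k = real (N k) powr (-\<beta>1 * (\<alpha> - 1)) * real (M k) powr -\<beta>2 * ln (s k)"
          by simp
        then show ?case
          unfolding *[symmetric] by (simp only: mult_ac mult_1)
      qed
      show "(\<lambda>k. (1 + real ?i) powr -\<beta>1 / 1) \<longlonglongrightarrow> (1 + real ?i) powr -\<beta>1"
        by simp
      show "(\<lambda>k. w ?i (nat \<lfloor>s k powr t - 1\<rfloor> + M k)) \<longlonglongrightarrow> wI ?i"
        by (intro w_tendsto_wI add_nat_at_top M)
      show "(\<lambda>k. (1 + real (?i + N k)) powr -\<beta>1 / real (N k) powr -\<beta>1) \<longlonglongrightarrow> 1"
        by (intro shifted_powr_const N)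
    qed (intro shifted_floor_powr_tendsto floor_powr_powr_tendsto w_tendsto_1 N M s s_le
        powr_minus_one_over_powr add_nat_at_top; use ut True in simp)+
  next
    case False
    with ut have "t > 1"
      by simp
    then have G0: "G (nat \<lfloor>u\<rfloor>) t = 0"
      by (simp add: G_def)
    show ?thesis
      unfolding G0
    proof (rule tendsto_0_of_powr_decay[OF s])
      show "\<delta> * (t - 1) > 0"
        using \<open>\<delta> > 0\<close> \<open>t > 1\<close> by simp
      show "\<forall>\<^sub>F k in sequentially. \<bar>?x k u t / ?R k * 1 * (s k powr t * ln (s k))\<bar> \<le>
          (C * (two_powers 0 (\<beta>1 * (\<alpha> - a)) u * 2 powr (\<beta>2 * a))) * s k powr - (\<delta> * (t - 1))"
        using pos
      proof eventually_elim
        case (elim k)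
        have "\<bar>?x k u t / ?R k * 1 * (s k powr t * ln (s k))\<bar> \<le>
            C * (two_powers 0 (\<beta>1 * (\<alpha> - a)) u * (2 powr (\<beta>2 * a) * s k powr ((\<beta>2 * a - 1) * (1 - t))))"
          using summand[OF elim ut(1,2), of a] a elim by (intro abs_divide_le) auto
        also have "(\<beta>2 * a - 1) * (1 - t) = - (\<delta> * (t - 1))"
          by (simp add: \<delta>_def algebra_simps)
        finally show ?case
          by (simp only: mult_ac)
      qed
    qed
  qed
  have meas: "(\<lambda>(u::real, t). G (nat \<lfloor>u\<rfloor>) t) \<in> borel_measurable borel"
    unfolding G_def borel_prod[symmetric] case_prod_unfold by measurable
  have R: "\<forall>\<^sub>F k in sequentially. 0 < ?R k"
    using pos by eventually_elim auto
  show "set_integrable lborel ({0<..} \<times> {0<..}) (\<lambda>(u::real, t). G (nat \<lfloor>u\<rfloor>) t)"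
    "(\<lambda>k. lag_series \<alpha> c (N k) (M k) / (s k * real (M k) powr (-\<beta>2 * \<alpha>) * ln (s k)))
      \<longlonglongrightarrow> (LINT p:{0<..} \<times> {0<..}|lborel. (\<lambda>(u::real, t). G (nat \<lfloor>u\<rfloor>) t) p)"
    using lag_series_tendsto[OF cells R bound _ a(3) _ _ lim meas] by simp_all
qed

end

section \<open>From the analytic regimes to the limit formulas\<close>

section \<open>The limit statements along sequences\<close>

text \<open>If the double limit failed, there would be bad points with both coordinates beyond every
  k; choosing one for each k gives a pair of divergent sequences violating the hypothesis.\<close>

lemma tendsto_at_top_prodI:
  fixes f :: "nat \<Rightarrow> nat \<Rightarrow> real"
  assumes "\<And>N M. filterlim N at_top sequentially \<Longrightarrow> filterlim M at_top sequentially \<Longrightarrow> (\<lambda>k. f (N k) (M k)) \<longlonglongrightarrow> L"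
  shows "((\<lambda>(n, m). f n m) \<longlongrightarrow> L) (at_top \<times>\<^sub>F at_top)"
proof (rule ccontr)
  assume "\<not> ?thesis"
  then obtain e where e: "e > 0" "\<not> (\<forall>\<^sub>F p in at_top \<times>\<^sub>F at_top. dist ((\<lambda>(n, m). f n m) p) L < e)"
    unfolding tendsto_iff by blast
  then have "\<forall>k. \<exists>n m. k \<le> n \<and> k \<le> m \<and> \<not> dist (f n m) L < e"
    unfolding eventually_prod_sequentially by fastforce
  then obtain N M where NM: "\<And>k. k \<le> N k" "\<And>k. k \<le> M k" "\<And>k. \<not> dist (f (N k) (M k)) L < e"
    by metis
  have "filterlim N at_top sequentially" "filterlim M at_top sequentially"
    using NM by (auto intro: filterlim_at_top_mono[OF filterlim_ident])
  from assms[OF this] have "\<forall>\<^sub>F k in sequentially. dist (f (N k) (M k)) L < e"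
    using e(1) by (simp add: tendsto_iff)
  then show False
    using NM(3) by simp
qed

lemma lim_series_swap: "lim_series f F a (\<lambda>(i, j). g i j) \<longleftrightarrow> lim_series f F a (\<lambda>(i, j). g j i)"
proof -
  have "(\<lambda>(i, j). g i j) summable_on UNIV \<longleftrightarrow> (\<lambda>p. (\<lambda>(i, j). g i j) (prod.swap p)) summable_on UNIV"
    by (rule summable_on_reindex_bij_betw[symmetric]) (rule bij_swap)
  moreover have "(\<Sum>\<^sub>\<infinity>p\<in>UNIV. (\<lambda>(i, j). g i j) (prod.swap p)) = (\<Sum>\<^sub>\<infinity>(i, j). g i j)"
    by (rule infsum_reindex_bij_betw) (rule bij_swap)
  ultimately show ?thesis
    by (simp add: lim_series_def case_prod_unfold)
qed

lemma lim_series_cong: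
  assumes "\<forall>\<^sub>F x in F. f x = f' x" "\<And>i. g i = g' i"
  shows "lim_series f F a g \<longleftrightarrow> lim_series f' F a g'"
proof -
  have "g = g'"
    using assms(2) by blast
  then show ?thesis
    using tendsto_cong[OF assms(1)] by (simp add: lim_series_def)
qed

text \<open>The scale is the reciprocal of the given ratio raised to the power 1 / b2, so it
  diverges. Since \<open>N k\<close> is eventually at least 1, the scale is at most M, and
  divergence of M follows; case (a) does not state it.\<close>

lemma scaled_lag_at_top:
  fixes N M :: "nat \<Rightarrow> nat"
  assumes b: "b1 > 0" "b2 > 0" and pos: "\<forall>\<^sub>F k in sequentially. 0 < N k" "\<forall>\<^sub>F k in sequentially. 0 < M k"
    and lim: "(\<lambda>k. real (M k) powr -b2 / real (N k) powr -b1) \<longlonglongrightarrow> 0"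
  shows "filterlim (\<lambda>k. real (M k) * real (N k) powr (-b1 / b2)) at_top sequentially"
    and "filterlim M at_top sequentially"
proof -
  let ?r = "\<lambda>k. real (M k) powr -b2 / real (N k) powr -b1"
  have "filterlim ?r (at_right 0) sequentially"
    unfolding filterlim_at_right_to_0[symmetric] filterlim_at
    using lim pos by (auto elim: eventually_elim2 simp: )
  then have "filterlim (\<lambda>k. inverse (?r k)) at_top sequentially"
    by (rule filterlim_compose[OF filterlim_inverse_at_top_right])
  then have "filterlim (\<lambda>k. inverse (?r k) powr (1 / b2)) at_top sequentially"
    using b by (intro powr_minus_one_over_powr(1)) auto
  moreover have "\<forall>\<^sub>F k in sequentially. inverse (?r k) powr (1 / b2) = real (M k) * real (N k) powr (-b1 / b2)"
    using pos by eventually_elim (use b in \<open>simp add: powr_mult powr_powr powr_divide powr_minus field_simps\<close>)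
  ultimately show *: "filterlim (\<lambda>k. real (M k) * real (N k) powr (-b1 / b2)) at_top sequentially"
    by (rule filterlim_cong[OF refl refl, THEN iffD1, rotated])
  have "\<forall>\<^sub>F k in sequentially. real (M k) * real (N k) powr (-b1 / b2) \<le> real (M k)"
    using pos
  proof eventually_elim
    case (elim k)
    have "real (N k) powr (-b1 / b2) \<le> 1 powr (-b1 / b2)"
      using elim b by (intro powr_mono2') auto
    then show ?case
      by (simp add: mult_left_le)
  qed
  from filterlim_at_top_mono[OF * this] have "filterlim (\<lambda>k. nat \<lfloor>real (M k)\<rfloor>) at_top sequentially"
    by (rule filterlim_nat_floor)
  then show "filterlim M at_top sequentially"
    by simp
qed

lemma summable_powr_shift: "p > 1 \<Longrightarrow> (\<lambda>i. (1 + real i) powr -p) summable_on UNIV"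
  using summable_real_powr_iff[of "-p"] summable_Suc_iff[of "\<lambda>i. real i powr -p"]
  by (intro norm_summable_imp_summable_on) (simp add: add.commute)

context coefficients
begin

lemma transposed: "coefficients \<alpha> \<beta>2 \<beta>1 (\<lambda>i j. w j i) wJ wI"
proof
  show "((\<lambda>(i, j). w j i) \<longlongrightarrow> 1) (at_top \<times>\<^sub>F at_top)"
    using filterlim_compose[OF w_lim filterlim_Pair[OF filterlim_snd filterlim_fst]]
    by (simp add: case_prod_unfold)
qed (use alpha beta wI_lim wI_pos wJ_lim wJ_pos in auto)

lemma lag_series_transposed: "lag_series \<alpha> (field_coeff \<beta>2 \<beta>1 (\<lambda>i j. w j i)) M N = lag_series \<alpha> c N M"
proof -
  have "field_coeff \<beta>2 \<beta>1 (\<lambda>i j. w j i) = (\<lambda>i j. c j i)"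
    by (simp add: field_coeff_def fun_eq_iff mult_ac)
  from arg_cong[OF this, of "\<lambda>c. lag_series \<alpha> c M N"] show ?thesis
    by (rule trans) (rule lag_series_transpose)
qed

text \<open>The point is the choice of a: it must lie in [alpha-1, 1] and in [0, alpha], above alpha
  - 1/beta1 and below 1/beta2. The hypotheses say that these intervals meet.\<close>

lemma limit_both_linear:
  assumes "(1 < \<alpha> \<and> 1 / \<beta>1 + 1 / \<beta>2 > \<alpha> \<and> \<beta>1 < 1 / (\<alpha> - 1) \<and> \<beta>2 < 1 / (\<alpha> - 1)) \<or>
    (\<alpha> \<le> 1 \<and> 1 / \<beta>1 + 1 / \<beta>2 > \<alpha>)"
  shows "set_integrable lborel ({0<..} \<times> {0<..})
       (\<lambda>(u, v). V \<alpha> ((1 + u) powr (-\<beta>1) * v powr (-\<beta>2)) (u powr (-\<beta>1) * (1 + v) powr (-\<beta>2)))" (is ?I)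
    and "((\<lambda>(n, m). lag_series \<alpha> c n m / (real n powr (1 - \<beta>1 * \<alpha>) * real m powr (1 - \<beta>2 * \<alpha>))) \<longlongrightarrow>
        (LINT p:{0<..} \<times> {0<..}|lborel. (case p of (u, v) \<Rightarrow>
           V \<alpha> ((1 + u) powr (-\<beta>1) * v powr (-\<beta>2)) (u powr (-\<beta>1) * (1 + v) powr (-\<beta>2)))))
       (at_top \<times>\<^sub>F at_top)"
proof -
  have r: "\<alpha> - 1 / \<beta>1 > 0" "1 / \<beta>2 < \<alpha>" "1 / \<beta>2 > 0"
    using beta_pos beta_alpha by (simp_all add: field_simps)
  have "\<exists>a. \<alpha> - 1 \<le> a \<and> a \<le> 1 \<and> 0 \<le> a \<and> a \<le> \<alpha> \<and> \<alpha> - 1 / \<beta>1 < a \<and> a < 1 / \<beta>2"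
  \<comment> \<open>For alpha = 2 the interval [alpha-1, 1] is the single point 1. Otherwise the
    lower bound l is strictly below the upper bound u and the midpoint satisfies all
    constraints.\<close>
  proof (cases "\<alpha> = 2")
    case True
    then show ?thesis
      using assms beta_pos by (intro exI[of _ 1]) (auto simp: field_simps)
  next
    case False
    define l u where "l = max (\<alpha> - 1 / \<beta>1) (\<alpha> - 1)" and "u = min (1 / \<beta>2) 1"
    have "\<alpha> > 1 \<Longrightarrow> \<alpha> - 1 < 1 / \<beta>1 \<and> \<alpha> - 1 < 1 / \<beta>2"
      using assms beta_pos by (auto simp: field_simps)
    then have "l < u" "0 < l" "u < \<alpha>"
      using assms r alpha False by (auto simp: l_def u_def)
    then show ?thesis
      by (intro exI[of _ "(l + u) / 2"]) (auto simp: l_def u_def)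
  qed
  then obtain a where a: "\<alpha> - 1 \<le> a" "a \<le> 1" "0 \<le> a" "a \<le> \<alpha>" "\<alpha> - 1 / \<beta>1 < a" "a < 1 / \<beta>2"
    by blast
  then have a': "\<beta>1 * (\<alpha> - a) < 1" "\<beta>2 * a < 1"
    using beta_pos by (simp_all add: field_simps)
  show ?I
    by (rule both_linear(1)[OF filterlim_ident filterlim_ident a(1-4) a'])
  show "((\<lambda>(n, m). lag_series \<alpha> c n m / (real n powr (1 - \<beta>1 * \<alpha>) * real m powr (1 - \<beta>2 * \<alpha>))) \<longlongrightarrow>
        (LINT p:{0<..} \<times> {0<..}|lborel. (case p of (u, v) \<Rightarrow>
           V \<alpha> ((1 + u) powr (-\<beta>1) * v powr (-\<beta>2)) (u powr (-\<beta>1) * (1 + v) powr (-\<beta>2)))))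
       (at_top \<times>\<^sub>F at_top)"
    by (intro tendsto_at_top_prodI both_linear(2)[OF _ _ a(1-4) a'])
qed

lemma wI_bounded: "\<exists>K\<ge>1. \<forall>i. wI i \<le> K"
proof -
  obtain K where K: "K \<ge> 1" "\<And>i j. \<bar>w i j\<bar> \<le> K"
    using w_bounded by blast
  have "wI i \<le> K" for i
    by (rule LIMSEQ_le_const2[OF wI_lim]) (use K(2)[of i] in \<open>auto intro: order_trans[OF abs_ge_self]\<close>)
  then show ?thesis
    using K(1) by blast
qed

lemma limit_const_linear:
  assumes "1 < \<alpha>" "1 / (\<alpha> - 1) < \<beta>1" "\<beta>2 < 1"
  shows "set_integrable lborel {0<..} (\<lambda>v. v powr (-\<beta>2) * (1 + v) powr (-\<beta>2 * (\<alpha> - 1)))" (is "set_integrable _ _ ?g")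
    and "lim_series (\<lambda>(n, m). lag_series \<alpha> c n m / (real n powr (-\<beta>1) * real m powr (1 - \<beta>2 * \<alpha>))) (at_top \<times>\<^sub>F at_top)
       (LINT v:{0<..}|lborel. v powr (-\<beta>2) * (1 + v) powr (-\<beta>2 * (\<alpha> - 1)))
       (\<lambda>i::nat. wI i powr (\<alpha> - 1) * (1 + real i) powr (-\<beta>1 * (\<alpha> - 1)))"
proof -
  let ?h = "\<lambda>i::nat. wI i powr (\<alpha> - 1) * (1 + real i) powr (-\<beta>1 * (\<alpha> - 1))"
  have hyp: "\<beta>1 * (\<alpha> - 1) > 1"
    using assms by (simp add: field_simps)
  note floor = floor_series_fst[where g="\<lambda>i v. ?h i * ?g v", OF const_linear(1)[OF filterlim_ident filterlim_ident assms(1) hyp assms(3)]]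
  \<comment> \<open>Integrability of the v-factor is read off from the slice at i = 0, after
    dividing by its positive coefficient.\<close>
  have "set_integrable lborel {0<..} (\<lambda>v. (1 / ?h 0) * (?h 0 * ?g v))"
    by (rule set_integrable_mult_right) (use floor(1)[of 0] in simp)
  then show "set_integrable lborel {0<..} ?g"
    using wI_pos[of 0] by simp
  obtain K where K: "K \<ge> 1" "\<And>i. wI i \<le> K"
    using wI_bounded by blast
  have "?h summable_on UNIV"
  proof (rule summable_on_comparison_test)
    show "(\<lambda>i. K powr (\<alpha> - 1) * (1 + real i) powr - (\<beta>1 * (\<alpha> - 1))) summable_on UNIV"
      by (intro summable_on_cmult_right summable_powr_shift hyp)
    show "?h i \<le> K powr (\<alpha> - 1) * (1 + real i) powr - (\<beta>1 * (\<alpha> - 1))" for i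
      using assms(1) K powr_mono2[OF _ less_imp_le[OF wI_pos] K(2), of "\<alpha> - 1" i] by (auto intro!: mult_right_mono)
  qed auto
  moreover have "((\<lambda>(n, m). lag_series \<alpha> c n m / (real n powr (-\<beta>1) * real m powr (1 - \<beta>2 * \<alpha>))) \<longlongrightarrow>
      (\<Sum>\<^sub>\<infinity>i. LINT v:{0<..}|lborel. ?h i * ?g v)) (at_top \<times>\<^sub>F at_top)"
    unfolding floor(3)[symmetric] by (intro tendsto_at_top_prodI const_linear(2) assms hyp)
  moreover have "(\<Sum>\<^sub>\<infinity>i. LINT v:{0<..}|lborel. ?h i * ?g v) = (LINT v:{0<..}|lborel. ?g v) * (\<Sum>\<^sub>\<infinity>i. ?h i)"
    by (subst set_integral_mult_right) (subst infsum_cmult_left', simp add: mult.commute)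
  ultimately show "lim_series (\<lambda>(n, m). lag_series \<alpha> c n m / (real n powr (-\<beta>1) * real m powr (1 - \<beta>2 * \<alpha>))) (at_top \<times>\<^sub>F at_top)
       (LINT v:{0<..}|lborel. ?g v) ?h"
    by (simp add: lim_series_def)
qed

lemma limit_log_linear:
  assumes "1 < \<alpha>" "\<beta>1 = 1 / (\<alpha> - 1)" "\<beta>2 < 1"
  shows "set_integrable lborel {0<..} (\<lambda>v. v powr (-\<beta>2) * (1 + v) powr (-\<beta>2 * (\<alpha> - 1)))" (is "set_integrable _ _ ?g")
    and "((\<lambda>(n, m). lag_series \<alpha> c n m / (real n powr (1 - \<beta>1 * \<alpha>) * real m powr (1 - \<beta>2 * \<alpha>) * ln (real n))) \<longlongrightarrow>
        (LINT v:{0<..}|lborel. v powr (-\<beta>2) * (1 + v) powr (-\<beta>2 * (\<alpha> - 1)))) (at_top \<times>\<^sub>F at_top)"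
proof -
  have hyp: "\<beta>1 * (\<alpha> - 1) = 1" "1 - \<beta>1 * \<alpha> = -\<beta>1"
    using assms by (simp_all add: field_simps)
  note floor = floor_series_fst[where g="\<lambda>i v. if i = 0 then ?g v else 0",
    OF log_linear(1)[OF filterlim_ident filterlim_ident assms(1) hyp(1) assms(3)]]
  show "set_integrable lborel {0<..} ?g"
    using floor(1)[of 0] by simp
  \<comment> \<open>Only the cell of index 0, that is 0 < t < 1, carries mass, so the series over
    cells collapses to one integral.\<close>
  have "(\<Sum>\<^sub>\<infinity>i. LINT v:{0<..}|lborel. if i = (0::nat) then ?g v else 0) =
      (\<Sum>\<^sub>\<infinity>i\<in>{0::nat}. LINT v:{0<..}|lborel. if i = (0::nat) then ?g v else 0)"
    by (rule infsum_cong_neutral) (auto simp: set_lebesgue_integral_def)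
  then have lint: "(LINT p:{0<..} \<times> {0<..}|lborel. (\<lambda>(u::real, v). if nat \<lfloor>u\<rfloor> = 0 then ?g v else 0) p) = (LINT v:{0<..}|lborel. ?g v)"
    unfolding floor(3) by simp
  have "((\<lambda>(n, m). lag_series \<alpha> c n m / (real n powr (-\<beta>1) * ln (real n) * real m powr (1 - \<beta>2 * \<alpha>))) \<longlongrightarrow>
        (LINT v:{0<..}|lborel. ?g v)) (at_top \<times>\<^sub>F at_top)"
    unfolding lint[symmetric] by (intro tendsto_at_top_prodI log_linear(2) assms hyp)
  then show "((\<lambda>(n, m). lag_series \<alpha> c n m / (real n powr (1 - \<beta>1 * \<alpha>) * real m powr (1 - \<beta>2 * \<alpha>) * ln (real n))) \<longlongrightarrow>
        (LINT v:{0<..}|lborel. ?g v)) (at_top \<times>\<^sub>F at_top)"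
    unfolding hyp(2) by (simp only: mult_ac)
qed

text \<open>The ratio of orders tends to 0, so the kernel degenerates to a product. With a = 1 the
  majorant has exactly the rate A B^(alpha-1), and hypothesis \<open>D\<close> of
  \<open>const_const\<close> holds with constant 1.\<close>

lemma limit_unbalanced:
  fixes N M :: "nat \<Rightarrow> nat"
  assumes N: "filterlim N at_top sequentially" and M: "filterlim M at_top sequentially"
    and hyp: "1 < \<alpha>" "\<beta>1 * (\<alpha> - 1) > 1" "\<beta>2 > 1"
    and lim: "(\<lambda>k. real (N k) powr -\<beta>1 / real (M k) powr -\<beta>2) \<longlonglongrightarrow> 0"
  shows "lim_series (\<lambda>k. lag_series \<alpha> c (N k) (M k) / (real (N k) powr (-\<beta>1) * real (M k) powr (-\<beta>2 * (\<alpha> - 1)))) sequentially 1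
    (\<lambda>(i, j). wJ j * wI i powr (\<alpha> - 1) * (1 + real j) powr (-\<beta>2) * (1 + real i) powr (-\<beta>1 * (\<alpha> - 1)))"
proof -
  have "kern \<alpha> 0 (wJ j * (1 + real j) powr -\<beta>2) (wI i * (1 + real i) powr -\<beta>1) =
      wJ j * wI i powr (\<alpha> - 1) * (1 + real j) powr (-\<beta>2) * (1 + real i) powr (-\<beta>1 * (\<alpha> - 1))" for i j
    using wI_pos[of i] by (subst kern_0[OF wI_factor_pos]) (simp add: powr_mult powr_powr)
  then show ?thesis
    using const_const[OF N M, of 1 0 1] hyp alpha lim by (simp add: lim_series_def)
qed

text \<open>The ratio of orders tends to 1 / r. The two normalisations, A B^(alpha-1) and
  A^(alpha-1) B, differ by the factor (B / A)^(alpha-2), which converges to r^(alpha-2); homogeneity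
  of V of degree alpha then converts one limit into the other.\<close>

lemma limit_balanced:
  fixes N M :: "nat \<Rightarrow> nat"
  assumes N: "filterlim N at_top sequentially" and M: "filterlim M at_top sequentially"
    and a: "\<alpha> - 1 \<le> a" "a \<le> 1" "0 \<le> a" "a \<le> \<alpha>" "\<beta>1 * (\<alpha> - a) > 1" "\<beta>2 * a > 1"
    and lim: "(\<lambda>k. real (M k) powr -\<beta>2 / real (N k) powr -\<beta>1) \<longlonglongrightarrow> r" and "r > 0"
  shows "lim_series (\<lambda>k. lag_series \<alpha> c (N k) (M k) / (real (N k) powr (-\<beta>1) * real (M k) powr (-\<beta>2 * (\<alpha> - 1)))) sequentially r
      (\<lambda>(i, j). V \<alpha> (wJ j * inverse r * (1 + real j) powr (-\<beta>2)) (wI i * (1 + real i) powr (-\<beta>1)))"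
    and "lim_series (\<lambda>k. lag_series \<alpha> c (N k) (M k) / (real (N k) powr (-\<beta>1 * (\<alpha> - 1)) * real (M k) powr (-\<beta>2))) sequentially (1 / r)
      (\<lambda>(i, j). V \<alpha> (wJ j * (1 + real j) powr (-\<beta>2)) (r * wI i * (1 + real i) powr (-\<beta>1)))"
proof -
  note pos = eventually_pos_nat[OF N] eventually_pos_nat[OF M]
  let ?q = "\<lambda>k. real (M k) powr -\<beta>2 / real (N k) powr -\<beta>1"
  let ?f = "\<lambda>(i, j). V \<alpha> (wJ j * inverse r * (1 + real j) powr (-\<beta>2)) (wI i * (1 + real i) powr (-\<beta>1))"
  let ?f' = "\<lambda>(i, j). V \<alpha> (wJ j * (1 + real j) powr (-\<beta>2)) (r * wI i * (1 + real i) powr (-\<beta>1))"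
  have "(\<lambda>k. 1 / ?q k) \<longlonglongrightarrow> 1 / r"
    using \<open>r > 0\<close> by (intro tendsto_intros lim) auto
  then have \<kappa>: "(\<lambda>k. real (N k) powr -\<beta>1 / real (M k) powr -\<beta>2) \<longlonglongrightarrow> 1 / r"
    by simp
  \<comment> \<open>The excess (B / A)^(1-a) of the majorant over the rate converges to
    \<open>r powr (1 - a)\<close>, so it is eventually below that limit plus 1.\<close>
  have D: "\<forall>\<^sub>F k in sequentially. real (N k) powr (-\<beta>1 * a) * real (M k) powr (-\<beta>2 * (\<alpha> - a)) \<le>
      (r powr (1 - a) + 1) * (real (N k) powr -\<beta>1 * real (M k) powr (-\<beta>2 * (\<alpha> - 1)))"
  proof -
    have "(\<lambda>k. ?q k powr (1 - a)) \<longlonglongrightarrow> r powr (1 - a)"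
      using \<open>r > 0\<close> by (intro tendsto_intros lim) auto
    then have "\<forall>\<^sub>F k in sequentially. ?q k powr (1 - a) < r powr (1 - a) + 1"
      by (rule order_tendstoD) simp
    then show ?thesis
      using pos
    proof eventually_elim
      case (elim k)
      have "exp x powr (-\<beta>1 * a) * exp y powr (-\<beta>2 * (\<alpha> - a)) =
          (exp y powr -\<beta>2 / exp x powr -\<beta>1) powr (1 - a) * (exp x powr -\<beta>1 * exp y powr (-\<beta>2 * (\<alpha> - 1)))" for x y :: real
        by (simp add: powr_def algebra_simps flip: exp_add exp_diff)
      from this[of "ln (real (N k))" "ln (real (M k))"]
      have "real (N k) powr (-\<beta>1 * a) * real (M k) powr (-\<beta>2 * (\<alpha> - a)) =
          ?q k powr (1 - a) * (real (N k) powr -\<beta>1 * real (M k) powr (-\<beta>2 * (\<alpha> - 1)))"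
        using elim by simp
      also have "\<dots> \<le> (r powr (1 - a) + 1) * (real (N k) powr -\<beta>1 * real (M k) powr (-\<beta>2 * (\<alpha> - 1)))"
        using elim by (intro mult_right_mono) auto
      finally show ?case .
    qed
  qed
  have f: "(\<lambda>(i, j). kern \<alpha> (1 / r) (wJ j * (1 + real j) powr -\<beta>2) (wI i * (1 + real i) powr -\<beta>1)) = (\<lambda>p. r * ?f p)"
    using \<open>r > 0\<close> by (auto simp: kern_inverse fun_eq_iff mult_ac)
  have "?f' (i, j) = r powr \<alpha> * ?f (i, j)" for i j
  proof -
    have "V \<alpha> (r * x) (r * y) = r powr \<alpha> * V \<alpha> x y" for x y
    proof -
      have "V \<alpha> (r * x) (r * y) / (r * r powr (\<alpha> - 1)) = V \<alpha> x y"
        using V_scaled[of r r \<alpha> x y] \<open>r > 0\<close> by (simp add: V_eq)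
      moreover have "r * r powr (\<alpha> - 1) = r powr \<alpha>"
        using \<open>r > 0\<close> by (simp add: powr_diff)
      ultimately show ?thesis
        using \<open>r > 0\<close> by (simp add: field_simps)
    qed
    from this[of "wJ j * inverse r * (1 + real j) powr (-\<beta>2)" "wI i * (1 + real i) powr (-\<beta>1)"]
    show ?thesis
      using \<open>r > 0\<close> by (simp add: field_simps)
  qed
  then have f': "?f' = (\<lambda>p. r powr \<alpha> * ?f p)"
    by auto
  note cc = const_const[OF N M a \<kappa> D, unfolded f]
  have summable: "?f summable_on UNIV"
    using summable_on_cmult_right[OF cc(1), of "1 / r"] \<open>r > 0\<close> by simp
  have L: "(\<lambda>k. lag_series \<alpha> c (N k) (M k) / (real (N k) powr (-\<beta>1) * real (M k) powr (-\<beta>2 * (\<alpha> - 1)))) \<longlonglongrightarrow> r * infsum ?f UNIV"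
    using cc(2) by (simp only: infsum_cmult_right')
  then show "lim_series (\<lambda>k. lag_series \<alpha> c (N k) (M k) / (real (N k) powr (-\<beta>1) * real (M k) powr (-\<beta>2 * (\<alpha> - 1)))) sequentially r ?f"
    using summable by (simp add: lim_series_def)
  have "(\<lambda>k. lag_series \<alpha> c (N k) (M k) / (real (N k) powr (-\<beta>1) * real (M k) powr (-\<beta>2 * (\<alpha> - 1))) * ?q k powr (\<alpha> - 2)) \<longlonglongrightarrow>
      r * infsum ?f UNIV * r powr (\<alpha> - 2)"
    using \<open>r > 0\<close> by (intro tendsto_intros L lim) auto
  moreover have "\<forall>\<^sub>F k in sequentially. lag_series \<alpha> c (N k) (M k) / (real (N k) powr (-\<beta>1) * real (M k) powr (-\<beta>2 * (\<alpha> - 1))) * ?q k powr (\<alpha> - 2) =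
      lag_series \<alpha> c (N k) (M k) / (real (N k) powr (-\<beta>1 * (\<alpha> - 1)) * real (M k) powr (-\<beta>2))"
    using pos
  proof eventually_elim
    case (elim k)
    have "exp x powr (-\<beta>1 * (\<alpha> - 1)) * exp y powr (-\<beta>2) * (exp y powr -\<beta>2 / exp x powr -\<beta>1) powr (\<alpha> - 2) =
        exp x powr (-\<beta>1) * exp y powr (-\<beta>2 * (\<alpha> - 1))" for x y :: real
      by (simp add: powr_def algebra_simps flip: exp_add exp_diff)
    from this[of "ln (real (N k))" "ln (real (M k))"] show ?case
      using elim by (simp add: field_simps)
  qed
  ultimately have "(\<lambda>k. lag_series \<alpha> c (N k) (M k) / (real (N k) powr (-\<beta>1 * (\<alpha> - 1)) * real (M k) powr (-\<beta>2))) \<longlonglongrightarrow>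
      r * infsum ?f UNIV * r powr (\<alpha> - 2)"
    by (rule Lim_transform_eventually)
  moreover have "r * infsum ?f UNIV * r powr (\<alpha> - 2) = 1 / r * infsum ?f' UNIV"
  proof -
    have "r * S * r powr (\<alpha> - 2) = 1 / r * (r powr \<alpha> * S)" for S
      using \<open>r > 0\<close> by (simp add: powr_diff power2_eq_square)
    then show ?thesis
      unfolding f' infsum_cmult_right' by blast
  qed
  moreover have "?f' summable_on UNIV"
    unfolding f' by (rule summable_on_cmult_right[OF summable])
  ultimately show "lim_series (\<lambda>k. lag_series \<alpha> c (N k) (M k) / (real (N k) powr (-\<beta>1 * (\<alpha> - 1)) * real (M k) powr (-\<beta>2))) sequentially (1 / r) ?f'"
    by (simp only: lim_series_def)
qed

lemma limit_scaled:
  fixes N M :: "nat \<Rightarrow> nat"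
  assumes N: "filterlim N at_top sequentially" and M: "filterlim M at_top sequentially"
    and s: "filterlim (\<lambda>k. real (M k) * real (N k) powr (-\<beta>1 / \<beta>2)) at_top sequentially"
    and a1: "\<alpha> - 1 \<le> a1" "a1 \<le> 1" "0 \<le> a1" "a1 \<le> \<alpha>" "\<beta>2 * a1 < 1"
    and a2: "\<alpha> - 1 \<le> a2" "a2 \<le> 1" "0 \<le> a2" "a2 \<le> \<alpha>" "\<beta>2 * a2 > 1" "\<beta>1 * (\<alpha> - a2) > 1"
  shows "lim_series_integral (\<lambda>k. lag_series \<alpha> c (N k) (M k) / (real (N k) powr (-\<beta>1 / \<beta>2) * real (M k) powr (1 - \<beta>2 * \<alpha>))) sequentially
    (\<lambda>i v. V \<alpha> (v powr (-\<beta>2)) (wI i * (1 + real i) powr (-\<beta>1)))"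
proof -
  note cs = const_scaled[OF N M s a1 a2]
  note floor = floor_series_fst[where g="\<lambda>i v. V \<alpha> (v powr (-\<beta>2)) (wI i * (1 + real i) powr (-\<beta>1))", OF cs(1)]
  have "\<forall>\<^sub>F k in sequentially. lag_series \<alpha> c (N k) (M k) / (real (M k) * real (N k) powr (-\<beta>1 / \<beta>2) * real (M k) powr (-\<beta>2 * \<alpha>)) =
      lag_series \<alpha> c (N k) (M k) / (real (N k) powr (-\<beta>1 / \<beta>2) * real (M k) powr (1 - \<beta>2 * \<alpha>))"
    using eventually_pos_nat[OF M] by eventually_elim (simp add: powr_diff powr_minus field_simps)
  from Lim_transform_eventually[OF cs(2) this] show ?thesis
    using floor(1,2) unfolding floor(3) by (simp add: lim_series_integral_def lim_series_def)
qed

text \<open>At a = alpha-1 the quantity beta1 (alpha-a) is beta1 > 1, so by continuity it exceeds 1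
  for some larger a, as \<open>const_log\<close> requires. In the limit the indicator of t < 1
  integrates to 1.\<close>

lemma limit_log:
  fixes N M :: "nat \<Rightarrow> nat"
  assumes N: "filterlim N at_top sequentially" and M: "filterlim M at_top sequentially"
    and s: "filterlim (\<lambda>k. real (M k) * real (N k) powr (-\<beta>1 / \<beta>2)) at_top sequentially"
    and hyp: "1 < \<alpha>" "\<beta>2 * (\<alpha> - 1) = 1" "\<beta>1 > 1" "\<alpha> < 2"
  shows "lim_series (\<lambda>k. lag_series \<alpha> c (N k) (M k) / (real (N k) powr (-\<beta>1 / \<beta>2) * real (M k) powr (1 - \<beta>2 * \<alpha>) *
      ln (real (N k) powr (-\<beta>1 / \<beta>2) * real (M k)))) sequentially 1
    (\<lambda>i. wI i * (1 + real i) powr (-\<beta>1))"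
proof -
  have "\<exists>a. \<alpha> - 1 < a \<and> a \<le> 1 \<and> \<beta>1 * (\<alpha> - a) > 1"
  proof -
    \<comment> \<open>The constraints on a from above are a <= 1 and a < alpha - 1/beta1. Both
      bounds exceed alpha-1, and the midpoint between alpha-1 and their minimum is
      admissible.\<close>
    define u where "u = min 1 (\<alpha> - 1 / \<beta>1)"
    have "1 / \<beta>1 < 1"
      using hyp by simp
    then have u: "\<alpha> - 1 < u" "u \<le> 1" "u \<le> \<alpha> - 1 / \<beta>1"
      using hyp by (auto simp: u_def)
    define a where "a = (\<alpha> - 1 + u) / 2"
    have "b < \<alpha> - (\<alpha> - 1 + u) / 2" if "b < 1" "u \<le> \<alpha> - b" for b
      using that by (simp add: field_simps)
    then have "\<alpha> - 1 < a" "a \<le> 1" "1 / \<beta>1 < \<alpha> - a"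
      using u \<open>1 / \<beta>1 < 1\<close> by (simp_all add: a_def)
    then show ?thesis
      using beta_pos by (intro exI[of _ a]) (simp add: field_simps)
  qed
  then obtain a where a: "\<alpha> - 1 < a" "a \<le> 1" "\<beta>1 * (\<alpha> - a) > 1"
    by blast
  note cs = const_log[OF N M s hyp(1,2) a]
  note floor = floor_series_fst[where g="\<lambda>i t. wI i * (1 + real i) powr (-\<beta>1) * indicator {..<1} (t::real)", OF cs(1)]
  have "(LINT t:{0::real<..}|lborel. K * indicator {..<1} t) = K" for K :: real
  proof -
    have "(LINT t:{0::real<..}|lborel. K * indicator {..<1} t) = integral\<^sup>L lborel (\<lambda>t::real. K * indicator {0<..<1} t)"
      unfolding set_lebesgue_integral_def by (intro Bochner_Integration.integral_cong) (auto simp: indicator_def)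
    then show ?thesis
      by simp
  qed
  note floor_eval = floor(2,3)[unfolded this]
  have "\<forall>\<^sub>F k in sequentially. lag_series \<alpha> c (N k) (M k) / (real (M k) * real (N k) powr (-\<beta>1 / \<beta>2) * real (M k) powr (-\<beta>2 * \<alpha>) *
        ln (real (M k) * real (N k) powr (-\<beta>1 / \<beta>2))) =
      lag_series \<alpha> c (N k) (M k) / (real (N k) powr (-\<beta>1 / \<beta>2) * real (M k) powr (1 - \<beta>2 * \<alpha>) *
        ln (real (N k) powr (-\<beta>1 / \<beta>2) * real (M k)))"
    using eventually_pos_nat[OF M] by eventually_elim (simp add: powr_diff powr_minus field_simps)
  from Lim_transform_eventually[OF cs(2) this] show ?thesis
    using floor_eval(1) unfolding floor_eval(2) by (simp add: lim_series_def)
qed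

end

section \<open>V as an angular integral of powers of linear forms\<close>

section \<open>The kernel as an angular average\<close>

lemma integral_periodic_shift:
  fixes f :: "real \<Rightarrow> real"
  assumes cont: "continuous_on UNIV f" and per: "\<And>t. f (t + p) = f t" and x: "0 \<le> x" "x \<le> p"
  shows "integral {0..p} (\<lambda>t. f (t + x)) = integral {0..p} f"
proof -
  have int: "f integrable_on {a..b}" for a b
    by (intro integrable_continuous_interval continuous_on_subset[OF cont]) auto
  have shift: "integral {a..b} (\<lambda>t. f (t + y)) = integral {a + y..b + y} f" for a b y
    using integral_shift_Icc_real[of a b f y] by (simp add: comp_def add.commute)
  have "integral {0..p} (\<lambda>t. f (t + x)) = integral {x..p} f + integral {p..p + x} f"
    using Henstock_Kurzweil_Integration.integral_combine[OF _ _ int, of x p "p + x"] x by (simp add: shift)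
  also have "integral {p..p + x} f = integral {0..x} f"
    using shift[of 0 x p] per by (simp add: add.commute)
  also have "integral {x..p} f + integral {0..x} f = integral {0..p} f"
    using Henstock_Kurzweil_Integration.integral_combine[OF _ _ int, of 0 x p] x by simp
  finally show ?thesis .
qed

lemma continuous_on_abs_powr [continuous_intros]:
  fixes f :: "'a::topological_space \<Rightarrow> real"
  assumes "continuous_on S f" "\<alpha> > 0"
  shows "continuous_on S (\<lambda>x. \<bar>f x\<bar> powr \<alpha>)"
  using assms by (intro continuous_on_powr' continuous_intros) auto

text \<open>Up to normalisation, the Fourier coefficient of |cos|^alpha at frequency 2. It is the
  multiplier between V and its angular integral, so it has to be nonzero for V to be
  recovered.\<close>

definition cos_moment :: "real \<Rightarrow> real" where
  "cos_moment \<alpha> = integral {0..2 * pi} (\<lambda>t. \<bar>cos t\<bar> powr \<alpha> * cos (2 * t))"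

text \<open>Translation by pi/2 replaces cos by sin and changes the sign of cos 2t. Averaging the
  two expressions leaves the integrand (|cos|^alpha - |sin|^alpha)(cos^2 - sin^2), whose factors
  always have the same sign.\<close>

lemma cos_moment_pos:
  assumes "\<alpha> > 0"
  shows "cos_moment \<alpha> > 0"
proof -
  let ?f = "\<lambda>t. \<bar>cos t\<bar> powr \<alpha> * cos (2 * t)"
  let ?g = "\<lambda>t. (\<bar>cos t\<bar> powr \<alpha> - \<bar>sin t\<bar> powr \<alpha>) * ((cos t)\<^sup>2 - (sin t)\<^sup>2)"
  have cont: "continuous_on S ?f" "continuous_on S (\<lambda>t. \<bar>sin t\<bar> powr \<alpha> * cos (2 * t))" "continuous_on S ?g" for S
    using assms by (intro continuous_intros; simp)+
  have "?f (t + 2 * pi) = ?f t" for t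
    using cos_periodic[of "2 * t + 2 * pi"] cos_periodic[of "2 * t"] by (simp add: distrib_left add.commute)
  then have "integral {0..2 * pi} (\<lambda>t. ?f (t + pi / 2)) = cos_moment \<alpha>"
    unfolding cos_moment_def using pi_gt_zero by (intro integral_periodic_shift cont) auto
  moreover have "(\<lambda>t. ?f (t + pi / 2)) = (\<lambda>t. - (\<bar>sin t\<bar> powr \<alpha> * cos (2 * t)))"
    by (simp add: fun_eq_iff cos_add distrib_left)
  ultimately have "cos_moment \<alpha> = - integral {0..2 * pi} (\<lambda>t. \<bar>sin t\<bar> powr \<alpha> * cos (2 * t))"
    by (simp only: Henstock_Kurzweil_Integration.integral_neg)
  then have "2 * cos_moment \<alpha> = integral {0..2 * pi} ?f - integral {0..2 * pi} (\<lambda>t. \<bar>sin t\<bar> powr \<alpha> * cos (2 * t))"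
    by (simp add: cos_moment_def)
  also have "\<dots> = integral {0..2 * pi} (\<lambda>t. ?f t - \<bar>sin t\<bar> powr \<alpha> * cos (2 * t))"
    by (intro Henstock_Kurzweil_Integration.integral_diff[symmetric] integrable_continuous_interval cont)
  also have "\<dots> = integral {0..2 * pi} ?g"
    by (simp add: cos_double left_diff_distrib)
  finally have eq: "2 * cos_moment \<alpha> = integral {0..2 * pi} ?g" .
  have nonneg: "?g t \<ge> 0" for t
  proof (cases "\<bar>sin t\<bar> \<le> \<bar>cos t\<bar>")
    case True
    then have "(sin t)\<^sup>2 \<le> (cos t)\<^sup>2" "\<bar>sin t\<bar> powr \<alpha> \<le> \<bar>cos t\<bar> powr \<alpha>"
      using assms by (auto simp: abs_le_square_iff intro: powr_mono2)
    then show ?thesis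
      by (intro mult_nonneg_nonneg) auto
  next
    case False
    then have "(cos t)\<^sup>2 \<le> (sin t)\<^sup>2" "\<bar>cos t\<bar> powr \<alpha> \<le> \<bar>sin t\<bar> powr \<alpha>"
      using assms by (auto simp: abs_le_square_iff[symmetric] intro: powr_mono2)
    then show ?thesis
      by (intro mult_nonpos_nonpos) auto
  qed
  \<comment> \<open>A continuous nonnegative function has zero integral only if it vanishes
    everywhere, but here the value at t = 0 is 1.\<close>
  have "integral {0..2 * pi} ?g \<noteq> 0"
    using integral_eq_0_iff[OF cont(3), of 0 "2 * pi"] nonneg assms by (auto intro!: bexI[of _ 0])
  moreover have "integral {0..2 * pi} ?g \<ge> 0"
    by (intro Henstock_Kurzweil_Integration.integral_nonneg integrable_continuous_interval cont nonneg)
  ultimately show ?thesis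
    using eq by simp
qed

text \<open>In polar coordinates (a, b) = r (cos x, sin x) the linear form is r cos(t - x). After
  translating by x, the addition formula for sin 2(t + x) leaves a cosine part, which is
  \<open>cos_moment\<close>, and an odd part with zero integral; finally r^alpha sin 2x is 2 V(a,
  b).\<close>

lemma angular_integral:
  assumes "\<alpha> > 0"
  shows "integral {0..2 * pi} (\<lambda>t. \<bar>a * cos t + b * sin t\<bar> powr \<alpha> * sin (2 * t)) = 2 * cos_moment \<alpha> * V \<alpha> a b"
proof (cases "a = 0 \<and> b = 0")
  case True
  then show ?thesis
    by simp
next
  case False
  define r where "r = sqrt (a\<^sup>2 + b\<^sup>2)"
  have "r > 0"
    using False by (simp add: r_def sum_power2_gt_zero_iff)
  have "(a / r)\<^sup>2 + (b / r)\<^sup>2 = 1"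
    using False by (simp add: r_def power_divide sum_power2_gt_zero_iff flip: add_divide_distrib)
  then obtain x where x: "0 \<le> x" "x < 2 * pi" "a / r = cos x" "b / r = sin x"
    by (rule sincos_total_2pi)
  then have ab: "a = r * cos x" "b = r * sin x"
    using \<open>r > 0\<close> by (auto simp: field_simps)
  let ?f = "\<lambda>t. \<bar>a * cos t + b * sin t\<bar> powr \<alpha> * sin (2 * t)"
  let ?c = "\<lambda>t. \<bar>cos t\<bar> powr \<alpha> * cos (2 * t)" and ?s = "\<lambda>t. \<bar>cos t\<bar> powr \<alpha> * sin (2 * t)"
  have cont: "continuous_on S ?f" "continuous_on S ?c" "continuous_on S ?s" for S
    using assms by (intro continuous_intros; simp)+
  have per: "?f (t + 2 * pi) = ?f t" "?s (t + 2 * pi) = ?s t" for t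
    using sin_periodic[of "2 * t + 2 * pi"] sin_periodic[of "2 * t"] by (simp_all add: distrib_left add.commute)
  \<comment> \<open>\<open>?s\<close> is odd, so reflection gives minus its integral over
    [-2 pi, 0], and periodicity moves that interval back: the integral equals its own
    negative.\<close>
  have "integral {0..2 * pi} ?s = integral {- (2 * pi)..0} (\<lambda>t. ?s (- t))"
    using Henstock_Kurzweil_Integration.integral_reflect_real[of "2 * pi" 0 ?s] by simp
  also have "\<dots> = - integral {- (2 * pi)..0} ?s"
    by (simp add: Henstock_Kurzweil_Integration.integral_neg)
  also have "integral {- (2 * pi)..0} ?s = integral {- (2 * pi)..0} (\<lambda>t. ?s (t + 2 * pi))"
    unfolding per ..
  also have "\<dots> = integral {0..2 * pi} ?s"
    using integral_shift_Icc_real[of "- (2 * pi)" 0 ?s "2 * pi"] by (simp add: comp_def add.commute)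
  finally have s0: "integral {0..2 * pi} ?s = 0"
    by simp
  have "?f (t + x) = r powr \<alpha> * sin (2 * x) * ?c t + r powr \<alpha> * cos (2 * x) * ?s t" for t
  proof -
    have "a * cos (t + x) + b * sin (t + x) = r * cos t * ((cos x)\<^sup>2 + (sin x)\<^sup>2)"
      unfolding ab cos_add sin_add by algebra
    then have "\<bar>a * cos (t + x) + b * sin (t + x)\<bar> = r * \<bar>cos t\<bar>"
      using \<open>r > 0\<close> by (simp add: abs_mult)
    moreover have "sin (2 * (t + x)) = sin (2 * t) * cos (2 * x) + cos (2 * t) * sin (2 * x)"
      by (simp add: distrib_left sin_add)
    ultimately show ?thesis
      using \<open>r > 0\<close> by (simp add: powr_mult algebra_simps)
  qed
  moreover have "integral {0..2 * pi} (\<lambda>t. ?f (t + x)) = integral {0..2 * pi} ?f"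
    using x per by (intro integral_periodic_shift cont) auto
  ultimately have "integral {0..2 * pi} ?f =
      integral {0..2 * pi} (\<lambda>t. r powr \<alpha> * sin (2 * x) * ?c t + r powr \<alpha> * cos (2 * x) * ?s t)"
    by simp
  also have "\<dots> = integral {0..2 * pi} (\<lambda>t. r powr \<alpha> * sin (2 * x) * ?c t) + integral {0..2 * pi} (\<lambda>t. r powr \<alpha> * cos (2 * x) * ?s t)"
    by (intro Henstock_Kurzweil_Integration.integral_add integrable_continuous_interval continuous_on_mult_left cont)
  also have "\<dots> = r powr \<alpha> * sin (2 * x) * cos_moment \<alpha>"
    by (simp only: Henstock_Kurzweil_Integration.integral_mult_right s0 cos_moment_def mult_zero_right add_0_right)
  also have "r powr \<alpha> * sin (2 * x) = 2 * V \<alpha> a b"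
  proof -
    have "(a\<^sup>2 + b\<^sup>2) powr ((2 - \<alpha>) / 2) = r powr (2 - \<alpha>)"
      by (simp add: r_def powr_powr flip: powr_half_sqrt)
    then have "V \<alpha> a b = a * b / r powr (2 - \<alpha>)"
      by (simp add: V_eq)
    also have "\<dots> = r powr \<alpha> * (cos x * sin x)"
      using \<open>r > 0\<close> unfolding ab by (simp add: powr_diff power2_eq_square)
    finally show ?thesis
      by (simp add: sin_double)
  qed
  finally show ?thesis
    by simp
qed

lemma abs_powr_le:
  fixes a b t :: real
  assumes "\<alpha> > 0"
  shows "\<bar>a * cos t + b * sin t\<bar> powr \<alpha> \<le> (\<bar>a\<bar> + \<bar>b\<bar>) powr \<alpha>"
proof (intro powr_mono2)
  have "\<bar>a * cos t + b * sin t\<bar> \<le> \<bar>a\<bar> * \<bar>cos t\<bar> + \<bar>b\<bar> * \<bar>sin t\<bar>"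
    by (metis abs_mult abs_triangle_ineq)
  also have "\<dots> \<le> \<bar>a\<bar> * 1 + \<bar>b\<bar> * 1"
    by (intro add_mono mult_left_mono) auto
  finally show "\<bar>a * cos t + b * sin t\<bar> \<le> \<bar>a\<bar> + \<bar>b\<bar>"
    by simp
qed (use assms in auto)

text \<open>Fubini applied to \<open>angular_integral\<close>. The right-hand side involves a, b and
  Q only through the integrals of |a cos t + b sin t|^alpha, so it is determined by the exponent of
  a stable characteristic function. It is applied both to a spectral measure and to counting measure
  on the sites.\<close>

lemma integral_V_eq_angular:
  fixes a b :: "'i \<Rightarrow> real"
  assumes "sigma_finite_measure Q" and [measurable]: "a \<in> borel_measurable Q" "b \<in> borel_measurable Q"
    and int: "integrable Q (\<lambda>s. (\<bar>a s\<bar> + \<bar>b s\<bar>) powr \<alpha>)" and "\<alpha> > 0"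
  shows "2 * cos_moment \<alpha> * (\<integral>s. V \<alpha> (a s) (b s) \<partial>Q) =
    (LINT t:{0..2 * pi}|lborel. (\<integral>s. \<bar>a s * cos t + b s * sin t\<bar> powr \<alpha> \<partial>Q) * sin (2 * t))"
proof -
  interpret Q: sigma_finite_measure Q by fact
  interpret pair_sigma_finite Q lborel ..
  define f where "f s t = indicator {0..2 * pi} t * (\<bar>a s * cos t + b s * sin t\<bar> powr \<alpha> * sin (2 * t))" for s t
  have bound: "\<bar>f s t\<bar> \<le> (\<bar>a s\<bar> + \<bar>b s\<bar>) powr \<alpha> * indicator {0..2 * pi} t" for s t
  proof -
    have "\<bar>f s t\<bar> = indicator {0..2 * pi} t * (\<bar>a s * cos t + b s * sin t\<bar> powr \<alpha> * \<bar>sin (2 * t)\<bar>)"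
      by (simp add: f_def abs_mult)
    also have "\<dots> \<le> indicator {0..2 * pi} t * ((\<bar>a s\<bar> + \<bar>b s\<bar>) powr \<alpha> * 1)"
      by (intro mult_left_mono mult_mono abs_powr_le \<open>\<alpha> > 0\<close>) auto
    finally show ?thesis
      by (simp add: mult.commute)
  qed
  have dom: "integrable (Q \<Otimes>\<^sub>M lborel) (\<lambda>(s, t). (\<bar>a s\<bar> + \<bar>b s\<bar>) powr \<alpha> * indicator {0..2 * pi} t)"
  proof (rule Fubini_integrable)
    show "integrable Q (\<lambda>s. \<integral>t. norm (case (s, t) of (s, t) \<Rightarrow> (\<bar>a s\<bar> + \<bar>b s\<bar>) powr \<alpha> * indicator {0..2 * pi} t) \<partial>lborel)"
      using int by (simp add: abs_mult)
  qed auto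
  have fint: "integrable (Q \<Otimes>\<^sub>M lborel) (case_prod f)"
    by (rule Bochner_Integration.integrable_bound[OF dom])
      (use bound in \<open>auto simp: f_def[abs_def] intro!: AE_I2 intro: order_trans[OF _ abs_ge_self]\<close>)
  have inner: "(\<integral>t. f s t \<partial>lborel) = 2 * cos_moment \<alpha> * V \<alpha> (a s) (b s)" for s
  proof -
    have "continuous_on {0..2 * pi} (\<lambda>t. \<bar>a s * cos t + b s * sin t\<bar> powr \<alpha> * sin (2 * t))"
      using \<open>\<alpha> > 0\<close> by (intro continuous_intros)
    from set_borel_integral_eq_integral(2)[OF borel_integrable_atLeastAtMost'[OF this]]
    show ?thesis
      by (simp add: f_def set_lebesgue_integral_def angular_integral[OF \<open>\<alpha> > 0\<close>])
  qed
  have "2 * cos_moment \<alpha> * (\<integral>s. V \<alpha> (a s) (b s) \<partial>Q) = (\<integral>s. \<integral>t. f s t \<partial>lborel \<partial>Q)"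
    by (simp add: inner)
  also have "\<dots> = (\<integral>t. \<integral>s. f s t \<partial>Q \<partial>lborel)"
    by (rule Fubini_integral[symmetric, OF fint])
  also have "\<dots> = (LINT t:{0..2 * pi}|lborel. (\<integral>s. \<bar>a s * cos t + b s * sin t\<bar> powr \<alpha> \<partial>Q) * sin (2 * t))"
    by (simp add: f_def set_lebesgue_integral_def)
  finally show ?thesis .
qed

section \<open>Joint characteristic function of two values of the field\<close>

section \<open>The joint characteristic function\<close>

text \<open>Convergence in probability suffices because \<open>iexp\<close> is 1-Lipschitz and
  bounded by 1: off the event of a deviation above e/2 the difference is at most e/2, and on it at
  most 2.\<close>

lemma (in prob_space) iexp_expectation_tendsto:
  fixes Y :: "nat \<Rightarrow> 'a \<Rightarrow> real" and Z :: "'a \<Rightarrow> real"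
  assumes [measurable]: "\<And>k. Y k \<in> borel_measurable M" "Z \<in> borel_measurable M"
    and conv: "\<And>e. e > 0 \<Longrightarrow> (\<lambda>k. measure M {\<omega> \<in> space M. \<bar>Y k \<omega> - Z \<omega>\<bar> > e}) \<longlonglongrightarrow> 0"
  shows "(\<lambda>k. CLINT \<omega>|M. iexp (Y k \<omega>)) \<longlonglongrightarrow> (CLINT \<omega>|M. iexp (Z \<omega>))"
proof (rule LIMSEQ_I)
  fix e :: real assume "e > 0"
  define A where "A k = {\<omega> \<in> space M. \<bar>Y k \<omega> - Z \<omega>\<bar> > e / 2}" for k
  have [measurable]: "A k \<in> sets M" for k
    unfolding A_def by measurable
  have int: "integrable M (\<lambda>\<omega>. iexp (Y k \<omega>))" "integrable M (\<lambda>\<omega>. iexp (Z \<omega>))" for k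
    by (intro integrable_iexp; simp)+
  have dist: "norm (iexp x - iexp y) \<le> \<bar>x - y\<bar>" for x y :: real
  proof -
    have "iexp x - iexp y = iexp y * (iexp (x - y) - 1)"
      by (simp add: right_diff_distrib algebra_simps flip: exp_add)
    then have "norm (iexp x - iexp y) = norm (iexp (x - y) - 1)"
      by (simp add: norm_mult)
    then show ?thesis
      using iexp_approx1[of "x - y" 0] by simp
  qed
  have pointwise: "norm (iexp (Y k \<omega>) - iexp (Z \<omega>)) \<le> e / 2 + 2 * indicator (A k) \<omega>" if "\<omega> \<in> space M" for k \<omega>
  proof (cases "\<omega> \<in> A k")
    case True
    have "norm (iexp (Y k \<omega>) - iexp (Z \<omega>)) \<le> norm (iexp (Y k \<omega>)) + norm (iexp (Z \<omega>))"
      by (rule norm_triangle_ineq4)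
    then have "norm (iexp (Y k \<omega>) - iexp (Z \<omega>)) \<le> 2"
      by simp
    then show ?thesis
      using True \<open>e > 0\<close> by simp
  next
    case False
    then show ?thesis
      using that dist[of "Y k \<omega>" "Z \<omega>"] by (simp add: A_def)
  qed
  have "norm ((CLINT \<omega>|M. iexp (Y k \<omega>)) - (CLINT \<omega>|M. iexp (Z \<omega>))) \<le> e / 2 + 2 * measure M (A k)" for k
  proof -
    have "norm ((CLINT \<omega>|M. iexp (Y k \<omega>)) - (CLINT \<omega>|M. iexp (Z \<omega>))) = norm (CLINT \<omega>|M. iexp (Y k \<omega>) - iexp (Z \<omega>))"
      using int by simp
    also have "\<dots> \<le> (\<integral>\<omega>. norm (iexp (Y k \<omega>) - iexp (Z \<omega>)) \<partial>M)"
      by (rule integral_norm_bound)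
    also have "\<dots> \<le> (\<integral>\<omega>. e / 2 + 2 * indicator (A k) \<omega> \<partial>M)"
    proof (rule integral_mono)
      show "integrable M (\<lambda>\<omega>. norm (iexp (Y k \<omega>) - iexp (Z \<omega>)))"
        using int by (intro integrable_norm Bochner_Integration.integrable_diff)
      show "integrable M (\<lambda>\<omega>. e / 2 + 2 * indicator (A k) \<omega>)"
        by (intro Bochner_Integration.integrable_add integrable_mult_right integrable_const integrable_real_indicator)
          (simp_all add: less_top[symmetric])
    qed (rule pointwise)
    also have "\<dots> = e / 2 + 2 * measure M (A k)"
    proof -
      have "integrable M (\<lambda>\<omega>. 2 * indicator (A k) \<omega> :: real)"
        by (intro integrable_mult_right integrable_real_indicator) (simp_all add: less_top[symmetric])
      from Bochner_Integration.integral_add[OF integrable_const this, of "e / 2"] show ?thesis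
        by (simp add: prob_space)
    qed
    finally show ?thesis .
  qed
  moreover have "\<forall>\<^sub>F k in sequentially. measure M (A k) < e / 4"
    unfolding A_def using \<open>e > 0\<close> by (intro order_tendstoD(2)[OF conv]) auto
  then obtain n where "\<And>k. k \<ge> n \<Longrightarrow> measure M (A k) < e / 4"
    unfolding eventually_sequentially by blast
  ultimately show "\<exists>n. \<forall>k\<ge>n. norm ((CLINT \<omega>|M. iexp (Y k \<omega>)) - (CLINT \<omega>|M. iexp (Z \<omega>))) < e"
  proof (intro exI[of _ n] allI impI)
    fix k assume le: "\<And>k. norm ((CLINT \<omega>|M. iexp (Y k \<omega>)) - (CLINT \<omega>|M. iexp (Z \<omega>))) \<le> e / 2 + 2 * measure M (A k)"
      and "\<And>k. k \<ge> n \<Longrightarrow> measure M (A k) < e / 4" "n \<le> k"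
    then have "measure M (A k) < e / 4"
      by blast
    with le[of k] show "norm ((CLINT \<omega>|M. iexp (Y k \<omega>)) - (CLINT \<omega>|M. iexp (Z \<omega>))) < e"
      by linarith
  qed
qed

lemma iexp_linear_combination:
  fixes P :: "(int \<times> int) set"
  assumes "prob_space M" "iid_sas_innovations M \<alpha> \<epsilon>" "finite P"
  shows "(CLINT \<omega>|M. iexp (\<Sum>p\<in>P. d p * \<epsilon> p \<omega>)) = complex_of_real (exp (- (\<Sum>p\<in>P. \<bar>d p\<bar> powr \<alpha>)))"
proof -
  interpret prob_space M by fact
  have indep: "indep_vars (\<lambda>_. borel) \<epsilon> UNIV"
    and char: "\<And>p t. char (distr M borel (\<epsilon> p)) t = complex_of_real (exp (- (\<bar>t\<bar> powr \<alpha>)))"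
    using assms(2) by (auto simp: iid_sas_innovations_def)
  have [measurable]: "\<epsilon> p \<in> borel_measurable M" for p
    using indep unfolding indep_vars_def by blast
  have indep': "indep_vars (\<lambda>_. borel) (\<lambda>p \<omega>. d p * \<epsilon> p \<omega>) P"
    by (rule indep_vars_compose2[OF indep_vars_subset[OF indep]]) auto
  have "char (distr M borel (\<lambda>\<omega>. d p * \<epsilon> p \<omega>)) 1 = char (distr M borel (\<epsilon> p)) (d p)" for p
    by (simp add: char_def integral_distr)
  moreover have "(CLINT \<omega>|M. iexp (\<Sum>p\<in>P. d p * \<epsilon> p \<omega>)) = char (distr M borel (\<lambda>\<omega>. \<Sum>p\<in>P. d p * \<epsilon> p \<omega>)) 1"
    by (simp add: char_def integral_distr)
  ultimately have "(CLINT \<omega>|M. iexp (\<Sum>p\<in>P. d p * \<epsilon> p \<omega>)) = (\<Prod>p\<in>P. complex_of_real (exp (- (\<bar>d p\<bar> powr \<alpha>))))"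
    by (simp add: char_distr_sum[OF indep'] char)
  also have "\<dots> = complex_of_real (exp (- (\<Sum>p\<in>P. \<bar>d p\<bar> powr \<alpha>)))"
    using assms(3) by (simp add: exp_sum flip: sum_negf of_real_prod)
  finally show ?thesis .
qed

text \<open>In \<open>X k l\<close> the coefficient \<open>c i j\<close> multiplies the innovation at \<open>site k l (i, j)\<close>.\<close>

definition site :: "int \<Rightarrow> int \<Rightarrow> nat \<times> nat \<Rightarrow> int \<times> int" where
  "site k l = (\<lambda>(i, j). (k - int i, l - int j))"

lemma inj_site: "inj_on (site k l) F"
  by (auto simp: inj_on_def site_def)

text \<open>The coefficient of the innovation at p in the part of \<open>X k l\<close> indexed by F.
  Coefficients of field values at different places become functions on the same lattice, so linear
  combinations can be formed innovation by innovation.\<close>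

definition site_coeff :: "(nat \<Rightarrow> nat \<Rightarrow> real) \<Rightarrow> (nat \<times> nat) set \<Rightarrow> int \<Rightarrow> int \<Rightarrow> int \<times> int \<Rightarrow> real" where
  "site_coeff c F k l p = (if p \<in> site k l ` F then c (nat (k - fst p)) (nat (l - snd p)) else 0)"

lemma site_coeff_site: "site_coeff c F k l (site k l (i, j)) = (if (i, j) \<in> F then c i j else 0)"
  by (auto simp: site_coeff_def site_def image_iff)

lemma site_coeff_outside: "p \<notin> site k l ` F \<Longrightarrow> site_coeff c F k l p = 0"
  by (simp add: site_coeff_def)

lemma site_coeff_le: "\<bar>site_coeff c F k l p\<bar> \<le> \<bar>site_coeff c UNIV k l p\<bar>"
  by (auto simp: site_coeff_def)

lemma sum_site_coeff:
  fixes e :: "int \<times> int \<Rightarrow> real"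
  assumes "finite P" "site k l ` F \<subseteq> P"
  shows "(\<Sum>(i, j)\<in>F. c i j * e (k - int i, l - int j)) = (\<Sum>p\<in>P. site_coeff c F k l p * e p)"
proof -
  have "(\<Sum>p\<in>P. site_coeff c F k l p * e p) = (\<Sum>p\<in>site k l ` F. site_coeff c F k l p * e p)"
    using assms by (intro sum.mono_neutral_right) (auto simp: site_coeff_def)
  also have "\<dots> = (\<Sum>q\<in>F. site_coeff c F k l (site k l q) * e (site k l q))"
    by (simp add: sum.reindex[OF inj_site])
  also have "\<dots> = (\<Sum>(i, j)\<in>F. c i j * e (k - int i, l - int j))"
    by (rule sum.cong) (auto simp: site_coeff_site, simp add: site_def)
  finally show ?thesis ..
qed

lemma integrable_site_coeff:
  assumes "(\<lambda>(i, j). \<bar>c i j\<bar> powr \<alpha>) summable_on UNIV" "\<alpha> > 0"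
  shows "integrable (count_space UNIV) (\<lambda>p. \<bar>site_coeff c UNIV k l p\<bar> powr \<alpha>)"
proof -
  have "(\<lambda>q. \<bar>site_coeff c UNIV k l (site k l q)\<bar> powr \<alpha>) = (\<lambda>(i, j). \<bar>c i j\<bar> powr \<alpha>)"
    by (auto simp: site_coeff_site)
  then have "(\<lambda>p. \<bar>site_coeff c UNIV k l p\<bar> powr \<alpha>) summable_on site k l ` UNIV"
    using assms(1) by (simp add: summable_on_reindex[OF inj_site] comp_def)
  then have "(\<lambda>p. \<bar>site_coeff c UNIV k l p\<bar> powr \<alpha>) summable_on UNIV"
    by (rule summable_on_cong_neutral[THEN iffD1, rotated -1]) (auto simp: site_coeff_outside)
  then show ?thesis
    by (subst (asm) summable_on_iff_abs_summable_on_real) (simp only: abs_summable_equivalent abs_summable_on_def)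
qed

text \<open>From x + y <= 2 max(x, y); this crude constant covers exponents below and above 1
  alike.\<close>

lemma powr_add_le:
  fixes x y :: real
  assumes "0 \<le> x" "0 \<le> y" "\<alpha> > 0"
  shows "(x + y) powr \<alpha> \<le> 2 powr \<alpha> * (x powr \<alpha> + y powr \<alpha>)"
proof -
  have "(x + y) powr \<alpha> \<le> (2 * max x y) powr \<alpha>"
    using assms by (intro powr_mono2) auto
  also have "\<dots> = 2 powr \<alpha> * max x y powr \<alpha>"
    using assms by (simp add: powr_mult)
  also have "\<dots> \<le> 2 powr \<alpha> * (x powr \<alpha> + y powr \<alpha>)"
    by (intro mult_left_mono) (auto simp: max_def)
  finally show ?thesis .
qed

lemma integrable_powr_add:
  fixes a b :: "'i \<Rightarrow> real"
  assumes [measurable]: "a \<in> borel_measurable Q" "b \<in> borel_measurable Q" and "\<alpha> > 0"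
    and int: "integrable Q (\<lambda>p. \<bar>a p\<bar> powr \<alpha>)" "integrable Q (\<lambda>p. \<bar>b p\<bar> powr \<alpha>)"
  shows "integrable Q (\<lambda>p. (\<bar>a p\<bar> + \<bar>b p\<bar>) powr \<alpha>)"
proof (rule Bochner_Integration.integrable_bound)
  show "integrable Q (\<lambda>p. 2 powr \<alpha> * (\<bar>a p\<bar> powr \<alpha> + \<bar>b p\<bar> powr \<alpha>))"
    using int by simp
  show "AE p in Q. norm ((\<bar>a p\<bar> + \<bar>b p\<bar>) powr \<alpha>) \<le> norm (2 powr \<alpha> * (\<bar>a p\<bar> powr \<alpha> + \<bar>b p\<bar> powr \<alpha>))"
  proof (rule AE_I2)
    fix p
    show "norm ((\<bar>a p\<bar> + \<bar>b p\<bar>) powr \<alpha>) \<le> norm (2 powr \<alpha> * (\<bar>a p\<bar> powr \<alpha> + \<bar>b p\<bar> powr \<alpha>))"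
      using powr_add_le[of "\<bar>a p\<bar>" "\<bar>b p\<bar>" \<alpha>] \<open>\<alpha> > 0\<close> by simp
  qed
qed measurable

text \<open>A finite linear combination of innovations factorises by independence. Convergence in
  probability passes the left-hand side to the limit, and dominated convergence on the lattice
  passes the exponent.\<close>

lemma joint_characteristic_function:
  fixes c :: "nat \<Rightarrow> nat \<Rightarrow> real"
  assumes M: "prob_space M" and iid: "iid_sas_innovations M \<alpha> \<epsilon>" and X: "linear_random_field M c \<epsilon> X"
    and \<alpha>: "\<alpha> > 0" and summable: "(\<lambda>(i, j). \<bar>c i j\<bar> powr \<alpha>) summable_on UNIV"
  shows "(CLINT \<omega>|M. iexp (\<theta>1 * X k1 l1 \<omega> + \<theta>2 * X k2 l2 \<omega>)) = complex_of_real (exp (-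
    (\<integral>p. \<bar>\<theta>1 * site_coeff c UNIV k1 l1 p + \<theta>2 * site_coeff c UNIV k2 l2 p\<bar> powr \<alpha> \<partial>count_space UNIV)))"
proof -
  interpret prob_space M by fact
  define B where "B K = {..<K} \<times> {..<K::nat}" for K
  define P where "P K = site k1 l1 ` B K \<union> site k2 l2 ` B K" for K
  have finP: "finite (P K)" for K
    by (simp add: P_def B_def)
  define S where "S k l K \<omega> = (\<Sum>(i, j)\<in>B K. c i j * \<epsilon> (k - int i, l - int j) \<omega>)" for k l K \<omega>
  \<comment> \<open>The field is a limit along the net of finite index sets. The growing squares
    eventually contain every finite set, which gives an ordinary sequence with the same
    limit.\<close>
  have B: "filterlim B (finite_subsets_at_top UNIV) sequentially"
    unfolding filterlim_finite_subsets_at_top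
  proof (intro allI impI)
    fix F :: "(nat \<times> nat) set" assume "finite F \<and> F \<subseteq> UNIV"
    then obtain K where "fst ` F \<union> snd ` F \<subseteq> {..<K}"
      using finite_nat_iff_bounded[of "fst ` F \<union> snd ` F"] by auto
    then have "\<forall>L\<ge>K. finite (B L) \<and> F \<subseteq> B L \<and> B L \<subseteq> UNIV"
      by (fastforce simp: B_def)
    then show "\<forall>\<^sub>F K in sequentially. finite (B K) \<and> F \<subseteq> B K \<and> B K \<subseteq> UNIV"
      unfolding eventually_sequentially by blast
  qed
  have [measurable]: "\<epsilon> p \<in> borel_measurable M" for p
    using iid unfolding iid_sas_innovations_def indep_vars_def by blast
  have [measurable]: "X k l \<in> borel_measurable M" for k l
    using X by (auto simp: linear_random_field_def)
  have [measurable]: "S k l K \<in> borel_measurable M" for k l K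
    unfolding S_def[abs_def] case_prod_unfold by measurable
  have conv: "(\<lambda>K. measure M {\<omega> \<in> space M. \<bar>S k l K \<omega> - X k l \<omega>\<bar> > e}) \<longlonglongrightarrow> 0" if "e > 0" for e k l
  proof -
    have "((\<lambda>F. measure M {\<omega> \<in> space M. \<bar>(\<Sum>(i, j)\<in>F. c i j * \<epsilon> (k - int i, l - int j) \<omega>) - X k l \<omega>\<bar> > e})
        \<longlongrightarrow> 0) (finite_subsets_at_top UNIV)"
      using X that unfolding linear_random_field_def by blast
    from filterlim_compose[OF this B] show ?thesis
      unfolding S_def .
  qed
  define d where "d F p = \<theta>1 * site_coeff c F k1 l1 p + \<theta>2 * site_coeff c F k2 l2 p" for F p
  define Y where "Y K \<omega> = \<theta>1 * S k1 l1 K \<omega> + \<theta>2 * S k2 l2 K \<omega>" for K \<omega>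
  define Z where "Z \<omega> = \<theta>1 * X k1 l1 \<omega> + \<theta>2 * X k2 l2 \<omega>" for \<omega>
  have "(\<lambda>K. CLINT \<omega>|M. iexp (Y K \<omega>)) \<longlonglongrightarrow> (CLINT \<omega>|M. iexp (Z \<omega>))"
  proof (rule iexp_expectation_tendsto)
    show "Y K \<in> borel_measurable M" "Z \<in> borel_measurable M" for K
      unfolding Y_def[abs_def] Z_def[abs_def] by measurable
    fix e :: real assume "e > 0"
    \<comment> \<open>If both partial sums are within e' of their limits, the combination is within
      (|theta1| + |theta2|) e', which is less than e; the added 1 avoids a zero denominator.\<close>
    define e' where "e' = e / (2 * (\<bar>\<theta>1\<bar> + \<bar>\<theta>2\<bar> + 1))"
    have "e' > 0"
      using \<open>e > 0\<close> by (auto simp: e'_def intro!: divide_pos_pos)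
    let ?A = "\<lambda>k l K. {\<omega> \<in> space M. \<bar>S k l K \<omega> - X k l \<omega>\<bar> > e'}"
    show "(\<lambda>K. measure M {\<omega> \<in> space M. \<bar>Y K \<omega> - Z \<omega>\<bar> > e}) \<longlonglongrightarrow> 0"
    proof (rule Lim_null_comparison)
      show "(\<lambda>K. measure M (?A k1 l1 K) + measure M (?A k2 l2 K)) \<longlonglongrightarrow> 0"
        by (rule tendsto_add_zero[OF conv conv]) (rule \<open>e' > 0\<close>)+
      show "\<forall>\<^sub>F K in sequentially. norm (measure M {\<omega> \<in> space M. \<bar>Y K \<omega> - Z \<omega>\<bar> > e}) \<le>
          measure M (?A k1 l1 K) + measure M (?A k2 l2 K)"
      proof (rule always_eventually, rule allI)
        fix K
        have "{\<omega> \<in> space M. \<bar>Y K \<omega> - Z \<omega>\<bar> > e} \<subseteq> ?A k1 l1 K \<union> ?A k2 l2 K"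
        proof (rule subsetI, rule ccontr)
          fix \<omega> assume *: "\<omega> \<in> {\<omega> \<in> space M. \<bar>Y K \<omega> - Z \<omega>\<bar> > e}" "\<omega> \<notin> ?A k1 l1 K \<union> ?A k2 l2 K"
          then have le: "\<bar>S k1 l1 K \<omega> - X k1 l1 \<omega>\<bar> \<le> e'" "\<bar>S k2 l2 K \<omega> - X k2 l2 \<omega>\<bar> \<le> e'"
            by auto
          have "Y K \<omega> - Z \<omega> = \<theta>1 * (S k1 l1 K \<omega> - X k1 l1 \<omega>) + \<theta>2 * (S k2 l2 K \<omega> - X k2 l2 \<omega>)"
            by (simp add: Y_def Z_def algebra_simps)
          then have "\<bar>Y K \<omega> - Z \<omega>\<bar> \<le> \<bar>\<theta>1\<bar> * \<bar>S k1 l1 K \<omega> - X k1 l1 \<omega>\<bar> + \<bar>\<theta>2\<bar> * \<bar>S k2 l2 K \<omega> - X k2 l2 \<omega>\<bar>"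
            by (metis abs_mult abs_triangle_ineq)
          also have "\<dots> \<le> \<bar>\<theta>1\<bar> * e' + \<bar>\<theta>2\<bar> * e'"
            using le by (intro add_mono mult_left_mono) auto
          also have "\<dots> \<le> 2 * (\<bar>\<theta>1\<bar> + \<bar>\<theta>2\<bar> + 1) * e'"
            using \<open>e' > 0\<close> by (simp add: algebra_simps add_nonneg_nonneg)
          also have "\<dots> = e"
            unfolding e'_def by (simp add: add_nonneg_pos[THEN less_imp_neq, symmetric])
          finally show False
            using * by auto
        qed
        then have "measure M {\<omega> \<in> space M. \<bar>Y K \<omega> - Z \<omega>\<bar> > e} \<le> measure M (?A k1 l1 K \<union> ?A k2 l2 K)"
          by (intro finite_measure_mono) measurable
        also have "\<dots> \<le> measure M (?A k1 l1 K) + measure M (?A k2 l2 K)"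
          by (intro measure_Un_le) measurable
        finally show "norm (measure M {\<omega> \<in> space M. \<bar>Y K \<omega> - Z \<omega>\<bar> > e}) \<le>
          measure M (?A k1 l1 K) + measure M (?A k2 l2 K)"
          by simp
      qed
    qed
  qed
  moreover have "(CLINT \<omega>|M. iexp (Y K \<omega>)) = complex_of_real (exp (- (\<integral>p. \<bar>d (B K) p\<bar> powr \<alpha> \<partial>count_space UNIV)))" for K
  proof -
    \<comment> \<open>The two partial sums involve different but possibly overlapping sites. On the
      union \<open>P K\<close> the coefficients of a common innovation add up before independence is
      used.\<close>
    have "Y K \<omega> = (\<Sum>p\<in>P K. d (B K) p * \<epsilon> p \<omega>)" for \<omega>
      unfolding Y_def S_def d_def
      by (subst (1 2) sum_site_coeff[OF finP, of _ _ _ K])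
        (auto simp: P_def sum.distrib sum_distrib_left algebra_simps)
    then have "(CLINT \<omega>|M. iexp (Y K \<omega>)) = complex_of_real (exp (- (\<Sum>p\<in>P K. \<bar>d (B K) p\<bar> powr \<alpha>)))"
      using iexp_linear_combination[OF M iid finP] by simp
    also have "(\<Sum>p\<in>P K. \<bar>d (B K) p\<bar> powr \<alpha>) = (\<integral>p. \<bar>d (B K) p\<bar> powr \<alpha> \<partial>count_space UNIV)"
    proof -
      have supp: "{p \<in> UNIV. \<bar>d (B K) p\<bar> powr \<alpha> \<noteq> 0} \<subseteq> P K"
      proof (rule subsetI, rule ccontr)
        fix p assume "p \<in> {p \<in> UNIV. \<bar>d (B K) p\<bar> powr \<alpha> \<noteq> 0}" "p \<notin> P K"
        then show False
          by (simp add: d_def P_def site_coeff_outside)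
      qed
      have "(\<integral>p. \<bar>d (B K) p\<bar> powr \<alpha> \<partial>count_space UNIV) = (\<Sum>p | p \<in> UNIV \<and> \<bar>d (B K) p\<bar> powr \<alpha> \<noteq> 0. \<bar>d (B K) p\<bar> powr \<alpha>)"
        by (rule lebesgue_integral_count_space_finite_support) (rule finite_subset[OF supp finP])
      also have "\<dots> = (\<Sum>p\<in>P K. \<bar>d (B K) p\<bar> powr \<alpha>)"
        using supp by (intro sum.mono_neutral_left finP) auto
      finally show ?thesis ..
    qed
    finally show ?thesis .
  qed
  ultimately have lim1: "(\<lambda>K. complex_of_real (exp (- (\<integral>p. \<bar>d (B K) p\<bar> powr \<alpha> \<partial>count_space UNIV)))) \<longlonglongrightarrow> (CLINT \<omega>|M. iexp (Z \<omega>))"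
    by simp
  have "(\<lambda>K. \<integral>p. \<bar>d (B K) p\<bar> powr \<alpha> \<partial>count_space UNIV) \<longlonglongrightarrow> (\<integral>p. \<bar>d UNIV p\<bar> powr \<alpha> \<partial>count_space UNIV)"
  proof (rule integral_dominated_convergence)
    have scaled: "integrable (count_space UNIV) (\<lambda>p. \<bar>\<theta> * site_coeff c UNIV k l p\<bar> powr \<alpha>)" for \<theta> k l
      using integrable_mult_right[OF integrable_site_coeff[OF summable \<alpha>], of "\<bar>\<theta>\<bar> powr \<alpha>" k l]
      by (simp add: abs_mult powr_mult)
    show "integrable (count_space UNIV) (\<lambda>p. (\<bar>\<theta>1 * site_coeff c UNIV k1 l1 p\<bar> + \<bar>\<theta>2 * site_coeff c UNIV k2 l2 p\<bar>) powr \<alpha>)"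
      by (intro integrable_powr_add scaled \<alpha>) auto
    show "AE p in count_space UNIV. norm (\<bar>d (B K) p\<bar> powr \<alpha>) \<le> (\<bar>\<theta>1 * site_coeff c UNIV k1 l1 p\<bar> + \<bar>\<theta>2 * site_coeff c UNIV k2 l2 p\<bar>) powr \<alpha>" for K
    proof (rule AE_I2)
      fix p
      have "\<bar>d (B K) p\<bar> \<le> \<bar>\<theta>1 * site_coeff c (B K) k1 l1 p\<bar> + \<bar>\<theta>2 * site_coeff c (B K) k2 l2 p\<bar>"
        unfolding d_def by (rule abs_triangle_ineq)
      also have "\<dots> \<le> \<bar>\<theta>1 * site_coeff c UNIV k1 l1 p\<bar> + \<bar>\<theta>2 * site_coeff c UNIV k2 l2 p\<bar>"
        unfolding abs_mult by (intro add_mono mult_left_mono site_coeff_le) auto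
      finally show "norm (\<bar>d (B K) p\<bar> powr \<alpha>) \<le> (\<bar>\<theta>1 * site_coeff c UNIV k1 l1 p\<bar> + \<bar>\<theta>2 * site_coeff c UNIV k2 l2 p\<bar>) powr \<alpha>"
        using \<alpha> by (simp add: powr_mono2)
    qed
    have site_lim: "\<forall>\<^sub>F K in sequentially. site_coeff c (B K) k l p = site_coeff c UNIV k l p" for k l p
    proof (cases "p \<in> site k l ` UNIV")
      case True
      then obtain i j where p: "p = site k l (i, j)"
        by auto
      have "\<forall>\<^sub>F K in sequentially. i < K \<and> j < K"
        by (intro eventually_conj eventually_gt_at_top)
      then show ?thesis
        by eventually_elim (simp add: p site_coeff_site B_def)
    next
      case False
      then show ?thesis
        by (intro always_eventually allI) (auto simp: site_coeff_def)
    qed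
    have "(\<lambda>K. \<bar>d (B K) p\<bar> powr \<alpha>) \<longlonglongrightarrow> \<bar>d UNIV p\<bar> powr \<alpha>" for p
    proof (rule tendsto_eventually)
      show "\<forall>\<^sub>F K in sequentially. \<bar>d (B K) p\<bar> powr \<alpha> = \<bar>d UNIV p\<bar> powr \<alpha>"
        using site_lim[of k1 l1 p] site_lim[of k2 l2 p] by eventually_elim (simp add: d_def)
    qed
    then show "AE p in count_space UNIV. (\<lambda>K. \<bar>d (B K) p\<bar> powr \<alpha>) \<longlonglongrightarrow> \<bar>d UNIV p\<bar> powr \<alpha>"
      by simp
  qed auto
  then have "(\<lambda>K. complex_of_real (exp (- (\<integral>p. \<bar>d (B K) p\<bar> powr \<alpha> \<partial>count_space UNIV)))) \<longlonglongrightarrow>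
      complex_of_real (exp (- (\<integral>p. \<bar>d UNIV p\<bar> powr \<alpha> \<partial>count_space UNIV)))"
    by (intro tendsto_intros)
  from LIMSEQ_unique[OF lim1 this] show ?thesis
    by (simp add: Z_def d_def)
qed

section \<open>Existence of the spectral measure and the value of the covariance\<close>

section \<open>The spectral covariance\<close>

lemma measurable_spectral:
  assumes "sets \<Gamma> = sets (restrict_space borel (sphere (0 :: real \<times> real) 1))"
  shows "(\<lambda>s. fst s) \<in> borel_measurable \<Gamma>" "(\<lambda>s. snd s) \<in> borel_measurable \<Gamma>"
proof -
  have "fst \<in> borel_measurable (borel :: (real \<times> real) measure)" "snd \<in> borel_measurable (borel :: (real \<times> real) measure)"
    by (simp_all flip: borel_prod)
  then show "(\<lambda>s. fst s) \<in> borel_measurable \<Gamma>" "(\<lambda>s. snd s) \<in> borel_measurable \<Gamma>"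
    using measurable_cong_sets[OF assms refl] measurable_restrict_space1 by blast+
qed

text \<open>\<open>spectral_measure\<close> is defined by choice, so a witness is needed before
  anything about it can be used. Each pair (a p, b p) is replaced by its direction with weight
  r^alpha, halved over two antipodal points to make the measure symmetric.\<close>

lemma spectral_measure_exists:
  fixes a b :: "'i::countable \<Rightarrow> real"
  assumes "\<alpha> > 0" and int: "integrable (count_space UNIV) (\<lambda>p. \<bar>a p\<bar> powr \<alpha>)" "integrable (count_space UNIV) (\<lambda>p. \<bar>b p\<bar> powr \<alpha>)"
    and char: "\<And>\<theta>1 \<theta>2. (CLINT \<omega>|M. iexp (\<theta>1 * X1 \<omega> + \<theta>2 * X2 \<omega>)) =
      complex_of_real (exp (- (\<integral>p. \<bar>\<theta>1 * a p + \<theta>2 * b p\<bar> powr \<alpha> \<partial>count_space UNIV)))"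
  shows "\<exists>\<Gamma>. is_spectral_measure M \<alpha> X1 X2 \<Gamma>"
proof -
  \<comment> \<open>atoms of mass \<open>r p powr \<alpha> / 2\<close> at the two antipodal points in direction \<open>(a p, b p)\<close>\<close>
  define r where "r p = norm (a p, b p)" for p
  define D where "D = (\<lambda>(p, s::bool). r p powr \<alpha> / 2)"
  \<comment> \<open>Where (a p, b p) vanishes there is no direction; the point (1, 0) is a
    placeholder of weight 0 that keeps u on the circle. The boolean selects one of the two
    antipodes.\<close>
  define u where "u = (\<lambda>(p, s). (if s then 1 else - 1) *\<^sub>R (if r p = 0 then (1, 0) else (a p / r p, b p / r p)))"
  define \<Gamma> where "\<Gamma> = distr (density (count_space UNIV) D) (restrict_space borel (sphere 0 1)) u"
  have r: "r p = sqrt ((a p)\<^sup>2 + (b p)\<^sup>2)" for p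
    by (simp add: r_def norm_prod_def)
  have sphere: "u q \<in> sphere 0 1" for q
  proof -
    obtain p s where q: "q = (p, s)"
      by force
    have "norm (a p / r p, b p / r p) = 1" if "r p \<noteq> 0"
    proof -
      have "(a p / r p, b p / r p) = (1 / r p) *\<^sub>R (a p, b p)"
        by simp
      then have "norm (a p / r p, b p / r p) = \<bar>1 / r p\<bar> * r p"
        unfolding r_def by (simp only: norm_scaleR)
      then show ?thesis
        using that by (simp add: r_def)
    qed
    moreover have "norm (1 :: real, 0 :: real) = 1"
      by (simp add: norm_prod_def)
    ultimately show ?thesis
      unfolding q u_def by (simp add: norm_scaleR del: norm_Pair)
  qed
  have u [measurable]: "u \<in> measurable (density (count_space UNIV) D) (restrict_space borel (sphere 0 1))"
    using sphere by (simp add: measurable_restrict_space2)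
  have D0: "D q \<ge> 0" for q
    by (auto simp: D_def split: prod.splits)
  interpret bool: sigma_finite_measure "count_space (UNIV :: bool set)"
    by (rule sigma_finite_measure_count_space)
  interpret idx: sigma_finite_measure "count_space (UNIV :: 'i set)"
    by (rule sigma_finite_measure_count_space)
  interpret pair_sigma_finite "count_space (UNIV :: 'i set)" "count_space (UNIV :: bool set)" ..
  have prod: "count_space (UNIV :: 'i set) \<Otimes>\<^sub>M count_space (UNIV :: bool set) = count_space UNIV"
    by (subst pair_measure_countable) auto
  have integrable_bool: "integrable (count_space UNIV) (\<lambda>(p, s::bool). h p)" if "integrable (count_space UNIV) h" for h :: "'i \<Rightarrow> real"
  proof -
    have "integrable (count_space UNIV \<Otimes>\<^sub>M count_space UNIV) (\<lambda>(p, s::bool). h p)"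
    proof (rule Fubini_integrable)
      show "integrable (count_space UNIV) (\<lambda>p. \<integral>s. norm (case (p, s) of (p, s::bool) \<Rightarrow> h p) \<partial>count_space UNIV)"
        using integrable_norm[OF that] by (simp add: lebesgue_integral_count_space_finite UNIV_bool)
      show "AE p in count_space UNIV. integrable (count_space UNIV) (\<lambda>s. case (p, s) of (p, s::bool) \<Rightarrow> h p)"
        by (simp add: integrable_count_space)
    qed (simp add: prod)
    then show ?thesis
      by (simp add: prod)
  qed
  have integral_bool: "(\<integral>q. (case q of (p, s::bool) \<Rightarrow> h p) \<partial>count_space UNIV) = 2 * (\<integral>p. h p \<partial>count_space UNIV)"
    if "integrable (count_space UNIV) h" for h :: "'i \<Rightarrow> real"
  proof -
    have "integrable (count_space UNIV \<Otimes>\<^sub>M count_space UNIV) (\<lambda>(p, s::bool). h p)"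
      unfolding prod by (rule integrable_bool[OF that])
    from integral_fst'[OF this] have "(\<integral>q. (case q of (p, s::bool) \<Rightarrow> h p) \<partial>count_space UNIV) =
        (\<integral>p. \<integral>s. h p \<partial>count_space (UNIV :: bool set) \<partial>count_space UNIV)"
      unfolding prod by simp
    also have "\<dots> = (\<integral>p. 2 * h p \<partial>count_space UNIV)"
      by (simp add: lebesgue_integral_count_space_finite UNIV_bool)
    finally show ?thesis
      by simp
  qed
  have rint: "integrable (count_space UNIV) (\<lambda>p. r p powr \<alpha>)"
  proof (rule Bochner_Integration.integrable_bound)
    show "integrable (count_space UNIV) (\<lambda>p. (\<bar>a p\<bar> + \<bar>b p\<bar>) powr \<alpha>)"
      using assms by (intro integrable_powr_add) auto
    have "r p \<le> \<bar>a p\<bar> + \<bar>b p\<bar>" for p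
      unfolding r by (rule sqrt_sum_squares_le_sum_abs)
    then show "AE p in count_space UNIV. norm (r p powr \<alpha>) \<le> norm ((\<bar>a p\<bar> + \<bar>b p\<bar>) powr \<alpha>)"
      using assms(1) by (auto simp: r_def intro!: powr_mono2)
  qed auto
  have Dint: "integrable (count_space UNIV) D"
    unfolding D_def using rint by (intro integrable_bool) simp
  have fin: "finite_measure (density (count_space UNIV) D)"
  proof (rule finite_measureI)
    have "emeasure (density (count_space UNIV) D) (space (density (count_space UNIV) D)) = (\<integral>\<^sup>+q. ennreal (D q) \<partial>count_space UNIV)"
      by (simp add: emeasure_density)
    also have "\<dots> = ennreal (\<integral>q. D q \<partial>count_space UNIV)"
      using D0 by (intro nn_integral_eq_integral Dint) auto
    finally show "emeasure (density (count_space UNIV) D) (space (density (count_space UNIV) D)) \<noteq> \<infinity>"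
      by simp
  qed
  have "is_spectral_measure M \<alpha> X1 X2 \<Gamma>"
    unfolding is_spectral_measure_def
  proof (intro conjI ballI allI)
    show "space \<Gamma> = sphere 0 1" "sets \<Gamma> = sets (restrict_space borel (sphere 0 1))"
      by (simp_all add: \<Gamma>_def space_restrict_space)
    show "finite_measure \<Gamma>"
      unfolding \<Gamma>_def by (rule finite_measure.finite_measure_distr[OF fin u])
  next
    fix A assume "A \<in> sets \<Gamma>"
    then have A: "A \<in> sets (restrict_space borel (sphere 0 1))"
      by (simp add: \<Gamma>_def)
    then have "A \<in> sets borel" "A \<subseteq> sphere 0 1"
      by (auto simp: sets_restrict_space)
    have "uminus ` A = uminus -` A"
      by force
    moreover have "uminus -` A \<in> sets borel"
      using measurable_sets[of uminus borel borel A] \<open>A \<in> sets borel\<close>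
      by (simp add: borel_measurable_uminus)
    moreover have "uminus ` A \<subseteq> sphere 0 1"
    proof
      fix y assume "y \<in> uminus ` A"
      then obtain x where "y = - x" "x \<in> A"
        by blast
      then have "x \<in> sphere 0 1"
        using \<open>A \<subseteq> sphere 0 1\<close> by blast
      then show "y \<in> sphere 0 1"
        unfolding \<open>y = - x\<close> mem_sphere_0 norm_minus_cancel .
    qed
    ultimately have A': "uminus ` A \<in> sets (restrict_space borel (sphere 0 1))"
      by (auto simp: sets_restrict_space image_iff intro!: bexI[of _ "uminus -` A"])
    have em: "emeasure \<Gamma> B = (\<integral>\<^sup>+q. ennreal (D q) * indicator B (u q) \<partial>count_space UNIV)"
      if "B \<in> sets (restrict_space borel (sphere 0 1))" for B
      unfolding \<Gamma>_def using that u
      by (subst emeasure_distr) (auto simp: emeasure_density indicator_def intro!: nn_integral_cong)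
    \<comment> \<open>Negating the boolean preserves the weights and negates the points, so
      reindexing by it realises the reflection of the circle.\<close>
    let ?flip = "\<lambda>(p::'i, s::bool). (p, \<not> s)"
    have "bij ?flip"
      by (rule involuntory_imp_bij) auto
    have flip: "D (?flip q) = D q" "u (?flip q) = - u q" for q
      by (auto simp: D_def u_def split: prod.splits)
    have "emeasure \<Gamma> (uminus ` A) = (\<integral>\<^sup>+q. ennreal (D (?flip q)) * indicator (uminus ` A) (u (?flip q)) \<partial>count_space UNIV)"
      unfolding em[OF A'] by (rule nn_integral_bij_count_space[OF \<open>bij ?flip\<close>, symmetric])
    also have "\<dots> = (\<integral>\<^sup>+q. ennreal (D q) * indicator A (u q) \<partial>count_space UNIV)"
    proof -
      have "- x \<in> uminus ` A \<longleftrightarrow> x \<in> A" for x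
        by (simp only: inj_image_mem_iff[OF inj_uminus])
      then have "indicator (uminus ` A) (- x) = (indicator A x :: ennreal)" for x
        by (simp only: indicator_def)
      then show ?thesis
        by (simp only: flip)
    qed
    finally show "emeasure \<Gamma> (uminus ` A) = emeasure \<Gamma> A"
      by (simp add: em[OF A])
  next
    fix \<theta>1 \<theta>2
    let ?h = "\<lambda>p. \<bar>\<theta>1 * a p + \<theta>2 * b p\<bar> powr \<alpha>"
    have hint: "integrable (count_space UNIV) ?h"
    proof (rule Bochner_Integration.integrable_bound)
      show "integrable (count_space UNIV) (\<lambda>p. (\<bar>\<theta>1 * a p\<bar> + \<bar>\<theta>2 * b p\<bar>) powr \<alpha>)"
        using assms(1) int by (intro integrable_powr_add) (auto simp: abs_mult powr_mult)
      show "AE p in count_space UNIV. norm (?h p) \<le> norm ((\<bar>\<theta>1 * a p\<bar> + \<bar>\<theta>2 * b p\<bar>) powr \<alpha>)"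
        using assms(1) by (auto intro!: powr_mono2 abs_triangle_ineq)
    qed auto
    have meas: "(\<lambda>s. \<bar>\<theta>1 * fst s + \<theta>2 * snd s\<bar> powr \<alpha>) \<in> borel_measurable (restrict_space borel (sphere (0 :: real \<times> real) 1))"
      using measurable_spectral[OF refl] by measurable
    have "(LINT s|\<Gamma>. \<bar>\<theta>1 * fst s + \<theta>2 * snd s\<bar> powr \<alpha>) =
        (\<integral>q. D q * \<bar>\<theta>1 * fst (u q) + \<theta>2 * snd (u q)\<bar> powr \<alpha> \<partial>count_space UNIV)"
      unfolding \<Gamma>_def using D0 by (subst integral_distr[OF u meas]) (simp add: integral_density)
    also have "\<dots> = (\<integral>q. (case q of (p, s::bool) \<Rightarrow> ?h p / 2) \<partial>count_space UNIV)"
    proof (intro Bochner_Integration.integral_cong refl)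
      fix q :: "'i \<times> bool"
      obtain p s where q: "q = (p, s)"
        by force
      show "D q * \<bar>\<theta>1 * fst (u q) + \<theta>2 * snd (u q)\<bar> powr \<alpha> = (case q of (p, s) \<Rightarrow> ?h p / 2)"
      proof (cases "r p = 0")
        case True
        then have "a p = 0" "b p = 0"
          by (simp_all add: r_def zero_prod_def)
        then show ?thesis
          using True by (simp add: q D_def)
      next
        case False
        then have "r p > 0"
          by (simp add: r_def)
        have "\<bar>\<theta>1 * fst (u q) + \<theta>2 * snd (u q)\<bar> = \<bar>\<theta>1 * a p + \<theta>2 * b p\<bar> / r p"
        proof -
          have "\<theta>1 * fst (u q) + \<theta>2 * snd (u q) = (if s then 1 else -1) * ((\<theta>1 * a p + \<theta>2 * b p) / r p)"
            using False by (auto simp: q u_def add_divide_distrib)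
          then show ?thesis
            using \<open>r p > 0\<close> by (simp add: abs_mult)
        qed
        then show ?thesis
          using \<open>r p > 0\<close> by (simp add: q D_def powr_divide)
      qed
    qed
    also have "\<dots> = (\<integral>p. ?h p \<partial>count_space UNIV)"
      using hint by (subst integral_bool) auto
    finally show "(LINT \<omega>|M. iexp (\<theta>1 * X1 \<omega> + \<theta>2 * X2 \<omega>)) =
        complex_of_real (exp (- (LINT s|\<Gamma>. \<bar>\<theta>1 * fst s + \<theta>2 * snd s\<bar> powr \<alpha>)))"
      using char by simp
  qed
  then show ?thesis
    by blast
qed

text \<open>Equal characteristic functions give equal exponents for every (theta1, theta2), in
  particular for (cos t, sin t). By \<open>integral_V_eq_angular\<close> both integrals of V then
  agree after cancelling the positive \<open>cos_moment\<close>, and on the unit circle V is the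
  product of the coordinates.\<close>

lemma spectral_covariance_eq:
  fixes a b :: "'i::countable \<Rightarrow> real"
  assumes "\<alpha> > 0" and int: "integrable (count_space UNIV) (\<lambda>p. \<bar>a p\<bar> powr \<alpha>)" "integrable (count_space UNIV) (\<lambda>p. \<bar>b p\<bar> powr \<alpha>)"
    and char: "\<And>\<theta>1 \<theta>2. (CLINT \<omega>|M. iexp (\<theta>1 * X1 \<omega> + \<theta>2 * X2 \<omega>)) =
      complex_of_real (exp (- (\<integral>p. \<bar>\<theta>1 * a p + \<theta>2 * b p\<bar> powr \<alpha> \<partial>count_space UNIV)))"
  shows "spectral_covariance M \<alpha> X1 X2 = (\<integral>p. V \<alpha> (a p) (b p) \<partial>count_space UNIV)"
proof -
  define \<Gamma> where "\<Gamma> = spectral_measure M \<alpha> X1 X2"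
  have *: "is_spectral_measure M \<alpha> X1 X2 \<Gamma>"
    unfolding \<Gamma>_def spectral_measure_def by (rule someI_ex) (rule spectral_measure_exists[OF assms])
  have space: "space \<Gamma> = sphere 0 1" and sets: "sets \<Gamma> = sets (restrict_space borel (sphere 0 1))"
    and "finite_measure \<Gamma>"
    using * unfolding is_spectral_measure_def atomize_conj by (elim conjE) (intro conjI; assumption)
  have char': "\<And>\<theta>1 \<theta>2. (CLINT \<omega>|M. iexp (\<theta>1 * X1 \<omega> + \<theta>2 * X2 \<omega>)) =
        complex_of_real (exp (- (LINT s|\<Gamma>. \<bar>\<theta>1 * fst s + \<theta>2 * snd s\<bar> powr \<alpha>)))"
    using * unfolding is_spectral_measure_def by (elim conjE) (drule spec, drule spec, assumption)
  interpret finite_measure \<Gamma> by fact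
  note [measurable] = measurable_spectral[OF sets]
  have circle: "(fst s)\<^sup>2 + (snd s)\<^sup>2 = 1" if "s \<in> space \<Gamma>" for s
    using that by (simp add: space norm_prod_def)
  have eq: "(LINT s|\<Gamma>. \<bar>\<theta>1 * fst s + \<theta>2 * snd s\<bar> powr \<alpha>) = (\<integral>p. \<bar>\<theta>1 * a p + \<theta>2 * b p\<bar> powr \<alpha> \<partial>count_space UNIV)" for \<theta>1 \<theta>2
    using trans[OF char'[symmetric] char, of \<theta>1 \<theta>2] by (simp only: of_real_eq_iff exp_inj_iff neg_equal_iff_equal)
  have eq': "(\<integral>s. \<bar>fst s * cos t + snd s * sin t\<bar> powr \<alpha> \<partial>\<Gamma>) = (\<integral>p. \<bar>a p * cos t + b p * sin t\<bar> powr \<alpha> \<partial>count_space UNIV)" for t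
    using eq[of "cos t" "sin t"] by (simp only: mult.commute[of "cos t"] mult.commute[of "sin t"])
  have int\<Gamma>: "integrable \<Gamma> (\<lambda>s. (\<bar>fst s\<bar> + \<bar>snd s\<bar>) powr \<alpha>)"
  proof (rule integrable_const_bound)
    show "AE s in \<Gamma>. norm ((\<bar>fst s\<bar> + \<bar>snd s\<bar>) powr \<alpha>) \<le> 2 powr \<alpha>"
    proof (rule AE_I2)
      fix s assume "s \<in> space \<Gamma>"
      then have "(fst s)\<^sup>2 \<le> 1\<^sup>2" "(snd s)\<^sup>2 \<le> 1\<^sup>2"
        using circle[of s] by (simp_all, smt (verit) zero_le_power2)+
      then have "\<bar>fst s\<bar> \<le> 1" "\<bar>snd s\<bar> \<le> 1"
        by (simp_all add: abs_le_square_iff[symmetric] abs_square_le_1)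
      then show "norm ((\<bar>fst s\<bar> + \<bar>snd s\<bar>) powr \<alpha>) \<le> 2 powr \<alpha>"
        using assms(1) by (simp add: powr_mono2)
    qed
  qed measurable
  have "2 * cos_moment \<alpha> * (LINT s|\<Gamma>. V \<alpha> (fst s) (snd s)) =
      (LINT t:{0..2 * pi}|lborel. (\<integral>s. \<bar>fst s * cos t + snd s * sin t\<bar> powr \<alpha> \<partial>\<Gamma>) * sin (2 * t))"
    using assms(1) int\<Gamma> by (intro integral_V_eq_angular) (auto intro: sigma_finite_measure_axioms)
  also have "\<dots> = (LINT t:{0..2 * pi}|lborel. (\<integral>p. \<bar>a p * cos t + b p * sin t\<bar> powr \<alpha> \<partial>count_space UNIV) * sin (2 * t))"
    by (simp only: eq')
  also have "\<dots> = 2 * cos_moment \<alpha> * (\<integral>p. V \<alpha> (a p) (b p) \<partial>count_space UNIV)"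
    using assms(1) int by (intro integral_V_eq_angular[symmetric] integrable_powr_add sigma_finite_measure_count_space) auto
  finally have "(LINT s|\<Gamma>. V \<alpha> (fst s) (snd s)) = (\<integral>p. V \<alpha> (a p) (b p) \<partial>count_space UNIV)"
    using cos_moment_pos[OF assms(1)] by simp
  moreover have "(LINT s|\<Gamma>. V \<alpha> (fst s) (snd s)) = (LINT s|\<Gamma>. fst s * snd s)"
    by (rule Bochner_Integration.integral_cong) (auto simp: V_eq circle)
  ultimately show ?thesis
    by (simp add: spectral_covariance_def \<Gamma>_def)
qed

text \<open>An innovation contributes only if both field values contain it, that is for first
  coordinate at most 0 and second at most -m. At the site (-i, -m-j) the two coefficients are
  \<open>c i (j + m)\<close> and \<open>c (i + n) j\<close>.\<close>

lemma integral_site_coeff: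
  fixes c :: "nat \<Rightarrow> nat \<Rightarrow> real"
  assumes "\<alpha> > 0" "\<alpha> \<le> 2" and summable: "(\<lambda>(i, j). \<bar>c i j\<bar> powr \<alpha>) summable_on UNIV"
  shows "(\<integral>p. V \<alpha> (site_coeff c UNIV 0 0 p) (site_coeff c UNIV (int n) (- int m) p) \<partial>count_space UNIV) = lag_series \<alpha> c n m"
proof -
  let ?a = "site_coeff c UNIV 0 0" and ?b = "site_coeff c UNIV (int n) (- int m)"
  note int = integrable_site_coeff[OF summable assms(1)]
  have "integrable (count_space UNIV) (\<lambda>p. V \<alpha> (?a p) (?b p))"
  proof (rule Bochner_Integration.integrable_bound)
    show "integrable (count_space UNIV) (\<lambda>p. (\<bar>?a p\<bar> + \<bar>?b p\<bar>) powr \<alpha>)"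
      using assms(1) int by (intro integrable_powr_add) auto
    have "norm (V \<alpha> x y) \<le> norm ((\<bar>x\<bar> + \<bar>y\<bar>) powr \<alpha>)" for x y
    proof -
      \<comment> \<open>The exponent alpha/2 lies in [alpha-1, 1] because alpha is at most 2, and
        treats both arguments equally.\<close>
      have "\<bar>V \<alpha> x y\<bar> \<le> \<bar>x\<bar> powr (\<alpha> / 2) * \<bar>y\<bar> powr (\<alpha> - \<alpha> / 2)"
        using assms by (intro V_bound) auto
      also have "\<dots> \<le> (\<bar>x\<bar> + \<bar>y\<bar>) powr (\<alpha> / 2) * (\<bar>x\<bar> + \<bar>y\<bar>) powr (\<alpha> - \<alpha> / 2)"
        using assms by (intro mult_mono powr_mono2) auto
      also have "\<dots> = (\<bar>x\<bar> + \<bar>y\<bar>) powr \<alpha>"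
        by (simp flip: powr_add)
      finally show ?thesis
        by simp
    qed
    then show "AE p in count_space UNIV. norm (V \<alpha> (?a p) (?b p)) \<le> norm ((\<bar>?a p\<bar> + \<bar>?b p\<bar>) powr \<alpha>)"
      by simp
  qed auto
  then have "Infinite_Set_Sum.abs_summable_on (\<lambda>p. V \<alpha> (?a p) (?b p)) UNIV"
    by (simp add: abs_summable_on_def)
  then have "(\<integral>p. V \<alpha> (?a p) (?b p) \<partial>count_space UNIV) = (\<Sum>\<^sub>\<infinity>p. V \<alpha> (?a p) (?b p))"
    by (simp add: infsetsum_def flip: infsetsum_infsum)
  also have "\<dots> = (\<Sum>\<^sub>\<infinity>p\<in>site 0 (- int m) ` UNIV. V \<alpha> (?a p) (?b p))"
  proof (rule infsum_cong_neutral)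
    fix p assume p: "p \<in> UNIV - site 0 (- int m) ` UNIV"
    have "p \<notin> site 0 0 ` UNIV \<or> p \<notin> site (int n) (- int m) ` UNIV"
    proof (rule ccontr)
      assume "\<not> ?thesis"
      then have "p \<in> site 0 0 ` UNIV" "p \<in> site (int n) (- int m) ` UNIV"
        by blast+
      then obtain q q' where "p = site 0 0 q" "p = site (int n) (- int m) q'"
        by (elim imageE)
      then have "p = site 0 (- int m) (fst q, snd q')"
        by (simp add: site_def case_prod_unfold)
      then show False
        using p by blast
    qed
    then show "V \<alpha> (?a p) (?b p) = 0"
      by (auto simp: site_coeff_outside)
  qed auto
  also have "\<dots> = (\<Sum>\<^sub>\<infinity>q\<in>UNIV. V \<alpha> (?a (site 0 (- int m) q)) (?b (site 0 (- int m) q)))"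
    by (simp add: infsum_reindex[OF inj_site] comp_def)
  also have "\<dots> = (\<Sum>\<^sub>\<infinity>(i, j). V \<alpha> (c (i + n) j) (c i (j + m)))"
  proof (rule infsum_cong)
    fix q :: "nat \<times> nat"
    obtain i j where q: "q = (i, j)"
      by force
    have "site 0 (- int m) q = site 0 0 (i, j + m)" "site 0 (- int m) q = site (int n) (- int m) (i + n, j)"
      by (simp_all add: q site_def)
    then have "?a (site 0 (- int m) q) = c i (j + m)" "?b (site 0 (- int m) q) = c (i + n) j"
      using site_coeff_site[of c UNIV 0 0 i "j + m"] site_coeff_site[of c UNIV "int n" "- int m" "i + n" j] by simp_all
    then show "V \<alpha> (?a (site 0 (- int m) q)) (?b (site 0 (- int m) q)) = (case q of (i, j) \<Rightarrow> V \<alpha> (c (i + n) j) (c i (j + m)))"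
      by (simp add: q V_commute)
  qed
  finally show ?thesis
    by (simp add: lag_series_def)
qed

lemma (in coefficients) coeff_summable: "(\<lambda>(i, j). \<bar>c i j\<bar> powr \<alpha>) summable_on UNIV"
proof -
  obtain K where K: "K \<ge> 1" "\<And>i j. \<bar>w i j\<bar> \<le> K"
    using w_bounded by blast
  let ?f = "\<lambda>b i. (1 + real i) powr - (b * \<alpha>)"
  have "(\<lambda>(i, j). ?f \<beta>1 i * ?f \<beta>2 j) summable_on UNIV \<times> UNIV"
  proof (rule summable_on_SigmaI[where g="\<lambda>i. ?f \<beta>1 i * infsum (?f \<beta>2) UNIV"])
    show "((\<lambda>j. case (i, j) of (i, j) \<Rightarrow> ?f \<beta>1 i * ?f \<beta>2 j) has_sum ?f \<beta>1 i * infsum (?f \<beta>2) UNIV) UNIV" for i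
      using has_sum_cmult_right[OF has_sum_infsum[OF summable_powr_shift[OF beta_alpha(2)]]] by simp
    show "(\<lambda>i. ?f \<beta>1 i * infsum (?f \<beta>2) UNIV) summable_on UNIV"
      by (intro summable_on_cmult_left summable_powr_shift beta_alpha)
  qed auto
  then have "(\<lambda>p. K powr \<alpha> * (\<lambda>(i, j). ?f \<beta>1 i * ?f \<beta>2 j) p) summable_on UNIV"
    by (intro summable_on_cmult_right) simp
  then show ?thesis
  proof (rule summable_on_comparison_test)
    fix p :: "nat \<times> nat"
    obtain i j where p: "p = (i, j)"
      by force
    have "\<bar>c i j\<bar> powr \<alpha> = \<bar>w i j\<bar> powr \<alpha> * (?f \<beta>1 i * ?f \<beta>2 j)"
      by (simp add: field_coeff_def abs_mult powr_mult powr_powr)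
    also have "\<dots> \<le> K powr \<alpha> * (?f \<beta>1 i * ?f \<beta>2 j)"
      using K alpha by (intro mult_right_mono powr_mono2) auto
    finally show "(case p of (i, j) \<Rightarrow> \<bar>c i j\<bar> powr \<alpha>) \<le> K powr \<alpha> * (\<lambda>(i, j). ?f \<beta>1 i * ?f \<beta>2 j) p"
      by (simp add: p)
  qed auto
qed

lemma (in coefficients) field_rho_eq_lag_series:
  assumes "prob_space M" "iid_sas_innovations M \<alpha> \<epsilon>" "linear_random_field M c \<epsilon> X"
  shows "field_rho M \<alpha> c X n m = lag_series \<alpha> c n m"
proof (cases "\<alpha> < 2")
  case True
  have "spectral_covariance M \<alpha> (X 0 0) (X (int n) (- int m)) =
      (\<integral>p. V \<alpha> (site_coeff c UNIV 0 0 p) (site_coeff c UNIV (int n) (- int m) p) \<partial>count_space UNIV)"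
    by (intro spectral_covariance_eq alpha integrable_site_coeff coeff_summable joint_characteristic_function[OF assms])
  then show ?thesis
    using True by (simp add: field_rho_def integral_site_coeff[OF alpha coeff_summable])
next
  case False
  then show ?thesis
    by (simp add: field_rho_def lag_series_def)
qed

section \<open>Growth of the lags, admissible exponents, and the final case analysis\<close>

section \<open>The three relative growth rates of the lags\<close>

lemma lim_series_transfer:
  assumes "\<forall>\<^sub>F x in F. r x = l x" "lim_series (\<lambda>x. l x / g x) F a h"
  shows "lim_series (\<lambda>x. r x / g x) F a h"
proof -
  have "\<forall>\<^sub>F x in F. l x / g x = r x / g x"
    using assms(1) by eventually_elim simp
  then show ?thesis
    using assms(2) unfolding lim_series_def by (auto intro: Lim_transform_eventually)
qed

lemma lim_series_integral_transfer:
  assumes "\<forall>\<^sub>F x in F. r x = l x" "lim_series_integral (\<lambda>x. l x / g x) F h"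
  shows "lim_series_integral (\<lambda>x. r x / g x) F h"
  unfolding lim_series_integral_def
  by (rule conjI[OF _ lim_series_transfer[OF assms(1)]]) (use assms(2) in \<open>simp_all add: lim_series_integral_def\<close>)

lemma eventually_pos_seq: "\<forall>n>0. 0 < m n \<Longrightarrow> \<forall>\<^sub>F n in sequentially. (0::nat) < m n"
  by (rule eventually_mono[OF eventually_gt_at_top[of "0::nat"]]) auto

context coefficients
begin

lemma case_a_at_top:
  assumes "case_a \<beta>1 \<beta>2 m" "\<forall>n>0. m n > 0"
  shows "filterlim (\<lambda>n. real (m n) * real n powr (-\<beta>1 / \<beta>2)) at_top sequentially"
    and "filterlim m at_top sequentially"
proof -
  have pos: "\<forall>\<^sub>F n in sequentially. 0 < n" "\<forall>\<^sub>F n in sequentially. 0 < m n"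
    by (rule eventually_gt_at_top, rule eventually_pos_seq[OF assms(2)])
  note * = scaled_lag_at_top[where N="\<lambda>n. n" and M=m, OF beta_pos pos assms(1)[unfolded case_a_def]]
  show "filterlim (\<lambda>n. real (m n) * real n powr (-\<beta>1 / \<beta>2)) at_top sequentially" "filterlim m at_top sequentially"
    by (rule *)+
qed

text \<open>Divergence of m is not part of case (b). With beta1 / 2 in place of beta1 the ratio
  acquires the factor n^(-beta1/2) and tends to 0, so \<open>scaled_lag_at_top\<close>
  applies.\<close>

lemma case_b_at_top:
  assumes "case_b \<beta>1 \<beta>2 m r" "\<forall>n>0. m n > 0"
  shows "filterlim m at_top sequentially"
proof -
  have pos: "\<forall>\<^sub>F n in sequentially. 0 < n" "\<forall>\<^sub>F n in sequentially. 0 < m n"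
    by (rule eventually_gt_at_top, rule eventually_pos_seq[OF assms(2)])
  have "(\<lambda>n. real (m n) powr (-\<beta>2) / real n powr (-\<beta>1) * real n powr - (\<beta>1 / 2)) \<longlonglongrightarrow> r * 0"
    using assms(1) beta_pos by (intro tendsto_mult powr_neg_tendsto_0 filterlim_real_sequentially) (auto simp: case_b_def)
  moreover have "\<forall>\<^sub>F n in sequentially. real (m n) powr (-\<beta>2) / real n powr (-\<beta>1) * real n powr - (\<beta>1 / 2) =
      real (m n) powr (-\<beta>2) / real n powr - (\<beta>1 / 2)"
    using pos
  proof eventually_elim
    case (elim n)
    have "real n powr (-\<beta>1) = real n powr - (\<beta>1 / 2) * real n powr - (\<beta>1 / 2)"
      by (simp flip: powr_add)
    then show ?case
      using elim by simp
  qed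
  ultimately have "(\<lambda>n. real (m n) powr (-\<beta>2) / real n powr - (\<beta>1 / 2)) \<longlonglongrightarrow> r * 0"
    by (rule Lim_transform_eventually)
  then show ?thesis
    using beta_pos pos by (intro scaled_lag_at_top(2)[where N="\<lambda>n. n" and M=m and ?b1.0="\<beta>1 / 2" and ?b2.0=\<beta>2]) auto
qed

lemma case_c_tendsto_0:
  assumes "case_c \<beta>1 \<beta>2 m"
  shows "(\<lambda>n. real n powr (-\<beta>1) / real (m n) powr (-\<beta>2)) \<longlonglongrightarrow> 0"
  using tendsto_inverse_0_at_top[of "\<lambda>n. real (m n) powr (-\<beta>2) / real n powr (-\<beta>1)"] assms
  by (simp add: case_c_def)

lemma case_c_at_top:
  assumes "case_c \<beta>1 \<beta>2 m" "\<forall>n>0. m n > 0"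
  shows "filterlim (\<lambda>n. real n * real (m n) powr (-\<beta>2 / \<beta>1)) at_top sequentially"
proof -
  have pos: "\<forall>\<^sub>F n in sequentially. 0 < n" "\<forall>\<^sub>F n in sequentially. 0 < m n"
    by (rule eventually_gt_at_top, rule eventually_pos_seq[OF assms(2)])
  show ?thesis
    by (rule scaled_lag_at_top(1)[where N=m and M="\<lambda>n. n", OF beta_pos(2,1) pos(2,1) case_c_tendsto_0[OF assms(1)]])
qed

text \<open>Wanted is a point strictly between 1/beta2 and alpha - 1/beta1 that also lies in
  [alpha-1, 1]. For alpha < 2 it suffices that 1/beta1 + 1/beta2 < alpha and both reciprocals are
  below 1, which every alternative implies; for alpha = 2 the only candidate is a = 1.\<close>

lemma balanced_exponent:
  assumes "(1 < \<alpha> \<and> 1 / (\<alpha> - 1) \<le> \<beta>1 \<and> \<beta>2 > 1) \<or>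
    (1 < \<alpha> \<and> \<alpha> < 2 \<and> \<beta>1 > 1 \<and> \<beta>2 > 1 \<and> 1 / \<beta>1 + 1 / \<beta>2 < \<alpha>) \<or> (\<alpha> \<le> 1 \<and> 1 / \<beta>1 + 1 / \<beta>2 < \<alpha>)"
    and "\<alpha> < 2 \<or> 1 / (\<alpha> - 1) < \<beta>1"
  obtains a where "\<alpha> - 1 \<le> a" "a \<le> 1" "0 \<le> a" "a \<le> \<alpha>" "\<beta>1 * (\<alpha> - a) > 1" "\<beta>2 * a > 1"
proof -
  have r: "1 / \<beta>1 > 0" "1 / \<beta>2 > 0" "1 / \<beta>1 < \<alpha>" "1 / \<beta>2 < \<alpha>"
    using beta_pos beta_alpha by (simp_all add: field_simps)
  have "\<exists>a. \<alpha> - 1 \<le> a \<and> a \<le> 1 \<and> 0 \<le> a \<and> a \<le> \<alpha> \<and> 1 / \<beta>2 < a \<and> a < \<alpha> - 1 / \<beta>1"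
  proof (cases "\<alpha> < 2")
    case False
    then have "\<alpha> = 2"
      using alpha by simp
    then show ?thesis
      using assms beta_pos by (intro exI[of _ 1]) (auto simp: field_simps)
  next
    case True
    have "1 / \<beta>2 < \<alpha> - 1 / \<beta>1 \<and> 1 / \<beta>2 < 1 \<and> 1 / \<beta>1 < 1"
      using assms(1)
    proof (elim disjE)
      assume *: "1 < \<alpha> \<and> 1 / (\<alpha> - 1) \<le> \<beta>1 \<and> \<beta>2 > 1"
      then have "1 / (\<alpha> - 1) \<le> \<beta>1" "\<alpha> - 1 > 0" "1 / \<beta>2 < 1"
        by simp_all
      then have "1 \<le> \<beta>1 * (\<alpha> - 1)"
        by (simp add: pos_divide_le_eq)
      then have "1 / \<beta>1 \<le> \<alpha> - 1"
        using beta_pos by (simp add: pos_divide_le_eq mult.commute)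
      then show ?thesis
        using True \<open>1 / \<beta>2 < 1\<close> by linarith
    next
      assume *: "1 < \<alpha> \<and> \<alpha> < 2 \<and> \<beta>1 > 1 \<and> \<beta>2 > 1 \<and> 1 / \<beta>1 + 1 / \<beta>2 < \<alpha>"
      then have "1 / \<beta>1 < 1" "1 / \<beta>2 < 1"
        by simp_all
      then show ?thesis
        using * by linarith
    next
      assume "\<alpha> \<le> 1 \<and> 1 / \<beta>1 + 1 / \<beta>2 < \<alpha>"
      then show ?thesis
        using r by linarith
    qed
    moreover define l u where "l = max (1 / \<beta>2) (\<alpha> - 1)" and "u = min (\<alpha> - 1 / \<beta>1) 1"
    ultimately have "l < u"
      using True unfolding l_def u_def max_less_iff_conj min_less_iff_conj
      by (intro conjI) linarith+
    moreover have "1 / \<beta>2 \<le> l" "u \<le> \<alpha> - 1 / \<beta>1"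
      by (simp_all add: l_def u_def)
    then have "0 < l" "u < \<alpha>"
      using r by linarith+
    ultimately show ?thesis
      by (intro exI[of _ "(l + u) / 2"]) (auto simp: l_def u_def)
  qed
  then show ?thesis
    using that beta_pos by (auto simp: field_simps)
qed

text \<open>The exponent a2 is the balanced one. For a1 the smallest admissible value max(0,
  alpha-1) is taken: either it is 0, or beta2 a1 < 1 is the assumption beta2 < 1/(alpha-1).\<close>

lemma scaled_exponents:
  assumes "(1 < \<alpha> \<and> \<alpha> < 2 \<and> 1 / (\<alpha> - 1) \<le> \<beta>1 \<and> \<beta>2 > 1 \<and> \<beta>2 < 1 / (\<alpha> - 1)) \<or>
    (1 < \<alpha> \<and> \<alpha> < 2 \<and> \<beta>1 > 1 \<and> \<beta>2 > 1 \<and> \<beta>2 < 1 / (\<alpha> - 1) \<and> 1 / \<beta>1 + 1 / \<beta>2 < \<alpha>) \<or>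
    (\<alpha> \<le> 1 \<and> 1 / \<beta>1 + 1 / \<beta>2 < \<alpha>)"
  obtains a1 a2 where "\<alpha> - 1 \<le> a1" "a1 \<le> 1" "0 \<le> a1" "a1 \<le> \<alpha>" "\<beta>2 * a1 < 1"
    "\<alpha> - 1 \<le> a2" "a2 \<le> 1" "0 \<le> a2" "a2 \<le> \<alpha>" "\<beta>2 * a2 > 1" "\<beta>1 * (\<alpha> - a2) > 1"
proof -
  obtain a2 where a2: "\<alpha> - 1 \<le> a2" "a2 \<le> 1" "0 \<le> a2" "a2 \<le> \<alpha>" "\<beta>1 * (\<alpha> - a2) > 1" "\<beta>2 * a2 > 1"
    by (rule balanced_exponent) (use assms in auto)
  define a1 where "a1 = max 0 (\<alpha> - 1)"
  have "\<beta>2 * a1 < 1"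
    using assms beta_pos by (auto simp: a1_def max_def field_simps)
  then show ?thesis
    using a2 alpha by (intro that[of a1 a2]) (auto simp: a1_def)
qed

end

theorem theorem2:
  fixes M :: "'a measure"
    and \<alpha> \<beta>1 \<beta>2 :: real
    and \<epsilon> :: "int \<times> int \<Rightarrow> 'a \<Rightarrow> real"
    and X :: "int \<Rightarrow> int \<Rightarrow> 'a \<Rightarrow> real"
    and w :: "nat \<Rightarrow> nat \<Rightarrow> real"
    and wI wJ :: "nat \<Rightarrow> real"
    and \<rho> :: "nat \<Rightarrow> nat \<Rightarrow> real"
  assumes "prob_space M"
    and "0 < \<alpha>" and "\<alpha> \<le> 2"
    and "\<beta>1 > 1 / \<alpha>" and "\<beta>2 > 1 / \<alpha>"
    and "iid_sas_innovations M \<alpha> \<epsilon>"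
    and "linear_random_field M (field_coeff \<beta>1 \<beta>2 w) \<epsilon> X"
    and "\<And>i j. w i j \<noteq> 0"
    and A1: "((\<lambda>(i, j). w i j) \<longlongrightarrow> 1) (at_top \<times>\<^sub>F at_top)"
    and A2: "\<And>i. (\<lambda>j. w i j) \<longlonglongrightarrow> wI i" "\<And>i. wI i > 0"
    and A3: "\<And>j. (\<lambda>i. w i j) \<longlonglongrightarrow> wJ j" "\<And>j. wJ j > 0"
    and rho: "\<And>n m. n > 0 \<Longrightarrow> m > 0 \<Longrightarrow> \<rho> n m = field_rho M \<alpha> (field_coeff \<beta>1 \<beta>2 w) X n m"
  shows
   "((1 < \<alpha> \<and> \<alpha> \<le> 2 \<and> 1 / \<beta>1 + 1 / \<beta>2 > \<alpha> \<and>
        1 / \<alpha> < \<beta>1 \<and> \<beta>1 < 1 / (\<alpha> - 1) \<and> 1 / \<alpha> < \<beta>2 \<and> \<beta>2 < 1 / (\<alpha> - 1)) \<or>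
      (0 < \<alpha> \<and> \<alpha> \<le> 1 \<and> 1 / \<beta>1 + 1 / \<beta>2 > \<alpha>) \<longrightarrow>
     set_integrable lborel ({0<..} \<times> {0<..})
       (\<lambda>(u, v). V \<alpha> ((1 + u) powr (-\<beta>1) * v powr (-\<beta>2)) (u powr (-\<beta>1) * (1 + v) powr (-\<beta>2))) \<and>
     ((\<lambda>(n, m). \<rho> n m / (real n powr (1 - \<beta>1 * \<alpha>) * real m powr (1 - \<beta>2 * \<alpha>))) \<longlongrightarrow>
        (LINT p:{0<..} \<times> {0<..}|lborel. (case p of (u, v) \<Rightarrow>
           V \<alpha> ((1 + u) powr (-\<beta>1) * v powr (-\<beta>2)) (u powr (-\<beta>1) * (1 + v) powr (-\<beta>2)))))
       (at_top \<times>\<^sub>F at_top)) \<and>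
    (1 < \<alpha> \<and> \<alpha> \<le> 2 \<and> 1 / (\<alpha> - 1) < \<beta>1 \<and> 1 / \<alpha> < \<beta>2 \<and> \<beta>2 < 1 \<longrightarrow>
     set_integrable lborel {0<..} (\<lambda>v. v powr (-\<beta>2) * (1 + v) powr (-\<beta>2 * (\<alpha> - 1))) \<and>
     lim_series (\<lambda>(n, m). \<rho> n m / (real n powr (-\<beta>1) * real m powr (1 - \<beta>2 * \<alpha>))) (at_top \<times>\<^sub>F at_top)
       (LINT v:{0<..}|lborel. v powr (-\<beta>2) * (1 + v) powr (-\<beta>2 * (\<alpha> - 1)))
       (\<lambda>i::nat. wI i powr (\<alpha> - 1) * (1 + real i) powr (-\<beta>1 * (\<alpha> - 1)))) \<and>
    (1 < \<alpha> \<and> \<alpha> \<le> 2 \<and> \<beta>1 = 1 / (\<alpha> - 1) \<and> 1 / \<alpha> < \<beta>2 \<and> \<beta>2 < 1 \<longrightarrow>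
     set_integrable lborel {0<..} (\<lambda>v. v powr (-\<beta>2) * (1 + v) powr (-\<beta>2 * (\<alpha> - 1))) \<and>
     ((\<lambda>(n, m). \<rho> n m / (real n powr (1 - \<beta>1 * \<alpha>) * real m powr (1 - \<beta>2 * \<alpha>) * ln (real n))) \<longlongrightarrow>
        (LINT v:{0<..}|lborel. v powr (-\<beta>2) * (1 + v) powr (-\<beta>2 * (\<alpha> - 1)))) (at_top \<times>\<^sub>F at_top)) \<and>
    (1 < \<alpha> \<and> \<alpha> \<le> 2 \<and> 1 / (\<alpha> - 1) < \<beta>1 \<and> 1 / (\<alpha> - 1) < \<beta>2 \<longrightarrow>
     (\<forall>m. (\<forall>n>0. m n > 0) \<longrightarrow>
        (case_a \<beta>1 \<beta>2 m \<longrightarrow>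
          lim_series (\<lambda>n. \<rho> n (m n) / (real n powr (-\<beta>1 * (\<alpha> - 1)) * real (m n) powr (-\<beta>2))) sequentially 1
            (\<lambda>(i::nat, j::nat). wJ j powr (\<alpha> - 1) * wI i * (1 + real j) powr (-\<beta>2 * (\<alpha> - 1)) * (1 + real i) powr (-\<beta>1))) \<and>
        (\<forall>c. case_b \<beta>1 \<beta>2 m c \<longrightarrow>
          lim_series (\<lambda>n. \<rho> n (m n) / (real n powr (-\<beta>1 * (\<alpha> - 1)) * real (m n) powr (-\<beta>2))) sequentially (1 / c)
            (\<lambda>(i::nat, j::nat). V \<alpha> (wJ j * (1 + real j) powr (-\<beta>2)) (c * wI i * (1 + real i) powr (-\<beta>1)))) \<and>
        (case_c \<beta>1 \<beta>2 m \<longrightarrow>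
          lim_series (\<lambda>n. \<rho> n (m n) / (real n powr (-\<beta>1) * real (m n) powr (-\<beta>2 * (\<alpha> - 1)))) sequentially 1
            (\<lambda>(i::nat, j::nat). wJ j * wI i powr (\<alpha> - 1) * (1 + real j) powr (-\<beta>2) * (1 + real i) powr (-\<beta>1 * (\<alpha> - 1)))))) \<and>
    (1 < \<alpha> \<and> \<alpha> < 2 \<and> 1 / (\<alpha> - 1) < \<beta>1 \<and> 1 < \<beta>2 \<and> \<beta>2 < 1 / (\<alpha> - 1) \<longrightarrow>
     (\<forall>m. (\<forall>n>0. m n > 0) \<longrightarrow>
        (case_a \<beta>1 \<beta>2 m \<longrightarrow>
          lim_series_integral (\<lambda>n. \<rho> n (m n) / (real n powr (-\<beta>1 / \<beta>2) * real (m n) powr (1 - \<beta>2 * \<alpha>))) sequentially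
            (\<lambda>i v. V \<alpha> (v powr (-\<beta>2)) (wI i * (1 + real i) powr (-\<beta>1)))) \<and>
        (\<forall>c. case_b \<beta>1 \<beta>2 m c \<longrightarrow>
          lim_series (\<lambda>n. \<rho> n (m n) / (real n powr (-\<beta>1) * real (m n) powr (-\<beta>2 * (\<alpha> - 1)))) sequentially c
            (\<lambda>(i::nat, j::nat). V \<alpha> (wJ j * inverse c * (1 + real j) powr (-\<beta>2)) (wI i * (1 + real i) powr (-\<beta>1)))) \<and>
        (case_c \<beta>1 \<beta>2 m \<longrightarrow>
          lim_series (\<lambda>n. \<rho> n (m n) / (real n powr (-\<beta>1) * real (m n) powr (-\<beta>2 * (\<alpha> - 1)))) sequentially 1
            (\<lambda>(i::nat, j::nat). wJ j * wI i powr (\<alpha> - 1) * (1 + real j) powr (-\<beta>2) * (1 + real i) powr (-\<beta>1 * (\<alpha> - 1)))))) \<and>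
    ((1 < \<alpha> \<and> \<alpha> < 2 \<and> 1 < \<beta>1 \<and> \<beta>1 < 1 / (\<alpha> - 1) \<and> 1 < \<beta>2 \<and> \<beta>2 < 1 / (\<alpha> - 1) \<and>
        1 / \<beta>1 + 1 / \<beta>2 < \<alpha>) \<or>
      (0 < \<alpha> \<and> \<alpha> \<le> 1 \<and> 1 / \<beta>1 + 1 / \<beta>2 < \<alpha>) \<longrightarrow>
     (\<forall>m. (\<forall>n>0. m n > 0) \<longrightarrow>
        (case_a \<beta>1 \<beta>2 m \<longrightarrow>
          lim_series_integral (\<lambda>n. \<rho> n (m n) / (real n powr (-\<beta>1 / \<beta>2) * real (m n) powr (1 - \<beta>2 * \<alpha>))) sequentially
            (\<lambda>i v. V \<alpha> (v powr (-\<beta>2)) (wI i * (1 + real i) powr (-\<beta>1)))) \<and>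
        (\<forall>c. case_b \<beta>1 \<beta>2 m c \<longrightarrow>
          lim_series (\<lambda>n. \<rho> n (m n) / (real n powr (-\<beta>1 * (\<alpha> - 1)) * real (m n) powr (-\<beta>2))) sequentially (1 / c)
            (\<lambda>(i::nat, j::nat). V \<alpha> (wJ j * (1 + real j) powr (-\<beta>2)) (c * wI i * (1 + real i) powr (-\<beta>1)))) \<and>
        (case_c \<beta>1 \<beta>2 m \<longrightarrow>
          lim_series_integral (\<lambda>n. \<rho> n (m n) / (real n powr (1 - \<beta>1 * \<alpha>) * real (m n) powr (-\<beta>2 / \<beta>1))) sequentially
            (\<lambda>j u. V \<alpha> (u powr (-\<beta>1)) (wJ j * (1 + real j) powr (-\<beta>2)))))) \<and>
    (1 < \<alpha> \<and> \<alpha> < 2 \<and> 1 / (\<alpha> - 1) < \<beta>1 \<and> \<beta>2 = 1 / (\<alpha> - 1) \<longrightarrow>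
     (\<forall>m. (\<forall>n>0. m n > 0) \<longrightarrow>
        (case_a \<beta>1 \<beta>2 m \<longrightarrow>
          lim_series (\<lambda>n. \<rho> n (m n) / (real n powr (-\<beta>1 / \<beta>2) * real (m n) powr (1 - \<beta>2 * \<alpha>) * ln (real n powr (-\<beta>1 / \<beta>2) * real (m n)))) sequentially 1
            (\<lambda>i::nat. wI i * (1 + real i) powr (-\<beta>1))) \<and>
        (\<forall>c. case_b \<beta>1 \<beta>2 m c \<longrightarrow>
          lim_series (\<lambda>n. \<rho> n (m n) / (real n powr (-\<beta>1) * real (m n) powr (-\<beta>2 * (\<alpha> - 1)))) sequentially c
            (\<lambda>(i::nat, j::nat). V \<alpha> (wJ j * inverse c * (1 + real j) powr (-\<beta>2)) (wI i * (1 + real i) powr (-\<beta>1)))) \<and>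
        (case_c \<beta>1 \<beta>2 m \<longrightarrow>
          lim_series (\<lambda>n. \<rho> n (m n) / (real n powr (-\<beta>1) * real (m n) powr (-\<beta>2 * (\<alpha> - 1)))) sequentially 1
            (\<lambda>(i::nat, j::nat). wJ j * wI i powr (\<alpha> - 1) * (1 + real j) powr (-\<beta>2) * (1 + real i) powr (-\<beta>1 * (\<alpha> - 1)))))) \<and>
    (1 < \<alpha> \<and> \<alpha> < 2 \<and> \<beta>1 = 1 / (\<alpha> - 1) \<and> 1 < \<beta>2 \<and> \<beta>2 < 1 / (\<alpha> - 1) \<longrightarrow>
     (\<forall>m. (\<forall>n>0. m n > 0) \<longrightarrow>
        (case_a \<beta>1 \<beta>2 m \<longrightarrow>
          lim_series_integral (\<lambda>n. \<rho> n (m n) / (real n powr (-\<beta>1 / \<beta>2) * real (m n) powr (1 - \<beta>2 * \<alpha>))) sequentially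
            (\<lambda>i s. V \<alpha> (wI i * (1 + real i) powr (-\<beta>1)) (s powr (-\<beta>2)))) \<and>
        (\<forall>c. case_b \<beta>1 \<beta>2 m c \<longrightarrow>
          lim_series (\<lambda>n. \<rho> n (m n) / (real n powr (-\<beta>1) * real (m n) powr (-\<beta>2 * (\<alpha> - 1)))) sequentially c
            (\<lambda>(i::nat, j::nat). V \<alpha> (wJ j * inverse c * (1 + real j) powr (-\<beta>2)) (wI i * (1 + real i) powr (-\<beta>1)))) \<and>
        (case_c \<beta>1 \<beta>2 m \<longrightarrow>
          lim_series (\<lambda>n. \<rho> n (m n) / (real n powr (1 - \<beta>1 * \<alpha>) * real (m n) powr (-\<beta>2 / \<beta>1) * ln (real n * real (m n) powr (-\<beta>2 / \<beta>1)))) sequentially 1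
            (\<lambda>j::nat. wJ j * (1 + real j) powr (-\<beta>2))))) \<and>
    (1 < \<alpha> \<and> \<alpha> < 2 \<and> \<beta>1 = 1 / (\<alpha> - 1) \<and> \<beta>2 = 1 / (\<alpha> - 1) \<longrightarrow>
     (\<forall>m. (\<forall>n>0. m n > 0) \<longrightarrow>
        (case_a \<beta>1 \<beta>2 m \<longrightarrow>
          lim_series (\<lambda>n. \<rho> n (m n) / (real n powr (-\<beta>1 / \<beta>2) * real (m n) powr (1 - \<beta>2 * \<alpha>) * ln (real n powr (-\<beta>1 / \<beta>2) * real (m n)))) sequentially 1
            (\<lambda>i::nat. wI i * (1 + real i) powr (-\<beta>1))) \<and>
        (\<forall>c. case_b \<beta>1 \<beta>2 m c \<longrightarrow>
          lim_series (\<lambda>n. \<rho> n (m n) / (real n powr (-\<beta>1) * real (m n) powr (-\<beta>2 * (\<alpha> - 1)))) sequentially c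
            (\<lambda>(i::nat, j::nat). V \<alpha> (wJ j * inverse c * (1 + real j) powr (-\<beta>2)) (wI i * (1 + real i) powr (-\<beta>1)))) \<and>
        (case_c \<beta>1 \<beta>2 m \<longrightarrow>
          lim_series (\<lambda>n. \<rho> n (m n) / (real n powr (1 - \<beta>1 * \<alpha>) * real (m n) powr (-\<beta>2 / \<beta>1) * ln (real n * real (m n) powr (-\<beta>2 / \<beta>1)))) sequentially 1
            (\<lambda>j::nat. wJ j * (1 + real j) powr (-\<beta>2)))))"
proof -
  interpret coefficients \<alpha> \<beta>1 \<beta>2 w wI wJ
    by unfold_locales (use assms in auto)
  \<comment> \<open>Mirrored regimes: with the coordinates exchanged, case (c) takes the place of
    case (a), and lag n the place of lag m.\<close>
  interpret T: coefficients \<alpha> \<beta>2 \<beta>1 "\<lambda>i j. w j i" wJ wI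
    by (rule transposed)
  have \<rho>: "\<rho> n m = lag_series \<alpha> c n m" if "0 < n" "0 < m" for n m
    using rho[OF that] field_rho_eq_lag_series[OF assms(1,6,7)] by simp
  have ev: "\<forall>\<^sub>F n in sequentially. \<rho> n (m n) = lag_series \<alpha> c n (m n)" if "\<forall>n>0. 0 < m n" for m
    by (rule eventually_mono[OF eventually_gt_at_top[of "0::nat"]]) (use that in \<open>simp add: \<rho>\<close>)
  \<comment> \<open>The representation of rho is assumed for positive lags only, hence the threshold
    1 in both coordinates.\<close>
  have ev_prod: "\<forall>\<^sub>F p in at_top \<times>\<^sub>F at_top. (\<lambda>(n, m). lag_series \<alpha> c n m / g n m) p = (\<lambda>(n, m). \<rho> n m / g n m) p" for g
    unfolding eventually_prod_sequentially by (intro exI[of _ 1]) (auto simp: \<rho>)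
  note transfer = lim_series_transfer[OF ev] lim_series_integral_transfer[OF ev]
  note id = filterlim_ident[of sequentially]
  have unbalanced: "lim_series (\<lambda>n. \<rho> n (m n) / (real n powr (-\<beta>1) * real (m n) powr (-\<beta>2 * (\<alpha> - 1)))) sequentially 1
      (\<lambda>(i, j). wJ j * wI i powr (\<alpha> - 1) * (1 + real j) powr (-\<beta>2) * (1 + real i) powr (-\<beta>1 * (\<alpha> - 1)))"
    if "1 < \<alpha>" "1 / (\<alpha> - 1) < \<beta>1" "1 < \<beta>2" "\<forall>n>0. 0 < m n" "case_c \<beta>1 \<beta>2 m" for m
    using that by (intro transfer limit_unbalanced id case_c_tendsto_0) (auto simp: case_c_def field_simps)
  have balanced: "lim_series (\<lambda>n. \<rho> n (m n) / (real n powr (-\<beta>1) * real (m n) powr (-\<beta>2 * (\<alpha> - 1)))) sequentially r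
      (\<lambda>(i, j). V \<alpha> (wJ j * inverse r * (1 + real j) powr (-\<beta>2)) (wI i * (1 + real i) powr (-\<beta>1)))"
    "lim_series (\<lambda>n. \<rho> n (m n) / (real n powr (-\<beta>1 * (\<alpha> - 1)) * real (m n) powr (-\<beta>2))) sequentially (1 / r)
      (\<lambda>(i, j). V \<alpha> (wJ j * (1 + real j) powr (-\<beta>2)) (r * wI i * (1 + real i) powr (-\<beta>1)))"
    if hyp: "(1 < \<alpha> \<and> 1 / (\<alpha> - 1) \<le> \<beta>1 \<and> \<beta>2 > 1) \<or>
        (1 < \<alpha> \<and> \<alpha> < 2 \<and> \<beta>1 > 1 \<and> \<beta>2 > 1 \<and> 1 / \<beta>1 + 1 / \<beta>2 < \<alpha>) \<or> (\<alpha> \<le> 1 \<and> 1 / \<beta>1 + 1 / \<beta>2 < \<alpha>)"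
      "\<alpha> < 2 \<or> 1 / (\<alpha> - 1) < \<beta>1" "\<forall>n>0. 0 < m n" "case_b \<beta>1 \<beta>2 m r" for m r
  proof -
    obtain a where a: "\<alpha> - 1 \<le> a" "a \<le> 1" "0 \<le> a" "a \<le> \<alpha>" "\<beta>1 * (\<alpha> - a) > 1" "\<beta>2 * a > 1"
      by (rule balanced_exponent[OF hyp(1,2)])
    have "0 < r" "(\<lambda>n. real (m n) powr -\<beta>2 / real n powr -\<beta>1) \<longlonglongrightarrow> r"
      using hyp(4) by (auto simp: case_b_def)
    note lim = limit_balanced[OF id case_b_at_top[OF hyp(4,3)] a this(2,1)]
    show "lim_series (\<lambda>n. \<rho> n (m n) / (real n powr (-\<beta>1) * real (m n) powr (-\<beta>2 * (\<alpha> - 1)))) sequentially r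
        (\<lambda>(i, j). V \<alpha> (wJ j * inverse r * (1 + real j) powr (-\<beta>2)) (wI i * (1 + real i) powr (-\<beta>1)))"
      "lim_series (\<lambda>n. \<rho> n (m n) / (real n powr (-\<beta>1 * (\<alpha> - 1)) * real (m n) powr (-\<beta>2))) sequentially (1 / r)
        (\<lambda>(i, j). V \<alpha> (wJ j * (1 + real j) powr (-\<beta>2)) (r * wI i * (1 + real i) powr (-\<beta>1)))"
      by (rule transfer(1)[OF hyp(3) lim(1)], rule transfer(1)[OF hyp(3) lim(2)])
  qed
  have scaled: "lim_series_integral (\<lambda>n. \<rho> n (m n) / (real n powr (-\<beta>1 / \<beta>2) * real (m n) powr (1 - \<beta>2 * \<alpha>))) sequentially
      (\<lambda>i v. V \<alpha> (v powr (-\<beta>2)) (wI i * (1 + real i) powr (-\<beta>1)))"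
    if "(1 < \<alpha> \<and> \<alpha> < 2 \<and> 1 / (\<alpha> - 1) \<le> \<beta>1 \<and> \<beta>2 > 1 \<and> \<beta>2 < 1 / (\<alpha> - 1)) \<or>
        (1 < \<alpha> \<and> \<alpha> < 2 \<and> \<beta>1 > 1 \<and> \<beta>2 > 1 \<and> \<beta>2 < 1 / (\<alpha> - 1) \<and> 1 / \<beta>1 + 1 / \<beta>2 < \<alpha>) \<or>
        (\<alpha> \<le> 1 \<and> 1 / \<beta>1 + 1 / \<beta>2 < \<alpha>)" "\<forall>n>0. 0 < m n" "case_a \<beta>1 \<beta>2 m" for m
    by (rule scaled_exponents[OF that(1)])
      (rule transfer(2)[OF that(2) limit_scaled[OF id case_a_at_top(2,1)[OF that(3,2)]]])
  have log: "lim_series (\<lambda>n. \<rho> n (m n) / (real n powr (-\<beta>1 / \<beta>2) * real (m n) powr (1 - \<beta>2 * \<alpha>) * ln (real n powr (-\<beta>1 / \<beta>2) * real (m n)))) sequentially 1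
      (\<lambda>i. wI i * (1 + real i) powr (-\<beta>1))"
    if "1 < \<alpha>" "\<alpha> < 2" "\<beta>2 = 1 / (\<alpha> - 1)" "\<beta>1 > 1" "\<forall>n>0. 0 < m n" "case_a \<beta>1 \<beta>2 m" for m
    by (rule transfer(1)[OF that(5) limit_log[OF id case_a_at_top(2,1)[OF that(6,5)]]]) (use that in auto)
  have unbalanced': "lim_series (\<lambda>n. \<rho> n (m n) / (real n powr (-\<beta>1 * (\<alpha> - 1)) * real (m n) powr (-\<beta>2))) sequentially 1
      (\<lambda>(i, j). wJ j powr (\<alpha> - 1) * wI i * (1 + real j) powr (-\<beta>2 * (\<alpha> - 1)) * (1 + real i) powr (-\<beta>1))"
    if "1 < \<alpha>" "1 / (\<alpha> - 1) < \<beta>2" "1 < \<beta>1" "\<forall>n>0. 0 < m n" "case_a \<beta>1 \<beta>2 m" for m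
  proof -
    have "\<beta>2 * (\<alpha> - 1) > 1"
      using that by (simp add: field_simps)
    note lim = T.limit_unbalanced[OF case_a_at_top(2)[OF that(5,4)] id that(1) this that(3) that(5)[unfolded case_a_def],
        unfolded lag_series_transposed]
    show ?thesis
      by (rule transfer(1)[OF that(4)], subst lim_series_swap) (use lim in \<open>simp only: mult_ac\<close>)
  qed
  have log': "lim_series (\<lambda>n. \<rho> n (m n) / (real n powr (1 - \<beta>1 * \<alpha>) * real (m n) powr (-\<beta>2 / \<beta>1) * ln (real n * real (m n) powr (-\<beta>2 / \<beta>1)))) sequentially 1
      (\<lambda>j. wJ j * (1 + real j) powr (-\<beta>2))"
    if "1 < \<alpha>" "\<alpha> < 2" "\<beta>1 = 1 / (\<alpha> - 1)" "\<beta>2 > 1" "\<forall>n>0. 0 < m n" "case_c \<beta>1 \<beta>2 m" for m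
  proof -
    have "\<beta>1 * (\<alpha> - 1) = 1" "filterlim m at_top sequentially"
      using that by (auto simp: case_c_def)
    note lim = T.limit_log[OF this(2) id case_c_at_top[OF that(6,5)] that(1) this(1) that(4,2), unfolded lag_series_transposed]
    show ?thesis
      by (rule transfer(1)[OF that(5)]) (use lim in \<open>simp only: mult_ac\<close>)
  qed
  have scaled': "lim_series_integral (\<lambda>n. \<rho> n (m n) / (real n powr (1 - \<beta>1 * \<alpha>) * real (m n) powr (-\<beta>2 / \<beta>1))) sequentially
      (\<lambda>j u. V \<alpha> (u powr (-\<beta>1)) (wJ j * (1 + real j) powr (-\<beta>2)))"
    if hyp: "(1 < \<alpha> \<and> \<alpha> < 2 \<and> \<beta>1 > 1 \<and> \<beta>2 > 1 \<and> \<beta>1 < 1 / (\<alpha> - 1) \<and> 1 / \<beta>1 + 1 / \<beta>2 < \<alpha>) \<or>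
        (\<alpha> \<le> 1 \<and> 1 / \<beta>1 + 1 / \<beta>2 < \<alpha>)" "\<forall>n>0. 0 < m n" "case_c \<beta>1 \<beta>2 m" for m
  proof -
    have m: "filterlim m at_top sequentially"
      using hyp by (auto simp: case_c_def)
    obtain a1 a2 where a: "\<alpha> - 1 \<le> a1" "a1 \<le> 1" "0 \<le> a1" "a1 \<le> \<alpha>" "\<beta>1 * a1 < 1"
        "\<alpha> - 1 \<le> a2" "a2 \<le> 1" "0 \<le> a2" "a2 \<le> \<alpha>" "\<beta>1 * a2 > 1" "\<beta>2 * (\<alpha> - a2) > 1"
      by (rule T.scaled_exponents) (use hyp(1) in \<open>auto simp: add.commute\<close>)
    note lim = T.limit_scaled[OF m id case_c_at_top[OF hyp(3,2)] a, unfolded lag_series_transposed]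
    show ?thesis
      by (rule transfer(2)[OF hyp(2)]) (use lim in \<open>simp only: mult_ac\<close>)
  qed
  \<comment> \<open>Since alpha is at most 2, the threshold 1/(alpha-1) is at least 1, so exceeding
    it provides the bound b > 1 that the regimes ask for.\<close>
  have gt1: "1 < b" if "1 < \<alpha>" "1 / (\<alpha> - 1) < b" for b
  proof -
    have "1 \<le> 1 / (\<alpha> - 1)"
      using that(1) assms(3) by simp
    then show ?thesis
      using that(2) by linarith
  qed
  have gt1': "1 < 1 / (\<alpha> - 1)" if "1 < \<alpha>" "\<alpha> < 2"
    using that by simp
  show ?thesis
  proof (intro conjI impI allI, goal_cases)
    \<comment> \<open>Goals 1 to 6 come in pairs, convergence of the integral and then the limit,
      for the first three items. From goal 7 on, each item contributes its sub-cases (a), (b), (c)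
      in this order.\<close>
    case 1
    then show ?case
      by (intro limit_both_linear(1)) auto
  next
    case 2
    then show ?case
      by (intro Lim_transform_eventually[OF limit_both_linear(2) ev_prod]) auto
  next
    case 3
    then show ?case
      by (intro limit_const_linear(1)) auto
  next
    case 4
    then show ?case
      by (intro iffD1[OF lim_series_cong[OF ev_prod refl] limit_const_linear(2)]) auto
  next
    case 5
    then show ?case
      by (intro limit_log_linear(1)) auto
  next
    case 6
    then show ?case
      by (intro Lim_transform_eventually[OF limit_log_linear(2) ev_prod]) auto
  next
    case (7 m)
    then show ?case
      using gt1[of \<beta>1] by (intro unbalanced') auto
  next
    case (8 m r)
    then show ?case
      using gt1[of \<beta>2] by (intro balanced(2)) auto
  next
    case (9 m)
    then show ?case
      using gt1[of \<beta>2] by (intro unbalanced) auto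
  next
    case (10 m)
    then show ?case
      by (intro scaled) auto
  next
    case (11 m r)
    then show ?case
      by (intro balanced(1)) auto
  next
    case (12 m)
    then show ?case
      by (intro unbalanced) auto
  next
    case (13 m)
    then show ?case
      by (intro scaled) auto
  next
    case (14 m r)
    then show ?case
      by (intro balanced(2)) auto
  next
    case (15 m)
    then show ?case
      by (intro scaled') auto
  next
    case (16 m)
    then show ?case
      using gt1[of \<beta>1] by (intro log) auto
  next
    case (17 m r)
    then show ?case
      using gt1' by (intro balanced(1)) auto
  next
    case (18 m)
    then show ?case
      using gt1' by (intro unbalanced) auto
  next
    case (19 m)
    then show ?case
      \<comment> \<open>In this sub-case the integrand is stated with the two arguments of V in the
        opposite order from \<open>scaled\<close>.\<close>
      by (subst V_commute) (intro scaled; auto)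
  next
    case (20 m r)
    then show ?case
      by (intro balanced(1)) auto
  next
    case (21 m)
    then show ?case
      by (intro log') auto
  next
    case (22 m)
    then show ?case
      using gt1' by (intro log) auto
  next
    case (23 m r)
    then show ?case
      using gt1' by (intro balanced(1)) auto
  next
    case (24 m)
    then show ?case
      using gt1' by (intro log') auto
  qed
qed

end
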